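(* Let $\mathcal{F}$ be a countable generating subset of $\mathcal{B}$, and let $W_1,W_2,\ldots$ be $\mathcal{Z}$-graphons each having finite range (i.e. each $W_n$ takes only finitely many values), such that: (i) for every $1\le p<\infty$ there is a constant $c_p>0$ with $\|W_n\|_p\le c_p$ for all $n$; (ii) the sequence $(t(\mathbf{F},W_n))_{n\ge1}$ is convergent for every $\mathcal{F}$-decorated graph $\mathbf{F}$. Then there exists a $\mathcal{Z}$-graphon $W$ such that $t(\mathbf{F},W_n)\to t(\mathbf{F},W)$ for every $\mathcal{B}$-decorated graph $\mathbf{F}$.
   Context: $\mathcal{B}$ is a separable real Banach space and $\mathcal{Z}$ its dual; $\langle b,z\rangle$ denotes the action of $b\in\mathcal{B}$ on $z\in\mathcal{Z}$. A function $W:[0,1]^2\to\mathcal{Z}$ is weak-* measurable if $(x,y)\mapsto\langle b,W(x,y)\rangle$ is measurable for every $b\in\mathcal{B}$. Let $\mathbb{L}=\bigcap_{1\le p<\infty}L^p_{\mathrm{sym}}([0,1]^2)$. A $\mathcal{Z}$-graphon is a symmetric weak-* measurable $W:[0,1]^2\to\mathcal{Z}$ such that $(x,y)\mapsto\|W(x,y)\|_{\mathcal{Z}}$ lies in $\mathbb{L}$; $\|W\|_p$ denotes the $L^p([0,1]^2)$-norm of $(x,y)\mapsto\|W(x,y)\|_{\mathcal{Z}}$. A subset $\mathcal{F}\subseteq\mathcal{B}$ is generating if the closure of its linear span is $\mathcal{B}$. A $\mathcal{B}$-decorated graph $\mathbf{F}=(F,f)$ is a finite simple graph $F$ on vertex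 set $[k]$ with a map $f:E(F)\to\mathcal{B}$; it is $\mathcal{F}$-decorated if $f$ takes values in $\mathcal{F}$. For a $\mathcal{Z}$-graphon $W$, $t(\mathbf{F},W)=\int_{[0,1]^k}\prod_{ij\in E(F)}\langle f(ij),W(x_i,x_j)\rangle\,dx_1\cdots dx_k$. *)

theory Defs
  imports "HOL-Analysis.Analysis"
begin

text \<open>
  Conventions. The dual space of a real Banach space \<open>'b\<close> is the normed space \<open>'b \<Rightarrow>\<^sub>L real\<close> of
  bounded linear functionals with the operator norm, and the pairing of \<open>b\<close> with \<open>z\<close> is
  \<open>blinfun_apply z b\<close>. Functions on the unit square are total functions on \<open>real \<times> real\<close> of which
  only the values on \<open>unit_square\<close> are ever used. ``Measurable'' means Lebesgue measurable.
\<close>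

abbreviation unit_square :: "(real \<times> real) set"
  where "unit_square \<equiv> {0..1} \<times> {0..1}"

definition symmetric_on_square :: "(real \<times> real \<Rightarrow> 'a) \<Rightarrow> bool"
  where "symmetric_on_square g \<longleftrightarrow> (\<forall>x\<in>{0..1}. \<forall>y\<in>{0..1}. g (x, y) = g (y, x))"

definition Lp_sym :: "real \<Rightarrow> (real \<times> real \<Rightarrow> real) set"
  where "Lp_sym p = {g. symmetric_on_square g \<and>
    g \<in> borel_measurable (lebesgue_on unit_square) \<and>
    integrable (lebesgue_on unit_square) (\<lambda>u. \<bar>g u\<bar> powr p)}"

definition L_all :: "(real \<times> real \<Rightarrow> real) set"
  where "L_all = (\<Inter>p\<in>{1..}. Lp_sym p)"

definition weak_star_measurable ::
    "(real \<times> real \<Rightarrow> ('b::real_normed_vector \<Rightarrow>\<^sub>L real)) \<Rightarrow> bool"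
  where "weak_star_measurable W \<longleftrightarrow>
    (\<forall>b. (\<lambda>u. blinfun_apply (W u) b) \<in> borel_measurable (lebesgue_on unit_square))"

definition graphon :: "(real \<times> real \<Rightarrow> ('b::real_normed_vector \<Rightarrow>\<^sub>L real)) \<Rightarrow> bool"
  where "graphon W \<longleftrightarrow>
    symmetric_on_square W \<and> weak_star_measurable W \<and> (\<lambda>u. norm (W u)) \<in> L_all"

definition graphon_norm ::
    "real \<Rightarrow> (real \<times> real \<Rightarrow> ('b::real_normed_vector \<Rightarrow>\<^sub>L real)) \<Rightarrow> real"
  where "graphon_norm p W =
    (\<integral>u. norm (W u) powr p \<partial>(lebesgue_on unit_square)) powr (1 / p)"

definition generating :: "'b::real_normed_vector set \<Rightarrow> bool"
  where "generating \<F> \<longleftrightarrow> closure (span \<F>) = UNIV"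

definition simple_graph :: "nat \<Rightarrow> nat set set \<Rightarrow> bool"
  where "simple_graph k E \<longleftrightarrow> (\<forall>e\<in>E. e \<subseteq> {1..k} \<and> card e = 2)"

text \<open>
  A decorated graph is given by its number \<open>k\<close> of vertices, its edge set \<open>E\<close> and the decoration \<open>f\<close>,
  of which only the values on \<open>E\<close> matter. Taking \<open>\<F> = UNIV\<close> gives all \<open>'b\<close>-decorated graphs.
\<close>

definition decorated_graph ::
    "'b set \<Rightarrow> nat \<Rightarrow> nat set set \<Rightarrow> (nat set \<Rightarrow> 'b) \<Rightarrow> bool"
  where "decorated_graph \<F> k E f \<longleftrightarrow> simple_graph k E \<and> (\<forall>e\<in>E. f e \<in> \<F>)"

text \<open>
  Completing the product of the Borel measures on \<open>[0,1]\<close> yields Lebesgue measure on the cube. The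
  completion is needed: for a merely Lebesgue measurable \<open>W\<close> the integrand below need not be
  measurable for the product sigma-algebra, and its integral would then be 0 by convention.
\<close>

definition lebesgue_cube :: "nat \<Rightarrow> (nat \<Rightarrow> real) measure"
  where "lebesgue_cube k = completion (\<Pi>\<^sub>M i\<in>{1..k}. restrict_space lborel {0..1})"

text \<open>
  An edge \<open>{i, j}\<close> is evaluated at its endpoints in increasing order; by the symmetry of graphons the
  order is immaterial.
\<close>

definition hom_density ::
    "nat \<Rightarrow> nat set set \<Rightarrow> (nat set \<Rightarrow> 'b) \<Rightarrow>
      (real \<times> real \<Rightarrow> ('b::real_normed_vector \<Rightarrow>\<^sub>L real)) \<Rightarrow> real"
  where "hom_density k E f W =
    (\<integral>x. (\<Prod>e\<in>E. blinfun_apply (W (x (Min e), x (Max e))) (f e)) \<partial>(lebesgue_cube k))"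

end

theory Submission
  imports Defs "HOL-Probability.Probability"
begin

text \<open>
  Fix countably many test vectors \<open>d\<^sub>j\<close>, dense in the space and containing \<open>\<F>\<close>, and
  consider the scalar kernels \<open>\<langle>d\<^sub>j, W\<^sub>n\<rangle>\<close> together with \<open>\<parallel>W\<^sub>n\<parallel>\<close>. For each \<open>n\<close> an energy increment
  argument gives nested partitions of \<open>[0,1]\<close>, with sizes independent of \<open>n\<close>, whose block averages
  approximate these kernels in cut norm. Along a subsequence all cell measures and block integrals
  converge. The limiting partitions can be realised by intervals, and the limiting block averages are
  an \<open>L\<^sup>2\<close>-bounded martingale on the unit square, whose limits \<open>u\<^sub>j\<close> and \<open>u\<close> satisfy every linear
  inequality satisfied by the given kernels. In particular
  \<open>\<bar>q u\<^sub>a + q' u\<^sub>b - u\<^sub>c\<bar> \<le> \<parallel>q d\<^sub>a + q' d\<^sub>b - d\<^sub>c\<parallel> u\<close> almost everywhere for rational \<open>q, q'\<close>, so almost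
  every point of the square carries a functional of norm at most \<open>u\<close> with values \<open>u\<^sub>j\<close> at \<open>d\<^sub>j\<close>.
  Densities are continuous in cut norm on kernels with bounded moments: truncating the kernels of all
  edges but one at a large height costs little, and a bounded product splits into functions of the two
  endpoints of the remaining edge.
\<close>

section \<open>Kernels with bounded moments and the counting lemma\<close>

text \<open>The kernels are unbounded and take values in a dual space on which only pairings with
  fixed vectors are measurable. Hence every estimate is made for scalar kernels, and boundedness is
  replaced by one sequence of integer moments valid for all \<open>n\<close>. Three requirements fix
  the shape. (a) A density mixes the pairings of different edges over the same vertices, so for each
  \<open>n\<close> one partition of the vertex space must serve all scalar kernels; the partition at
  level \<open>k\<close> treats the first \<open>k + 1\<close> of them. (b) The limit must again be
  dual valued. Linear inequalities survive block averaging and limits, so the norm is carried along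
  as a kernel of its own, and a bound on an absolute value is written as two linear inequalities.
  Rational coefficients keep the exceptional null sets countable in number. (c) The partitions found
  for different \<open>n\<close> are unrelated. Only cell measures and block integrals are compared,
  never points; this is enough because the density of a step kernel is a polynomial in these
  numbers. Compactness yields a subsequence only; the assumed convergence for \<F>-decorated graphs
  brings back the whole sequence.\<close>

definition moments_le :: "'a measure \<Rightarrow> ('a \<Rightarrow> real) \<Rightarrow> (nat \<Rightarrow> real) \<Rightarrow> bool" where
  "moments_le N h C \<longleftrightarrow> h \<in> borel_measurable N \<and>
     (\<forall>q. integrable N (\<lambda>u. \<bar>h u\<bar> ^ q) \<and> (\<integral>u. \<bar>h u\<bar> ^ q \<partial>N) \<le> C q)"

text \<open>Signed test functions instead of sets: freezing all other vertices leaves exactly a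
  product of one bounded function of each endpoint, which can be inserted after scaling.\<close>

definition cut_le :: "'a measure \<Rightarrow> ('a \<times> 'a \<Rightarrow> real) \<Rightarrow> real \<Rightarrow> bool" where
  "cut_le M h \<epsilon> \<longleftrightarrow> (\<forall>f\<in>borel_measurable M. \<forall>g\<in>borel_measurable M.
     (\<forall>x. \<bar>f x\<bar> \<le> 1) \<longrightarrow> (\<forall>x. \<bar>g x\<bar> \<le> 1) \<longrightarrow>
     \<bar>\<integral>u. h u * (f (fst u) * g (snd u)) \<partial>(M \<Otimes>\<^sub>M M)\<bar> \<le> \<epsilon>)"

text \<open>Each edge has a kernel of its own, since kernels are exchanged one edge at a time; no
  symmetry is assumed, so \<open>Min\<close> and \<open>Max\<close> fix the orientation.\<close>

definition graph_density ::
    "'a measure \<Rightarrow> nat \<Rightarrow> nat set set \<Rightarrow> (nat set \<Rightarrow> 'a \<times> 'a \<Rightarrow> real) \<Rightarrow> real" where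
  "graph_density M k E h =
     (\<integral>x. (\<Prod>e\<in>E. h e (x (Min e), x (Max e))) \<partial>(\<Pi>\<^sub>M i\<in>{1..k}. M))"

text \<open>The quantifiers express uniformity: \<delta> may depend on the number of edges and the
  moment bounds, but not on the graph or the kernels, so that it can be fixed before
  \<open>n\<close>.\<close>

definition density_modulus :: "'a measure \<Rightarrow> nat \<Rightarrow> (nat \<Rightarrow> real) \<Rightarrow> real \<Rightarrow> real \<Rightarrow> bool" where
  "density_modulus M m C \<delta> \<eta> \<longleftrightarrow> (\<forall>k E h h'. simple_graph k E \<longrightarrow> card E = m \<longrightarrow>
     (\<forall>e\<in>E. moments_le (M \<Otimes>\<^sub>M M) (h e) C \<and> moments_le (M \<Otimes>\<^sub>M M) (h' e) C \<and>
        cut_le M (\<lambda>u. h e u - h' e u) \<delta>) \<longrightarrow>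
     \<bar>graph_density M k E h - graph_density M k E h'\<bar> \<le> \<eta>)"

lemma density_modulusD:
  assumes "density_modulus M m C \<delta> \<eta>" "simple_graph k E" "card E = m"
    and "\<And>e. e \<in> E \<Longrightarrow> moments_le (M \<Otimes>\<^sub>M M) (h e) C" "\<And>e. e \<in> E \<Longrightarrow> moments_le (M \<Otimes>\<^sub>M M) (h' e) C"
    and "\<And>e. e \<in> E \<Longrightarrow> cut_le M (\<lambda>u. h e u - h' e u) \<delta>"
  shows "\<bar>graph_density M k E h - graph_density M k E h'\<bar> \<le> \<eta>"
  using assms unfolding density_modulus_def by blast

lemma cut_le_mono: "cut_le M h \<epsilon> \<Longrightarrow> \<epsilon> \<le> \<epsilon>' \<Longrightarrow> cut_le M h \<epsilon>'"
  unfolding cut_le_def by fastforce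

lemma moments_leD:
  assumes "moments_le N h C"
  shows "h \<in> borel_measurable N" "integrable N (\<lambda>u. \<bar>h u\<bar> ^ q)" "(\<integral>u. \<bar>h u\<bar> ^ q \<partial>N) \<le> C q"
    "integrable N h" "C q \<ge> 0"
proof -
  show 1: "h \<in> borel_measurable N" "integrable N (\<lambda>u. \<bar>h u\<bar> ^ q)" "(\<integral>u. \<bar>h u\<bar> ^ q \<partial>N) \<le> C q"
    using assms by (auto simp: moments_le_def)
  have "integrable N (\<lambda>u. \<bar>h u\<bar> ^ 1)" using assms unfolding moments_le_def by blast
  then show "integrable N h" using 1(1) by (simp add: integrable_abs_iff)
  have "0 \<le> (\<integral>u. \<bar>h u\<bar> ^ q \<partial>N)" by (rule Bochner_Integration.integral_nonneg) auto
  with 1(3) show "C q \<ge> 0" by linarith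
qed

lemma moments_le_mono:
  assumes "moments_le N h C" "\<And>q. C q \<le> D q"
  shows "moments_le N h D"
  using assms unfolding moments_le_def by (meson order_trans)

lemma moments_le_dominated:
  assumes "moments_le N h C" "h' \<in> borel_measurable N" "AE u in N. \<bar>h' u\<bar> \<le> \<bar>h u\<bar>"
  shows "moments_le N h' C"
  unfolding moments_le_def
proof (intro conjI allI assms(2))
  fix q
  note h = moments_leD[OF assms(1)]
  have ae: "AE u in N. \<bar>h' u\<bar> ^ q \<le> \<bar>h u\<bar> ^ q"
    using assms(3) by eventually_elim (auto intro: power_mono)
  show 1: "integrable N (\<lambda>u. \<bar>h' u\<bar> ^ q)"
    by (rule Bochner_Integration.integrable_bound[OF h(2)[of q]])
       (use assms(2) ae in \<open>auto intro!: borel_measurable_power borel_measurable_abs\<close>)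
  have "(\<integral>u. \<bar>h' u\<bar> ^ q \<partial>N) \<le> (\<integral>u. \<bar>h u\<bar> ^ q \<partial>N)"
    by (rule integral_mono_AE[OF 1 h(2) ae])
  then show "(\<integral>u. \<bar>h' u\<bar> ^ q \<partial>N) \<le> C q" using h(3)[of q] by linarith
qed

lemma abs_add_power_le: "\<bar>a + b\<bar> ^ q \<le> 2 ^ q * (\<bar>a\<bar> ^ q + \<bar>b\<bar> ^ q)" for a b :: real
proof -
  let ?m = "max \<bar>a\<bar> \<bar>b\<bar>"
  have "\<bar>a + b\<bar> ^ q \<le> (2 * ?m) ^ q" by (rule power_mono) auto
  also have "\<dots> = 2 ^ q * ?m ^ q" by (simp add: power_mult_distrib)
  also have "?m ^ q \<le> \<bar>a\<bar> ^ q + \<bar>b\<bar> ^ q" by (auto simp: max_def)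
  finally show ?thesis by simp
qed

lemma moments_le_add:
  assumes "moments_le N h C" "moments_le N g D"
  shows "moments_le N (\<lambda>u. h u + g u) (\<lambda>q. 2 ^ q * (C q + D q))"
  unfolding moments_le_def
proof (intro conjI allI)
  note h = moments_leD[OF assms(1)] and g = moments_leD[OF assms(2)]
  note [measurable] = h(1) g(1)
  show "(\<lambda>u. h u + g u) \<in> borel_measurable N" by simp
  fix q
  have i: "integrable N (\<lambda>u. 2 ^ q * (\<bar>h u\<bar> ^ q + \<bar>g u\<bar> ^ q))"
    using h(2)[of q] g(2)[of q] by simp
  show 1: "integrable N (\<lambda>u. \<bar>h u + g u\<bar> ^ q)"
    by (rule Bochner_Integration.integrable_bound[OF i])
       (auto simp: abs_add_power_le intro!: AE_I2)
  have "(\<integral>u. \<bar>h u + g u\<bar> ^ q \<partial>N) \<le> (\<integral>u. 2 ^ q * (\<bar>h u\<bar> ^ q + \<bar>g u\<bar> ^ q) \<partial>N)"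
    by (rule integral_mono[OF 1 i]) (rule abs_add_power_le)
  also have "\<dots> \<le> 2 ^ q * (C q + D q)"
    using h(2,3)[of q] g(2,3)[of q] by (simp add: add_mono)
  finally show "(\<integral>u. \<bar>h u + g u\<bar> ^ q \<partial>N) \<le> 2 ^ q * (C q + D q)" .
qed

lemma moments_le_cmult:
  assumes "moments_le N h C"
  shows "moments_le N (\<lambda>u. c * h u) (\<lambda>q. \<bar>c\<bar> ^ q * C q)"
proof -
  note h = moments_leD[OF assms]
  show ?thesis unfolding moments_le_def
    using h by (auto simp: abs_mult power_mult_distrib intro!: mult_left_mono)
qed

lemma moments_le_diff:
  assumes "moments_le N h C" "moments_le N g D"
  shows "moments_le N (\<lambda>u. h u - g u) (\<lambda>q. 2 ^ q * (C q + D q))"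
  using moments_le_add[OF assms(1) moments_le_cmult[OF assms(2), of "-1"]] by simp

text \<open>The product is at most the largest factor to the power \<open>card E\<close>. This
  replaces Hoelder's inequality: a product over edges is integrable as soon as single edges have
  moments of order \<open>card E\<close>.\<close>

lemma prod_le_sum_power:
  fixes s :: "'i \<Rightarrow> real"
  assumes "finite E" "E \<noteq> {}" "\<And>e. e \<in> E \<Longrightarrow> s e \<ge> 0"
  shows "(\<Prod>e\<in>E. s e) \<le> (\<Sum>e\<in>E. s e ^ card E)"
proof -
  define m where "m = Max (s ` E)"
  have "m \<in> s ` E" unfolding m_def using assms by (intro Max_in) auto
  then obtain e where e: "e \<in> E" "m = s e" by auto
  have "(\<Prod>e\<in>E. s e) \<le> (\<Prod>e\<in>E. m)"
    using assms by (intro prod_mono) (auto simp: m_def)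
  also have "\<dots> = s e ^ card E" using e by simp
  also have "\<dots> \<le> (\<Sum>e\<in>E. s e ^ card E)"
    using assms e by (intro member_le_sum) auto
  finally show ?thesis .
qed

lemma simple_graph_edge:
  assumes "simple_graph k E" "e \<in> E"
  shows "Min e \<in> {1..k}" "Max e \<in> {1..k}" "Min e \<noteq> Max e" "e = {Min e, Max e}"
proof -
  from assms have e: "e \<subseteq> {1..k}" "card e = 2" by (auto simp: simple_graph_def)
  then obtain a b where ab: "e = {a, b}" "a \<noteq> b" by (auto simp: card_2_iff)
  show "Min e \<in> {1..k}" "Max e \<in> {1..k}" "Min e \<noteq> Max e" "e = {Min e, Max e}"
    using ab e by (auto simp: min_def max_def)
qed

lemma simple_graph_finite: "simple_graph k E \<Longrightarrow> finite E"
  by (rule finite_subset[of _ "Pow {1..k}"]) (auto simp: simple_graph_def)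

section \<open>Two-coordinate marginals of a product measure\<close>

context prob_space
begin

text \<open>Both measures agree on rectangles, because the preimage of a rectangle is a box with
  full factors at the remaining coordinates. Integrals and null sets belonging to one edge thereby
  move between the cube and the square.\<close>

lemma distr_PiM_pair:
  fixes V :: "nat set"
  assumes V: "finite V" "i \<in> V" "j \<in> V" "i \<noteq> j"
  shows "distr (\<Pi>\<^sub>M i\<in>V. M) (M \<Otimes>\<^sub>M M) (\<lambda>x. (x i, x j)) = M \<Otimes>\<^sub>M M"
proof (rule sym, rule pair_measure_eqI)
  show "sigma_finite_measure M" by unfold_locales
  then show "sigma_finite_measure M" .
  interpret P: product_prob_space "\<lambda>_::nat. M" V by unfold_locales
  show "sets (M \<Otimes>\<^sub>M M) = sets (distr (\<Pi>\<^sub>M i\<in>V. M) (M \<Otimes>\<^sub>M M) (\<lambda>x. (x i, x j)))" by simp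
  fix A B assume AB[measurable]: "A \<in> sets M" "B \<in> sets M"
  have [measurable]: "(\<lambda>x. (x i, x j)) \<in> measurable (\<Pi>\<^sub>M i\<in>V. M) (M \<Otimes>\<^sub>M M)"
    using V by measurable
  let ?F = "\<lambda>v. if v = i then A else if v = j then B else space M"
  note sub = AB[THEN sets.sets_into_space]
  have eq: "(\<lambda>x. (x i, x j)) -` (A \<times> B) \<inter> space (\<Pi>\<^sub>M i\<in>V. M) = (\<Pi>\<^sub>E v\<in>V. ?F v)"
  proof (intro set_eqI iffI)
    fix x assume "x \<in> (\<lambda>x. (x i, x j)) -` (A \<times> B) \<inter> space (\<Pi>\<^sub>M i\<in>V. M)"
    then show "x \<in> (\<Pi>\<^sub>E v\<in>V. ?F v)" by (auto simp: space_PiM PiE_iff)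
  next
    fix x assume x: "x \<in> (\<Pi>\<^sub>E v\<in>V. ?F v)"
    then have F: "x v \<in> ?F v" if "v \<in> V" for v using that by (auto simp only: PiE_iff)
    have "x v \<in> space M" if "v \<in> V" for v using F[OF that] sub by (auto split: if_splits)
    moreover have "x i \<in> A" "x j \<in> B" using F[OF V(2)] F[OF V(3)] V(4) by auto
    ultimately show "x \<in> (\<lambda>x. (x i, x j)) -` (A \<times> B) \<inter> space (\<Pi>\<^sub>M i\<in>V. M)"
      using x by (auto simp: space_PiM PiE_iff)
  qed
  have "emeasure (distr (\<Pi>\<^sub>M i\<in>V. M) (M \<Otimes>\<^sub>M M) (\<lambda>x. (x i, x j))) (A \<times> B)
      = emeasure (\<Pi>\<^sub>M i\<in>V. M) (\<Pi>\<^sub>E v\<in>V. ?F v)"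
    by (subst emeasure_distr) (auto simp: eq)
  also have "\<dots> = (\<Prod>v\<in>V. emeasure M (?F v))"
    by (rule P.emeasure_PiM) (use V in auto)
  also have "\<dots> = (\<Prod>v\<in>{i, j}. emeasure M (?F v))"
    by (rule prod.mono_neutral_right) (use V in \<open>auto simp: emeasure_space_1\<close>)
  also have "\<dots> = emeasure M A * emeasure M B" using V by simp
  finally show "emeasure M A * emeasure M B
      = emeasure (distr (\<Pi>\<^sub>M i\<in>V. M) (M \<Otimes>\<^sub>M M) (\<lambda>x. (x i, x j))) (A \<times> B)" by simp
qed

lemma measurable_PiM_pair:
  assumes "i \<in> V" "j \<in> V"
  shows "(\<lambda>x. (x i, x j)) \<in> measurable (\<Pi>\<^sub>M i\<in>V. M) (M \<Otimes>\<^sub>M M)"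
  using assms by measurable

lemma integral_PiM_pair:
  fixes V :: "nat set" and h :: "_ \<Rightarrow> real"
  assumes V: "finite V" "i \<in> V" "j \<in> V" "i \<noteq> j" and h: "h \<in> borel_measurable (M \<Otimes>\<^sub>M M)"
  shows "(\<integral>x. h (x i, x j) \<partial>(\<Pi>\<^sub>M i\<in>V. M)) = (\<integral>u. h u \<partial>(M \<Otimes>\<^sub>M M))"
    and "integrable (\<Pi>\<^sub>M i\<in>V. M) (\<lambda>x. h (x i, x j)) \<longleftrightarrow> integrable (M \<Otimes>\<^sub>M M) h"
  using integral_distr[OF measurable_PiM_pair[OF V(2,3)] h]
    integrable_distr_eq[OF measurable_PiM_pair[OF V(2,3)] h]
  by (simp_all add: distr_PiM_pair[OF V])

lemma AE_PiM_pair: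
  fixes V :: "nat set"
  assumes V: "finite V" "i \<in> V" "j \<in> V" "i \<noteq> j" and P: "AE u in M \<Otimes>\<^sub>M M. P u"
  shows "AE x in (\<Pi>\<^sub>M i\<in>V. M). P (x i, x j)"
proof -
  have "AE u in distr (\<Pi>\<^sub>M i\<in>V. M) (M \<Otimes>\<^sub>M M) (\<lambda>x. (x i, x j)). P u"
    by (subst distr_PiM_pair[OF V]) (rule P)
  then show ?thesis by (rule AE_distrD[OF measurable_PiM_pair[OF V(2,3)]])
qed

lemma edge_moment:
  assumes G: "simple_graph k E" "e \<in> E" and h: "moments_le (M \<Otimes>\<^sub>M M) h C"
  shows "integrable (\<Pi>\<^sub>M i\<in>{1..k}. M) (\<lambda>x. \<bar>h (x (Min e), x (Max e))\<bar> ^ q)"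
    "(\<integral>x. \<bar>h (x (Min e), x (Max e))\<bar> ^ q \<partial>(\<Pi>\<^sub>M i\<in>{1..k}. M)) \<le> C q"
    "(\<lambda>x. h (x (Min e), x (Max e))) \<in> borel_measurable (\<Pi>\<^sub>M i\<in>{1..k}. M)"
proof -
  note e = simple_graph_edge[OF G] and h = moments_leD[OF h]
  note * = integral_PiM_pair[of "{1..k}" "Min e" "Max e" "\<lambda>u. \<bar>h u\<bar> ^ q", OF _ e(1-3)]
  note [measurable] = h(1)
  show "integrable (\<Pi>\<^sub>M i\<in>{1..k}. M) (\<lambda>x. \<bar>h (x (Min e), x (Max e))\<bar> ^ q)"
    using *(2) h(2) by simp
  show "(\<integral>x. \<bar>h (x (Min e), x (Max e))\<bar> ^ q \<partial>(\<Pi>\<^sub>M i\<in>{1..k}. M)) \<le> C q"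
    using *(1) h(3) by simp
  show "(\<lambda>x. h (x (Min e), x (Max e))) \<in> borel_measurable (\<Pi>\<^sub>M i\<in>{1..k}. M)"
    using measurable_compose[OF measurable_PiM_pair[OF e(1,2)] h(1)] .
qed

lemma graph_density_integrable:
  assumes G: "simple_graph k E" and h: "\<And>e. e \<in> E \<Longrightarrow> moments_le (M \<Otimes>\<^sub>M M) (h e) C"
  shows "integrable (\<Pi>\<^sub>M i\<in>{1..k}. M) (\<lambda>x. \<Prod>e\<in>E. h e (x (Min e), x (Max e)))"
proof (cases "E = {}")
  case True
  interpret P: prob_space "\<Pi>\<^sub>M i\<in>{1..k}. M" by (rule prob_space_PiM) (rule prob_space_axioms)
  show ?thesis unfolding True prod.empty by (rule P.integrable_const)
next
  case False
  note m = edge_moment[OF G _ h]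
  have i: "integrable (\<Pi>\<^sub>M i\<in>{1..k}. M) (\<lambda>x. \<Sum>e\<in>E. \<bar>h e (x (Min e), x (Max e))\<bar> ^ card E)"
    by (intro Bochner_Integration.integrable_sum m)
  show ?thesis
  proof (rule Bochner_Integration.integrable_bound[OF i])
    show "(\<lambda>x. \<Prod>e\<in>E. h e (x (Min e), x (Max e))) \<in> borel_measurable (\<Pi>\<^sub>M i\<in>{1..k}. M)"
      by (intro borel_measurable_prod m)
    show "AE x in \<Pi>\<^sub>M i\<in>{1..k}. M. norm (\<Prod>e\<in>E. h e (x (Min e), x (Max e)))
        \<le> norm (\<Sum>e\<in>E. \<bar>h e (x (Min e), x (Max e))\<bar> ^ card E)"
      using prod_le_sum_power[OF simple_graph_finite[OF G] False]
      by (intro AE_I2) (auto simp: abs_prod intro: order_trans[OF _ abs_ge_self])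
  qed
qed


section \<open>The counting lemma for unbounded kernels\<close>

lemma cut_le_scaled:
  assumes "cut_le M h \<epsilon>" "f \<in> borel_measurable M" "g \<in> borel_measurable M"
    and "\<And>x. \<bar>f x\<bar> \<le> A" "\<And>x. \<bar>g x\<bar> \<le> B" "A > 0" "B > 0"
  shows "\<bar>\<integral>u. h u * (f (fst u) * g (snd u)) \<partial>(M \<Otimes>\<^sub>M M)\<bar> \<le> A * B * \<epsilon>"
proof -
  have "\<bar>\<integral>u. h u * (f (fst u) / A * (g (snd u) / B)) \<partial>(M \<Otimes>\<^sub>M M)\<bar> \<le> \<epsilon>"
    using assms(1)[unfolded cut_le_def, rule_format, of "\<lambda>x. f x / A" "\<lambda>x. g x / B"] assms(2-)
    by (simp add: abs_divide divide_le_eq)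
  also have "(\<lambda>u. h u * (f (fst u) / A * (g (snd u) / B))) = (\<lambda>u. h u * (f (fst u) * g (snd u)) / (A * B))"
    by (simp add: field_simps)
  finally show ?thesis using assms(6,7) by (simp add: abs_mult field_simps)
qed

lemma abs_prod_le_power:
  fixes s :: "'i \<Rightarrow> real"
  assumes "finite E" "\<And>e. e \<in> E \<Longrightarrow> \<bar>s e\<bar> \<le> A" "A \<ge> 1" "card E \<le> n"
  shows "\<bar>\<Prod>e\<in>E. s e\<bar> \<le> A ^ n"
proof -
  have "\<bar>\<Prod>e\<in>E. s e\<bar> \<le> (\<Prod>e\<in>E. A)"
    unfolding abs_prod by (intro prod_mono) (use assms in auto)
  also have "\<dots> \<le> A ^ n" using assms by (simp add: power_increasing)
  finally show ?thesis .
qed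

text \<open>Once all vertices except the two endpoints of \<open>e0\<close> are frozen, no other edge contains both
  endpoints, so the remaining product splits into a function of each endpoint.\<close>

lemma single_edge_bounded:
  fixes B :: "nat set \<Rightarrow> 'a \<times> 'a \<Rightarrow> real"
  assumes G: "simple_graph k E" and e0: "e0 \<in> E" and D: "integrable (M \<Otimes>\<^sub>M M) D"
    and cut: "cut_le M D \<epsilon>" and B[measurable]: "\<And>e. B e \<in> borel_measurable (M \<Otimes>\<^sub>M M)"
    and BA: "\<And>e u. \<bar>B e u\<bar> \<le> A" and A: "A \<ge> 1"
  shows "\<bar>\<integral>x. D (x (Min e0), x (Max e0)) * (\<Prod>e\<in>E - {e0}. B e (x (Min e), x (Max e)))
    \<partial>(\<Pi>\<^sub>M i\<in>{1..k}. M)\<bar> \<le> A ^ (2 * card E) * \<epsilon>"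
proof -
  interpret P: product_prob_space "\<lambda>_::nat. M" "{1..k}" by unfold_locales
  define i where "i = Min e0"
  define j where "j = Max e0"
  define K where "K = {1..k} - {i, j}"
  have ij: "i \<in> {1..k}" "j \<in> {1..k}" "i \<noteq> j" "e0 = {i, j}"
    using simple_graph_edge[OF G e0] by (auto simp: i_def j_def)
  have KJ: "K \<inter> {i, j} = {}" "K \<union> {i, j} = {1..k}" "finite K" using ij by (auto simp: K_def)
  have finE: "finite E" using G by (rule simple_graph_finite)
  define \<Phi> where "\<Phi> = (\<lambda>x. D (x i, x j) * (\<Prod>e\<in>E - {e0}. B e (x (Min e), x (Max e))))"
  have eps: "\<epsilon> \<ge> 0"
    using cut[unfolded cut_le_def, rule_format, of "\<lambda>_. 0" "\<lambda>_. 0"] by simp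
  have [measurable]: "D \<in> borel_measurable (M \<Otimes>\<^sub>M M)" using D by simp
  have mB: "(\<lambda>x. B e (x (Min e), x (Max e))) \<in> borel_measurable (\<Pi>\<^sub>M i\<in>{1..k}. M)" if "e \<in> E" for e
    using measurable_compose[OF measurable_PiM_pair[OF simple_graph_edge(1,2)[OF G that]] B] .
  have i1: "integrable (\<Pi>\<^sub>M i\<in>{1..k}. M) (\<lambda>x. A ^ card E * D (x i, x j))"
    using integral_PiM_pair(2)[OF _ ij(1-3), of D] D by simp
  have int: "integrable (\<Pi>\<^sub>M i\<in>{1..k}. M) \<Phi>"
  proof (rule Bochner_Integration.integrable_bound[OF i1])
    show "\<Phi> \<in> borel_measurable (\<Pi>\<^sub>M i\<in>{1..k}. M)" unfolding \<Phi>_def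
      using ij by (intro borel_measurable_times borel_measurable_prod mB
          measurable_compose[OF measurable_PiM_pair, of _ _ _ D]) auto
    have "\<bar>\<Prod>e\<in>E - {e0}. B e (x (Min e), x (Max e))\<bar> \<le> A ^ card E" for x
      by (rule abs_prod_le_power) (use finE BA A in \<open>auto intro: card_mono\<close>)
    then show "AE x in \<Pi>\<^sub>M i\<in>{1..k}. M. norm (\<Phi> x) \<le> norm (A ^ card E * D (x i, x j))"
      using A by (intro AE_I2) (auto simp: \<Phi>_def abs_mult mult.commute[of "A ^ _"] intro!: mult_left_mono)
  qed
  \<comment> \<open>Fubini: the endpoints \<open>i\<close> and \<open>j\<close> are integrated
    inside, all other vertices are frozen outside.\<close>
  have "(\<integral>x. \<Phi> x \<partial>(\<Pi>\<^sub>M i\<in>{1..k}. M))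
      = (\<integral>x. (\<integral>y. \<Phi> (merge K {i, j} (x, y)) \<partial>(\<Pi>\<^sub>M i\<in>{i, j}. M)) \<partial>(\<Pi>\<^sub>M i\<in>K. M))"
    using P.product_integral_fold[OF KJ(1,3), of \<Phi>] int unfolding KJ(2) by simp
  moreover have "\<bar>\<integral>y. \<Phi> (merge K {i, j} (x, y)) \<partial>(\<Pi>\<^sub>M i\<in>{i, j}. M)\<bar> \<le> A ^ (2 * card E) * \<epsilon>"
    if x: "x \<in> space (\<Pi>\<^sub>M i\<in>K. M)" for x
  proof -
    \<comment> \<open>An edge other than \<open>e0\<close> cannot contain both \<open>i\<close> and
      \<open>j\<close>. The edges avoiding \<open>j\<close> give a function of the vertex
      \<open>i\<close>; those containing \<open>j\<close> avoid \<open>i\<close> and give a function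
      of the vertex \<open>j\<close>.\<close>
    define E1 where "E1 = {e\<in>E - {e0}. j \<notin> e}"
    define E2 where "E2 = {e\<in>E - {e0}. j \<in> e}"
    define f where "f = (\<lambda>a. \<Prod>e\<in>E1. B e ((x(i := a)) (Min e), (x(i := a)) (Max e)))"
    define g where "g = (\<lambda>a. \<Prod>e\<in>E2. B e ((x(j := a)) (Min e), (x(j := a)) (Max e)))"
    have xK: "x v \<in> space M" if "v \<in> K" for v using x that by (auto simp: space_PiM)
    have E1: "Min e \<in> K \<union> {i}" "Max e \<in> K \<union> {i}" if "e \<in> E1" for e
    proof -
      have "e \<in> E" "j \<notin> e" using that by (auto simp: E1_def)
      with simple_graph_edge[OF G \<open>e \<in> E\<close>] show "Min e \<in> K \<union> {i}" "Max e \<in> K \<union> {i}"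
        by (auto simp: K_def)
    qed
    have E2: "Min e \<in> K \<union> {j}" "Max e \<in> K \<union> {j}" if "e \<in> E2" for e
    proof -
      have e: "e \<in> E" "j \<in> e" "e \<noteq> e0" using that by (auto simp: E2_def)
      note se = simple_graph_edge[OF G e(1)]
      obtain p q where pq: "e = {p, q}" using se(4) by blast
      have "i \<notin> e" using e(2,3) ij(3,4) unfolding pq by auto
      with se show "Min e \<in> K \<union> {j}" "Max e \<in> K \<union> {j}" by (auto simp: K_def)
    qed
    have upd: "(\<lambda>a. (x(l := a)) v) \<in> measurable M M" if "v \<in> K \<union> {l}" for v l
      using that xK by (cases "v = l") auto
    have [measurable]: "f \<in> borel_measurable M" unfolding f_def
      by (intro borel_measurable_prod measurable_compose[OF measurable_Pair B] upd E1)
    have [measurable]: "g \<in> borel_measurable M" unfolding g_def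
      by (intro borel_measurable_prod measurable_compose[OF measurable_Pair B] upd E2)
    have "\<Phi> (merge K {i, j} (x, y)) = D (y i, y j) * (f (y i) * g (y j))" for y
    proof -
      let ?z = "merge K {i, j} (x, y)"
      have z: "?z i = y i" "?z j = y j" "\<And>v. v \<in> K \<Longrightarrow> ?z v = x v"
        using KJ by (auto simp: merge_def)
      have "(\<Prod>e\<in>E - {e0}. B e (?z (Min e), ?z (Max e)))
          = (\<Prod>e\<in>E1. B e (?z (Min e), ?z (Max e))) * (\<Prod>e\<in>E2. B e (?z (Min e), ?z (Max e)))"
        by (subst prod.union_disjoint[symmetric])
           (use finE in \<open>auto simp: E1_def E2_def intro!: prod.cong\<close>)
      also have "(\<Prod>e\<in>E1. B e (?z (Min e), ?z (Max e))) = f (y i)"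
        unfolding f_def
      proof (rule prod.cong[OF refl])
        fix e assume "e \<in> E1"
        have "?z v = (x(i := y i)) v" if "v \<in> K \<union> {i}" for v using that z by auto
        with E1[OF \<open>e \<in> E1\<close>] show "B e (?z (Min e), ?z (Max e))
          = B e ((x(i := y i)) (Min e), (x(i := y i)) (Max e))" by metis
      qed
      also have "(\<Prod>e\<in>E2. B e (?z (Min e), ?z (Max e))) = g (y j)"
        unfolding g_def
      proof (rule prod.cong[OF refl])
        fix e assume "e \<in> E2"
        have "?z v = (x(j := y j)) v" if "v \<in> K \<union> {j}" for v using that z by auto
        with E2[OF \<open>e \<in> E2\<close>] show "B e (?z (Min e), ?z (Max e))
          = B e ((x(j := y j)) (Min e), (x(j := y j)) (Max e))" by metis
      qed
      finally show ?thesis by (simp add: \<Phi>_def z)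
    qed
    then have "(\<integral>y. \<Phi> (merge K {i, j} (x, y)) \<partial>(\<Pi>\<^sub>M i\<in>{i, j}. M))
        = (\<integral>y. (\<lambda>u. D u * (f (fst u) * g (snd u))) (y i, y j) \<partial>(\<Pi>\<^sub>M i\<in>{i, j}. M))" by simp
    also have "\<dots> = (\<integral>u. D u * (f (fst u) * g (snd u)) \<partial>(M \<Otimes>\<^sub>M M))"
      by (rule integral_PiM_pair(1)) (use ij in auto)
    finally have eq: "(\<integral>y. \<Phi> (merge K {i, j} (x, y)) \<partial>(\<Pi>\<^sub>M i\<in>{i, j}. M))
        = (\<integral>u. D u * (f (fst u) * g (snd u)) \<partial>(M \<Otimes>\<^sub>M M))" .
    have "\<bar>f a\<bar> \<le> A ^ card E" "\<bar>g a\<bar> \<le> A ^ card E" for a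
      unfolding f_def g_def
      by (rule abs_prod_le_power, use finE BA A in \<open>auto simp: E1_def E2_def intro: card_mono\<close>)+
    then have "\<bar>\<integral>u. D u * (f (fst u) * g (snd u)) \<partial>(M \<Otimes>\<^sub>M M)\<bar> \<le> A ^ card E * A ^ card E * \<epsilon>"
      using A by (intro cut_le_scaled[OF cut]) auto
    then show ?thesis unfolding eq by (simp add: power_add mult_2)
  qed
  moreover have "\<bar>\<integral>x. F x \<partial>(\<Pi>\<^sub>M i\<in>K. M)\<bar> \<le> c"
    if F: "\<And>x. x \<in> space (\<Pi>\<^sub>M i\<in>K. M) \<Longrightarrow> \<bar>F x\<bar> \<le> c" and "c \<ge> 0" for F and c :: real
  proof -
    interpret Q: prob_space "\<Pi>\<^sub>M i\<in>K. M" by (rule prob_space_PiM) (rule prob_space_axioms)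
    show ?thesis
    proof (cases "integrable (\<Pi>\<^sub>M i\<in>K. M) F")
      case True
      have "\<bar>\<integral>x. F x \<partial>(\<Pi>\<^sub>M i\<in>K. M)\<bar> \<le> (\<integral>x. \<bar>F x\<bar> \<partial>(\<Pi>\<^sub>M i\<in>K. M))"
        using integral_norm_bound[of _ F] by simp
      also have "\<dots> \<le> (\<integral>x. c \<partial>(\<Pi>\<^sub>M i\<in>K. M))"
        by (rule integral_mono) (use True F in auto)
      finally show ?thesis by (simp add: Q.prob_space)
    qed (use \<open>c \<ge> 0\<close> in \<open>simp add: not_integrable_integral_eq\<close>)
  qed
  ultimately have "\<bar>\<integral>x. \<Phi> x \<partial>(\<Pi>\<^sub>M i\<in>{1..k}. M)\<bar> \<le> A ^ (2 * card E) * \<epsilon>"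
    using eps A by simp
  then show ?thesis by (simp add: \<Phi>_def i_def j_def)
qed

text \<open>Truncating the kernels of the other edges at height \<open>A\<close> costs \<open>O(1 / A)\<close> by the moment bounds.\<close>

lemma single_edge:
  fixes C :: "nat \<Rightarrow> real"
  assumes G: "simple_graph k E" and e0: "e0 \<in> E"
    and h: "\<And>e. e \<in> E \<Longrightarrow> moments_le (M \<Otimes>\<^sub>M M) (h e) C"
    and cut: "cut_le M (h e0) \<epsilon>" and A: "A \<ge> 1"
  shows "\<bar>graph_density M k E h\<bar> \<le> A ^ (2 * card E) * \<epsilon> + card E * C (card E + 1) / A"
proof -
  let ?P = "\<Pi>\<^sub>M i\<in>{1..k}. M"
  \<comment> \<open>Large values are cut to 0 rather than to \<open>A\<close>: the truncated product
    of the other edges then either equals the full one or vanishes.\<close>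
  define B where "B = (\<lambda>e u. if e \<in> E \<and> \<bar>h e u\<bar> \<le> A then h e u else 0)"
  define H where "H = (\<lambda>x e. h e (x (Min e :: nat), x (Max e)))"
  define \<Phi> where "\<Phi> = (\<lambda>x. H x e0 * (\<Prod>e\<in>E - {e0}. B e (x (Min e), x (Max e))))"
  have finE: "finite E" using G by (rule simple_graph_finite)
  have BA: "\<bar>B e u\<bar> \<le> A" for e u using A by (auto simp: B_def)
  note hD = moments_leD[OF h]
  have Bm: "B e \<in> borel_measurable (M \<Otimes>\<^sub>M M)" for e
  proof (cases "e \<in> E")
    case True
    note [measurable] = hD(1)[OF True]
    show ?thesis using True unfolding B_def by simp
  qed (simp add: B_def)
  note m = edge_moment[OF G _ h]
  have prod_eq: "(\<Prod>e\<in>E. H x e) = H x e0 * (\<Prod>e\<in>E - {e0}. H x e)" for x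
    using finE e0 by (rule prod.remove)
  have i1: "integrable ?P (\<lambda>x. \<Prod>e\<in>E. H x e)" unfolding H_def
    by (rule graph_density_integrable[OF G h])
  have \<Phi>_le: "\<bar>\<Phi> x\<bar> \<le> \<bar>\<Prod>e\<in>E. H x e\<bar>" for x
    unfolding prod_eq \<Phi>_def abs_mult abs_prod
    by (intro mult_left_mono prod_mono) (auto simp: B_def H_def)
  have mB: "(\<lambda>x. B e (x (Min e), x (Max e))) \<in> borel_measurable ?P" if "e \<in> E" for e
    using measurable_compose[OF measurable_PiM_pair[OF simple_graph_edge(1,2)[OF G that]] Bm] .
  have i2: "integrable ?P \<Phi>"
    by (rule Bochner_Integration.integrable_bound[OF i1])
      (use \<Phi>_le m(3)[of e0] e0 mB in \<open>auto simp: \<Phi>_def H_def intro!: borel_measurable_times borel_measurable_prod\<close>)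
  have i3: "integrable ?P (\<lambda>x. (\<Sum>e\<in>E. \<bar>H x e\<bar> ^ (card E + 1)) / A)"
    unfolding H_def by (intro integrable_divide Bochner_Integration.integrable_sum m)
  have err: "\<bar>(\<Prod>e\<in>E. H x e) - \<Phi> x\<bar> \<le> (\<Sum>e\<in>E. \<bar>H x e\<bar> ^ (card E + 1)) / A" for x
  proof (cases "\<forall>e\<in>E - {e0}. \<bar>H x e\<bar> \<le> A")
    case True
    then have "(\<Prod>e\<in>E - {e0}. B e (x (Min e), x (Max e))) = (\<Prod>e\<in>E - {e0}. H x e)"
      by (intro prod.cong) (auto simp: B_def H_def)
    then show ?thesis using A by (simp add: \<Phi>_def prod_eq sum_nonneg)
  next
    case False
    then obtain e1 where "e1 \<in> E - {e0}" "\<not> \<bar>H x e1\<bar> \<le> A" by blast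
    then have e1: "e1 \<in> E" "e1 \<noteq> e0" "\<bar>H x e1\<bar> > A" by simp_all
    then have "B e1 (x (Min e1), x (Max e1)) = 0" by (auto simp: B_def H_def)
    then have "\<Phi> x = 0" using e1 finE by (auto simp: \<Phi>_def prod_zero_iff)
    \<comment> \<open>With \<open>m\<close> the largest factor, some factor above \<open>A\<close>
      forces \<open>m \<ge> A\<close>, and the whole product is at most
      \<open>m ^ card E \<le> m ^ (card E + 1) / A\<close>.\<close>
    define m where "m = Max ((\<lambda>e. \<bar>H x e\<bar>) ` E)"
    have "m \<in> (\<lambda>e. \<bar>H x e\<bar>) ` E" unfolding m_def using finE e0 by (intro Max_in) auto
    then obtain e2 where e2: "e2 \<in> E" "m = \<bar>H x e2\<bar>" by auto
    have le: "\<bar>H x e\<bar> \<le> m" if "e \<in> E" for e using that finE by (auto simp: m_def)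
    have "A \<le> m" using le[OF e1(1)] e1(3) by linarith
    have "\<bar>\<Prod>e\<in>E. H x e\<bar> * A \<le> m ^ card E * m"
      using le A \<open>A \<le> m\<close> unfolding abs_prod
      by (intro mult_mono) (auto intro: order_trans[OF prod_mono[where g="\<lambda>_. m"]])
    also have "\<dots> = \<bar>H x e2\<bar> ^ (card E + 1)" using e2 by simp
    also have "\<dots> \<le> (\<Sum>e\<in>E. \<bar>H x e\<bar> ^ (card E + 1))"
      using finE e2 by (intro member_le_sum) auto
    finally show ?thesis using A \<open>\<Phi> x = 0\<close> by (simp add: field_simps)
  qed
  have "\<bar>(\<integral>x. (\<Prod>e\<in>E. H x e) \<partial>?P) - (\<integral>x. \<Phi> x \<partial>?P)\<bar> = \<bar>\<integral>x. (\<Prod>e\<in>E. H x e) - \<Phi> x \<partial>?P\<bar>"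
    using i1 i2 by simp
  also have "\<dots> \<le> (\<integral>x. \<bar>(\<Prod>e\<in>E. H x e) - \<Phi> x\<bar> \<partial>?P)"
    using integral_norm_bound[of _ "\<lambda>x. (\<Prod>e\<in>E. H x e) - \<Phi> x"] by simp
  also have "\<dots> \<le> (\<integral>x. (\<Sum>e\<in>E. \<bar>H x e\<bar> ^ (card E + 1)) / A \<partial>?P)"
    by (rule integral_mono) (use i1 i2 i3 err in auto)
  also have "\<dots> = (\<Sum>e\<in>E. (\<integral>x. \<bar>H x e\<bar> ^ (card E + 1) \<partial>?P)) / A"
    unfolding H_def using m(1)[where q = "card E + 1"] by simp
  also have "\<dots> \<le> (\<Sum>e\<in>E. C (card E + 1)) / A"
    using m(2)[where q = "card E + 1"] A unfolding H_def by (intro divide_right_mono sum_mono) auto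
  finally have "\<bar>(\<integral>x. (\<Prod>e\<in>E. H x e) \<partial>?P) - (\<integral>x. \<Phi> x \<partial>?P)\<bar> \<le> card E * C (card E + 1) / A"
    by simp
  moreover have "\<bar>\<integral>x. \<Phi> x \<partial>?P\<bar> \<le> A ^ (2 * card E) * \<epsilon>"
    unfolding \<Phi>_def H_def
    by (rule single_edge_bounded[OF G e0 hD(4)[OF e0] cut Bm BA A])
  ultimately show ?thesis unfolding graph_density_def H_def by linarith
qed

text \<open>Linearity in one edge kernel. It drives the telescoping in the counting lemma and later
  the passage from \<F> to its span.\<close>

lemma graph_density_upd:
  assumes G: "simple_graph k E" and e0: "e0 \<in> E"
    and h: "\<And>e. e \<in> E \<Longrightarrow> moments_le (M \<Otimes>\<^sub>M M) (h e) C"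
    and g: "moments_le (M \<Otimes>\<^sub>M M) g C"
  shows "graph_density M k E (h(e0 := \<lambda>u. a * h e0 u + b * g u))
    = a * graph_density M k E h + b * graph_density M k E (h(e0 := g))"
proof -
  have finE: "finite E" using G by (rule simple_graph_finite)
  let ?R = "\<lambda>x. \<Prod>e\<in>E - {e0}. h e (x (Min e), x (Max e))"
  have split: "(\<Prod>e\<in>E. (h(e0 := w)) e (x (Min e), x (Max e))) = w (x (Min e0), x (Max e0)) * ?R x" for w x
    by (subst prod.remove[OF finE e0]) (auto intro!: arg_cong2[where f="(*)"] prod.cong)
  have i: "integrable (\<Pi>\<^sub>M i\<in>{1..k}. M) (\<lambda>x. w (x (Min e0), x (Max e0)) * ?R x)"
    if "moments_le (M \<Otimes>\<^sub>M M) w C" for w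
    unfolding split[symmetric] by (rule graph_density_integrable[OF G]) (use h that in auto)
  have split0: "(\<Prod>e\<in>E. h e (x (Min e), x (Max e))) = h e0 (x (Min e0), x (Max e0)) * ?R x" for x
    using split[of "h e0"] by simp
  show ?thesis
    unfolding graph_density_def split split0
    using i[OF h[OF e0]] i[OF g] by (simp add: distrib_right mult.assoc)
qed

text \<open>Telescoping: replacing \<open>h\<close> by \<open>h'\<close> on one edge changes the
  density by a density with the difference kernel on that edge, which \<open>single_edge\<close>
  bounds. The truncation height is chosen first, from the moments alone; the cut distance is then
  made small against its powers.\<close>

theorem graph_density_cut_continuous:
  fixes m :: nat and C :: "nat \<Rightarrow> real"
  assumes "\<eta> > 0"
  obtains \<delta> where "\<delta> > 0" "density_modulus M m C \<delta> \<eta>"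
proof -
  \<comment> \<open>Dominates the moments of \<open>h\<close>, of \<open>h'\<close> and of their
    difference.\<close>
  define C' where "C' = (\<lambda>q. max (C q) (2 ^ q * (C q + C q)))"
  define c where "c = \<bar>real m * C' (m + 1)\<bar>"
  define \<eta>' where "\<eta>' = \<eta> / (real m + 1)"
  have \<eta>': "\<eta>' > 0" using assms by (simp add: \<eta>'_def)
  \<comment> \<open>\<open>c / A\<close> is the truncation error and
    \<open>A ^ (2 * m) * \<delta>\<close> the cut error; each gets half of \<eta>'.\<close>
  define A where "A = max 1 (2 * c / \<eta>')"
  have A: "A \<ge> 1" "c / A \<le> \<eta>' / 2"
  proof -
    show A1: "A \<ge> 1" by (simp add: A_def)
    have "2 * c / \<eta>' \<le> A" by (simp add: A_def)
    then show "c / A \<le> \<eta>' / 2" using A1 \<eta>' by (simp add: field_simps)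
  qed
  define \<delta> where "\<delta> = \<eta>' / (2 * A ^ (2 * m))"
  have \<delta>: "\<delta> > 0" "A ^ (2 * m) * \<delta> = \<eta>' / 2" using A \<eta>' by (auto simp: \<delta>_def)
  show ?thesis
  proof (rule that[of \<delta>], goal_cases)
    case 1
    show ?case by (rule \<delta>)
  next
    case 2
    show ?case unfolding density_modulus_def
    proof (intro allI impI)
      fix k E and h h' :: "nat set \<Rightarrow> 'a \<times> 'a \<Rightarrow> real"
      assume G: "simple_graph k E" and m: "card E = m"
        and hh: "\<forall>e\<in>E. moments_le (M \<Otimes>\<^sub>M M) (h e) C \<and> moments_le (M \<Otimes>\<^sub>M M) (h' e) C \<and>
          cut_le M (\<lambda>u. h e u - h' e u) \<delta>"
      have finE: "finite E" using G by (rule simple_graph_finite)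
      have C: "C q \<le> C' q" "2 ^ q * (C q + C q) \<le> C' q" for q by (simp_all add: C'_def)
      \<comment> \<open>\<open>S\<close> is the set of edges already switched to
        \<open>h'\<close>.\<close>
      have "\<bar>graph_density M k E h - graph_density M k E (\<lambda>e. if e \<in> S then h' e else h e)\<bar>
          \<le> card S * \<eta>'" if "S \<subseteq> E" for S
        using finite_subset[OF that finE] that
      proof (induction S rule: finite_induct)
        case empty
        then show ?case by simp
      next
        case (insert e0 S)
        let ?g = "\<lambda>e. if e \<in> S then h' e else h e"
        let ?d = "\<lambda>u. h e0 u - h' e0 u"
        have e0: "e0 \<in> E" using insert by auto
        have g: "moments_le (M \<Otimes>\<^sub>M M) (?g e) C'" if "e \<in> E" for e
          using hh that by (auto intro: moments_le_mono[OF _ C(1)])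
        have h'0: "moments_le (M \<Otimes>\<^sub>M M) (h' e0) C'"
          using hh e0 by (auto intro: moments_le_mono[OF _ C(1)])
        have d: "moments_le (M \<Otimes>\<^sub>M M) ?d C'"
          using moments_le_mono[OF moments_le_diff C(2)] hh e0 by blast
        have eq1: "?g(e0 := h' e0) = (\<lambda>e. if e \<in> insert e0 S then h' e else h e)" by auto
        have eq2: "(\<lambda>u. 1 * ?g e0 u + (- 1) * h' e0 u) = ?d" using insert by auto
        have "graph_density M k E (?g(e0 := ?d))
            = graph_density M k E ?g - graph_density M k E (\<lambda>e. if e \<in> insert e0 S then h' e else h e)"
          using graph_density_upd[OF G e0, of ?g C' "h' e0" 1 "-1", OF g h'0]
          unfolding eq1 eq2 by simp
        moreover have "\<bar>graph_density M k E (?g(e0 := ?d))\<bar>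
            \<le> A ^ (2 * card E) * \<delta> + card E * C' (card E + 1) / A"
          by (rule single_edge[OF G e0, where h = "?g(e0 := ?d)" and C = C', OF _ _ A(1)]) (use g d hh e0 in auto)
        moreover have "card E * C' (card E + 1) / A \<le> c / A"
          using A by (intro divide_right_mono) (auto simp: c_def m)
        ultimately have "\<bar>graph_density M k E ?g
            - graph_density M k E (\<lambda>e. if e \<in> insert e0 S then h' e else h e)\<bar> \<le> \<eta>'"
          using A(2) \<delta>(2) unfolding m by linarith
        then show ?case using insert by (simp add: algebra_simps)
      qed
      from this[OF subset_refl]
      have "\<bar>graph_density M k E h - graph_density M k E (\<lambda>e. if e \<in> E then h' e else h e)\<bar> \<le> m * \<eta>'"
        using m by simp
      also have "graph_density M k E (\<lambda>e. if e \<in> E then h' e else h e) = graph_density M k E h'"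
        unfolding graph_density_def by (intro Bochner_Integration.integral_cong prod.cong refl) auto
      also have "m * \<eta>' \<le> \<eta>" using assms by (simp add: \<eta>'_def field_simps)
      finally show "\<bar>graph_density M k E h - graph_density M k E h'\<bar> \<le> \<eta>" .
    qed
  qed
qed

end

section \<open>Averages over finite partitions\<close>

definition cell :: "'a measure \<Rightarrow> ('a \<Rightarrow> 'i) \<Rightarrow> 'i \<Rightarrow> real" where
  "cell M d j = measure M {x \<in> space M. d x = j}"

definition cell_int :: "'a measure \<Rightarrow> ('a \<Rightarrow> 'i) \<Rightarrow> ('a \<Rightarrow> real) \<Rightarrow> 'i \<Rightarrow> real" where
  "cell_int M d h j = (\<integral>x. h x * of_bool (d x = j) \<partial>M)"

text \<open>On a null cell the quotient is 0; this is consistent, since \<open>cell_int\<close>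
  vanishes there as well.\<close>

definition cell_mean :: "'a measure \<Rightarrow> ('a \<Rightarrow> 'i) \<Rightarrow> ('a \<Rightarrow> real) \<Rightarrow> 'i \<Rightarrow> real" where
  "cell_mean M d h j = cell_int M d h j / cell M d j"

text \<open>The squared \<open>L2\<close> norm of the conditional expectation of \<open>h\<close>
  given the partition into the cells of \<open>d\<close>.\<close>

definition energy :: "'a measure \<Rightarrow> ('a \<Rightarrow> 'i) \<Rightarrow> ('a \<Rightarrow> real) \<Rightarrow> real" where
  "energy M d h = (\<integral>x. (cell_mean M d h (d x))\<^sup>2 \<partial>M)"

text \<open>The graph of \<open>s ^ q\<close> lies above its tangent at \<open>t\<close>:
  Bernoulli's inequality for \<open>s / t\<close>, multiplied by \<open>t ^ q\<close>.\<close>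

lemma power_tangent:
  fixes s t :: real
  assumes "s \<ge> 0" "t > 0"
  shows "t ^ q + real q * t ^ q / t * (s - t) \<le> s ^ q"
proof -
  have "1 + real q * (s / t - 1) \<le> (1 + (s / t - 1)) ^ q"
    by (rule Bernoulli_inequality) (use assms in auto)
  then have "t ^ q * (1 + real q * (s / t - 1)) \<le> t ^ q * (s / t) ^ q"
    using assms by (intro mult_left_mono) auto
  also have "t ^ q * (s / t) ^ q = s ^ q" using assms by (simp add: power_divide)
  also have "t ^ q * (1 + real q * (s / t - 1)) = t ^ q + real q * t ^ q / t * (s - t)"
    using assms by (simp add: field_simps)
  finally show ?thesis .
qed

context prob_space
begin

lemma integrable_times_bounded:
  fixes h g :: "'a \<Rightarrow> real"
  assumes "integrable M h" "g \<in> borel_measurable M" "\<And>x. x \<in> space M \<Longrightarrow> \<bar>g x\<bar> \<le> B"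
  shows "integrable M (\<lambda>x. h x * g x)"
proof (rule Bochner_Integration.integrable_bound)
  show "integrable M (\<lambda>x. B * h x)" using assms(1) by simp
  have "\<bar>h x * g x\<bar> \<le> \<bar>B * h x\<bar>" if "x \<in> space M" for x
    using mult_left_mono[OF assms(3)[OF that], of "\<bar>h x\<bar>"] order_trans[OF abs_ge_zero assms(3)[OF that]]
    by (simp add: abs_mult mult.commute)
  then show "AE x in M. norm (h x * g x) \<le> norm (B * h x)" by (intro AE_I2) auto
qed (use assms in auto)

text \<open>Nonnegativity of the variance of \<open>\<bar>h\<bar>\<close>.\<close>

lemma abs_integral_le_sqrt:
  fixes h :: "'a \<Rightarrow> real"
  assumes [measurable]: "h \<in> borel_measurable M" and 2: "integrable M (\<lambda>x. (h x)\<^sup>2)"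
  shows "integrable M h" "(\<integral>x. \<bar>h x\<bar> \<partial>M) \<le> sqrt (\<integral>x. (h x)\<^sup>2 \<partial>M)"
proof -
  show 1: "integrable M h" by (rule square_integrable_imp_integrable) (use 2 in auto)
  have "0 \<le> variance (\<lambda>x. \<bar>h x\<bar>)" by (rule variance_positive)
  also have "\<dots> = expectation (\<lambda>x. \<bar>h x\<bar>\<^sup>2) - (expectation (\<lambda>x. \<bar>h x\<bar>))\<^sup>2"
    by (rule variance_eq) (use 1 2 in auto)
  finally show "(\<integral>x. \<bar>h x\<bar> \<partial>M) \<le> sqrt (\<integral>x. (h x)\<^sup>2 \<partial>M)"
    by (intro real_le_rsqrt) simp
qed

context
  fixes d :: "'a \<Rightarrow> 'i" and S :: "'i set"
  assumes d[measurable]: "d \<in> measurable M (count_space UNIV)" and S: "finite S"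
    and dS: "\<And>x. x \<in> space M \<Longrightarrow> d x \<in> S"
begin

lemma finite_classifier_measurable:
  fixes p :: "'i \<Rightarrow> real"
  shows "(\<lambda>x. p (d x)) \<in> borel_measurable M"
    "x \<in> space M \<Longrightarrow> \<bar>p (d x)\<bar> \<le> (\<Sum>j\<in>S. \<bar>p j\<bar>)"
  using member_le_sum[of "d x" S "\<lambda>j. \<bar>p j\<bar>"] S dS by (auto intro!: measurable_compose[OF d])

lemma integrable_finite_classifier:
  fixes p :: "'i \<Rightarrow> real"
  shows "integrable M (\<lambda>x. p (d x))"
    "integrable M h \<Longrightarrow> integrable M (\<lambda>x. h x * p (d x))"
  using integrable_times_bounded[of "\<lambda>_. 1" "\<lambda>x. p (d x)", OF _ finite_classifier_measurable]
    integrable_times_bounded[of h "\<lambda>x. p (d x)", OF _ finite_classifier_measurable] by auto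

lemma integral_times_classifier:
  assumes h: "integrable M h"
  shows "(\<integral>x. h x * p (d x) \<partial>M) = (\<Sum>j\<in>S. p j * cell_int M d h j)"
proof -
  have "(\<integral>x. h x * p (d x) \<partial>M) = (\<integral>x. (\<Sum>j\<in>S. p j * (h x * of_bool (d x = j))) \<partial>M)"
  proof (rule Bochner_Integration.integral_cong[OF refl])
    fix x assume "x \<in> space M"
    have "(\<Sum>j\<in>S. p j * (h x * of_bool (d x = j))) = (\<Sum>j\<in>{d x}. p j * (h x * of_bool (d x = j)))"
      by (rule sum.mono_neutral_right) (use S dS[OF \<open>x \<in> space M\<close>] in auto)
    then show "h x * p (d x) = (\<Sum>j\<in>S. p j * (h x * of_bool (d x = j)))" by simp
  qed
  also have "\<dots> = (\<Sum>j\<in>S. p j * cell_int M d h j)"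
    unfolding cell_int_def
    by (subst Bochner_Integration.integral_sum)
       (auto intro!: integrable_mult_right integrable_finite_classifier(2)[OF h, of "\<lambda>i. of_bool (i = j)" for j])
  finally show ?thesis .
qed

lemma cell_int_1: "cell_int M d (\<lambda>_. 1) j = cell M d j"
proof -
  have "cell_int M d (\<lambda>_. 1) j = (\<integral>x. indicator {x \<in> space M. d x = j} x \<partial>M)"
    unfolding cell_int_def by (rule Bochner_Integration.integral_cong) (auto simp: indicator_def)
  also have "\<dots> = cell M d j"
    unfolding cell_def by (simp add: Int_absorb2)
  finally show ?thesis .
qed

lemma integral_classifier: "(\<integral>x. p (d x) \<partial>M) = (\<Sum>j\<in>S. p j * cell M d j)"
  using integral_times_classifier[of "\<lambda>_. 1" p] by (simp add: cell_int_1)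

text \<open>Jensen's inequality on a single cell. The tangent to \<open>s ^ q\<close> at the
  absolute mean \<open>t\<close> is integrated over the cell; its linear part contributes
  nonnegatively, as the cell integral of \<open>\<bar>h\<bar>\<close> is at least \<open>t\<close>
  times the cell measure.\<close>

lemma cell_jensen:
  assumes h: "moments_le M h C"
  shows "cell M d j * \<bar>cell_mean M d h j\<bar> ^ q \<le> cell_int M d (\<lambda>x. \<bar>h x\<bar> ^ q) j"
proof -
  note hm = moments_leD[OF h]
  have nonneg: "cell_int M d (\<lambda>x. \<bar>h x\<bar> ^ q) j \<ge> 0"
    unfolding cell_int_def by (rule Bochner_Integration.integral_nonneg) auto
  show ?thesis
  proof (cases "cell M d j = 0")
    case True
    then show ?thesis using nonneg by simp
  next
    case False
    then have pos: "cell M d j > 0" by (simp add: cell_def zero_less_measure_iff)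
    define t where "t = \<bar>cell_mean M d h j\<bar>"
    show ?thesis
    proof (cases "t = 0")
      case True
      \<comment> \<open>For \<open>t = 0\<close> there is no tangent argument; only
        \<open>q = 0\<close> matters, where \<open>0 ^ 0 = 1\<close>.\<close>
      have "cell M d j \<le> cell_int M d (\<lambda>x. \<bar>h x\<bar> ^ 0) j" by (simp add: cell_int_1)
      then show ?thesis using True nonneg by (cases q) (auto simp: t_def)
    next
      case False
      then have t: "t > 0" by (simp add: t_def)
      let ?I = "\<lambda>x. of_bool (d x = j) :: real"
      note i = integrable_finite_classifier(2)[where p = "\<lambda>i. of_bool (i = j)"]
      note iI = integrable_finite_classifier(1)[where p = "\<lambda>i. of_bool (i = j)"]
      have tz: "t * cell M d j = \<bar>cell_int M d h j\<bar>"
        using pos by (simp add: t_def cell_mean_def)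
      have "t * cell M d j \<le> (\<integral>x. \<bar>h x * ?I x\<bar> \<partial>M)"
        unfolding tz cell_int_def using integral_norm_bound[of M "\<lambda>x. h x * ?I x"] by simp
      also have "\<dots> = (\<integral>x. \<bar>h x\<bar> * ?I x \<partial>M)" by (simp add: abs_mult)
      finally have a: "0 \<le> (\<integral>x. \<bar>h x\<bar> * ?I x \<partial>M) - t * cell M d j" by simp
      have "t ^ q * cell M d j \<le> t ^ q * cell M d j
          + real q * t ^ q / t * ((\<integral>x. \<bar>h x\<bar> * ?I x \<partial>M) - t * cell M d j)"
        using a t by (intro le_add_same_cancel1[THEN iffD2] mult_nonneg_nonneg) auto
      also have "\<dots> = (\<integral>x. t ^ q * ?I x + real q * t ^ q / t * (\<bar>h x\<bar> * ?I x - t * ?I x) \<partial>M)"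
        using i[of "\<lambda>x. \<bar>h x\<bar>"] hm(4) iI cell_int_1[of j, unfolded cell_int_def]
        by (simp add: integrable_abs_iff)
      also have "\<dots> \<le> (\<integral>x. \<bar>h x\<bar> ^ q * ?I x \<partial>M)"
      proof (rule integral_mono)
        show "integrable M (\<lambda>x. \<bar>h x\<bar> ^ q * ?I x)" using i hm(2) by blast
        show "integrable M (\<lambda>x. t ^ q * ?I x + real q * t ^ q / t * (\<bar>h x\<bar> * ?I x - t * ?I x))"
          using i[of "\<lambda>x. \<bar>h x\<bar>"] hm(4) iI by auto
        show "t ^ q * ?I x + real q * t ^ q / t * (\<bar>h x\<bar> * ?I x - t * ?I x) \<le> \<bar>h x\<bar> ^ q * ?I x" for x
          using power_tangent[OF abs_ge_zero t, of q "h x"] by (simp add: field_simps)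
      qed
      finally show ?thesis by (simp add: t_def cell_int_def mult.commute)
    qed
  qed
qed

lemma cell_int_eq_mean:
  assumes h: "moments_le M h C"
  shows "cell_int M d h j = cell_mean M d h j * cell M d j"
proof (cases "cell M d j = 0")
  case True
  have "AE x in M. x \<notin> {x \<in> space M. d x = j}"
    using True by (intro AE_not_in) (simp add: cell_def null_sets_def emeasure_eq_measure)
  then have "AE x in M. h x * of_bool (d x = j) = 0" using AE_space by eventually_elim auto
  then have "cell_int M d h j = 0"
    unfolding cell_int_def using moments_leD(1)[OF h]
    by (subst integral_cong_AE[of _ M "\<lambda>_. 0"]) (auto intro!: measurable_compose[OF d])
  then show ?thesis by (simp add: True)
qed (simp add: cell_mean_def)

text \<open>The defining property of the conditional expectation: functions of the cell cannot
  distinguish \<open>h\<close> from its cell means.\<close>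

lemma integral_mean_orthogonal:
  assumes h: "moments_le M h C"
  shows "(\<integral>x. cell_mean M d h (d x) * p (d x) \<partial>M) = (\<integral>x. h x * p (d x) \<partial>M)"
  using integral_classifier[of "\<lambda>j. cell_mean M d h j * p j"]
    integral_times_classifier[OF moments_leD(4)[OF h], of p] cell_int_eq_mean[OF h]
  by (simp add: mult_ac)

lemma moments_le_cell_mean:
  assumes h: "moments_le M h C"
  shows "moments_le M (\<lambda>x. cell_mean M d h (d x)) C"
  unfolding moments_le_def
proof (intro conjI allI)
  show "(\<lambda>x. cell_mean M d h (d x)) \<in> borel_measurable M" by (rule finite_classifier_measurable)
  fix q
  show "integrable M (\<lambda>x. \<bar>cell_mean M d h (d x)\<bar> ^ q)"
    using integrable_finite_classifier(1)[of "\<lambda>j. \<bar>cell_mean M d h j\<bar> ^ q"] .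
  have "(\<integral>x. \<bar>cell_mean M d h (d x)\<bar> ^ q \<partial>M) = (\<Sum>j\<in>S. \<bar>cell_mean M d h j\<bar> ^ q * cell M d j)"
    using integral_classifier[of "\<lambda>j. \<bar>cell_mean M d h j\<bar> ^ q"] .
  also have "\<dots> \<le> (\<Sum>j\<in>S. 1 * cell_int M d (\<lambda>x. \<bar>h x\<bar> ^ q) j)"
    using cell_jensen[OF h] by (intro sum_mono) (simp add: mult.commute)
  also have "\<dots> = (\<integral>x. \<bar>h x\<bar> ^ q * 1 \<partial>M)"
    by (rule integral_times_classifier[symmetric]) (rule moments_leD(2)[OF h])
  also have "\<dots> \<le> C q" using moments_leD(3)[OF h, of q] by simp
  finally show "(\<integral>x. \<bar>cell_mean M d h (d x)\<bar> ^ q \<partial>M) \<le> C q" .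
qed

lemma energy_le:
  assumes h: "moments_le M h C"
  shows "0 \<le> energy M d h" "energy M d h \<le> C 2"
proof -
  show "0 \<le> energy M d h" unfolding energy_def by (rule Bochner_Integration.integral_nonneg) auto
  show "energy M d h \<le> C 2"
    using moments_leD(3)[OF moments_le_cell_mean[OF h], of 2] by (simp add: energy_def)
qed

text \<open>Pythagoras: the means over the coarser partition \<open>e\<close> are the orthogonal
  projection of those over \<open>d\<close>, so the cross term equals the coarser energy.\<close>

lemma energy_refine:
  fixes e :: "'a \<Rightarrow> 'k" and \<phi> :: "'i \<Rightarrow> 'k"
  assumes h: "moments_le M h C" and \<phi>: "\<And>x. x \<in> space M \<Longrightarrow> e x = \<phi> (d x)"
  shows "(\<integral>x. (cell_mean M d h (d x) - cell_mean M e h (e x))\<^sup>2 \<partial>M) = energy M d h - energy M e h"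
proof -
  note i = integrable_finite_classifier(1)
  have "(\<integral>x. cell_mean M d h (d x) * cell_mean M e h (e x) \<partial>M)
      = (\<integral>x. cell_mean M d h (d x) * cell_mean M e h (\<phi> (d x)) \<partial>M)"
    by (rule Bochner_Integration.integral_cong) (auto simp: \<phi>)
  also have "\<dots> = (\<integral>x. h x * cell_mean M e h (\<phi> (d x)) \<partial>M)"
    by (rule integral_mean_orthogonal[OF h])
  also have "\<dots> = (\<integral>x. h x * cell_mean M e h (e x) \<partial>M)"
    by (rule Bochner_Integration.integral_cong) (auto simp: \<phi>)
  also have "\<dots> = (\<integral>x. cell_mean M e h (e x) * cell_mean M e h (e x) \<partial>M)"
  proof (rule prob_space.integral_mean_orthogonal[OF prob_space_axioms, symmetric, where S = "\<phi> ` S"])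
    show "e \<in> measurable M (count_space UNIV)"
      by (subst measurable_cong[where g = "\<lambda>x. \<phi> (d x)"]) (auto simp: \<phi> intro: measurable_compose[OF d])
  qed (use S dS \<phi> h in auto)
  finally have cross: "(\<integral>x. cell_mean M d h (d x) * cell_mean M e h (e x) \<partial>M) = energy M e h"
    by (simp add: energy_def power2_eq_square)
  have "(\<integral>x. (cell_mean M d h (d x) - cell_mean M e h (e x))\<^sup>2 \<partial>M)
     = (\<integral>x. (cell_mean M d h (d x))\<^sup>2 + (cell_mean M e h (e x))\<^sup>2
          - 2 * (cell_mean M d h (d x) * cell_mean M e h (e x)) \<partial>M)"
    by (simp add: power2_eq_square algebra_simps)
  also have "\<dots> = energy M d h + energy M e h - 2 * energy M e h"
  proof -
    have "integrable M (\<lambda>x. (cell_mean M d h (d x))\<^sup>2)" using i[of "\<lambda>j. (cell_mean M d h j)\<^sup>2"] .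
    moreover have "integrable M (\<lambda>x. (cell_mean M e h (e x))\<^sup>2)"
      using i[of "\<lambda>j. (cell_mean M e h (\<phi> j))\<^sup>2"] by (subst Bochner_Integration.integrable_cong[OF refl]) (auto simp: \<phi>)
    moreover have "integrable M (\<lambda>x. cell_mean M d h (d x) * cell_mean M e h (e x))"
      using i[of "\<lambda>j. cell_mean M d h j * cell_mean M e h (\<phi> j)"]
      by (subst Bochner_Integration.integrable_cong[OF refl]) (auto simp: \<phi>)
    ultimately show ?thesis by (simp add: cross) (simp add: energy_def)
  qed
  finally show ?thesis by simp
qed

end

end

section \<open>Regularity partitions\<close>

definition pair_class :: "('a \<Rightarrow> nat) \<Rightarrow> 'a \<times> 'a \<Rightarrow> nat \<times> nat" where
  "pair_class c u = (c (fst u), c (snd u))"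

definition step_kernel :: "'a measure \<Rightarrow> ('a \<Rightarrow> nat) \<Rightarrow> ('a \<times> 'a \<Rightarrow> real) \<Rightarrow> 'a \<times> 'a \<Rightarrow> real" where
  "step_kernel M c h u = cell_mean (M \<Otimes>\<^sub>M M) (pair_class c) h (pair_class c u)"

text \<open>The bound need not be small for a single \<open>k\<close>; it becomes small because
  energies along a chain of refinements are increasing and bounded. Of the last summand,
  \<open>1 / (k + 1)\<close> pays for test functions that are only nearly optimal and
  \<open>4 * C i 1 / (k + 1)\<close> for rounding them.\<close>

definition regular_step ::
    "'a measure \<Rightarrow> nat \<Rightarrow> (nat \<Rightarrow> 'a \<times> 'a \<Rightarrow> real) \<Rightarrow> (nat \<Rightarrow> nat \<Rightarrow> real) \<Rightarrow> ('a \<Rightarrow> nat) \<Rightarrow> ('a \<Rightarrow> nat) \<Rightarrow> bool" where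
  "regular_step M k w C c c' \<longleftrightarrow> (\<forall>i\<le>k. cut_le M (\<lambda>u. w i u - step_kernel M c (w i) u)
     (sqrt (energy (M \<Otimes>\<^sub>M M) (pair_class c') (w i) - energy (M \<Otimes>\<^sub>M M) (pair_class c) (w i))
       + (1 + 4 * C i 1) / (real k + 1)))"

text \<open>There are \<open>k + 1\<close> kernels with two test functions each, every one rounded
  to the \<open>2 * (k + 1) + 1\<close> grid points of mesh \<open>1 / (k + 1)\<close> between -1
  and 1. The kernels do not enter, so the numbers of cells are the same for all of them.\<close>

definition refinement_factor :: "nat \<Rightarrow> nat" where
  "refinement_factor k = (2 * (k + 1) + 1) ^ (2 * (k + 1))"

text \<open>The values are read as the digits of a number in base \<open>B\<close>; division and
  remainder recover them.\<close>

lemma combine_classifiers: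
  fixes F :: "nat \<Rightarrow> 'a \<Rightarrow> nat"
  assumes "\<And>s. s < n \<Longrightarrow> F s \<in> measurable M (count_space UNIV)" "\<And>s x. s < n \<Longrightarrow> F s x < B"
  shows "\<exists>d\<in>measurable M (count_space UNIV). (\<forall>x. d x < B ^ n) \<and> (\<forall>s<n. \<exists>\<phi>. \<forall>x. F s x = \<phi> (d x))"
  using assms
proof (induction n)
  case 0
  show ?case by (rule bexI[of _ "\<lambda>_. 0"]) auto
next
  case (Suc n)
  then obtain d where d[measurable]: "d \<in> measurable M (count_space UNIV)" and dB: "\<And>x. d x < B ^ n"
    and \<phi>: "\<And>s. s < n \<Longrightarrow> \<exists>\<phi>. \<forall>x. F s x = \<phi> (d x)"
    by (metis less_SucI)
  have [measurable]: "F n \<in> measurable M (count_space UNIV)" and FB: "\<And>x. F n x < B"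
    using Suc.prems by auto
  show ?case
  proof (intro bexI[of _ "\<lambda>x. d x * B + F n x"] conjI allI impI)
    fix x
    have "d x * B + F n x < (d x + 1) * B" using FB[of x] by simp
    also have "\<dots> \<le> B ^ n * B" using dB[of x] by (intro mult_le_mono1) auto
    finally show "d x * B + F n x < B ^ Suc n" by (simp add: mult.commute)
  next
    fix s assume "s < Suc n"
    show "\<exists>\<phi>. \<forall>x. F s x = \<phi> (d x * B + F n x)"
    proof (cases "s = n")
      case True
      then show ?thesis using FB by (intro exI[of _ "\<lambda>y. y mod B"]) simp
    next
      case False
      then obtain \<psi> where "\<forall>x. F s x = \<psi> (d x)" using \<phi> \<open>s < Suc n\<close> by (metis less_SucE)
      moreover have "B > 0" using FB[of undefined] by auto
      ultimately show ?thesis using FB by (intro exI[of _ "\<lambda>y. \<psi> (y div B)"]) simp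
    qed
  qed measurable
qed

lemma floor_discretization:
  fixes v :: real and k :: nat
  assumes "\<bar>v\<bar> \<le> 1"
  defines "n \<equiv> nat \<lfloor>(v + 1) * (k + 1)\<rfloor>"
  shows "n < 2 * (k + 1) + 1" "\<bar>real n / (k + 1) - 1\<bar> \<le> 1" "\<bar>v - (real n / (k + 1) - 1)\<bar> \<le> 1 / (k + 1)"
proof -
  have v: "0 \<le> (v + 1) * (k + 1)" "(v + 1) * (k + 1) \<le> 2 * (k + 1)"
    using assms(1) mult_right_mono[of "v + 1" 2 "real (k + 1)"] by (simp_all add: abs_le_iff)
  have n: "real n \<le> (v + 1) * (k + 1)" "(v + 1) * (k + 1) < real n + 1"
    using v(1) by (simp_all add: n_def)
  then have n2: "real n \<le> 2 * (k + 1)" using v(2) by linarith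
  then show "n < 2 * (k + 1) + 1" by linarith
  show "\<bar>real n / (k + 1) - 1\<bar> \<le> 1" using n2 by (simp add: abs_le_iff field_simps)
  have "v - (real n / (k + 1) - 1) = ((v + 1) * (k + 1) - n) / (k + 1)" by (simp add: field_simps)
  also have "\<bar>\<dots>\<bar> \<le> 1 / (k + 1)"
    unfolding abs_divide using n by (intro frac_le) auto
  finally show "\<bar>v - (real n / (k + 1) - 1)\<bar> \<le> 1 / (k + 1)" .
qed

context prob_space
begin

lemma prob_space_pair_self: "prob_space (M \<Otimes>\<^sub>M M)"
proof -
  interpret pair_prob_space M M by unfold_locales
  show ?thesis by (rule P.prob_space_axioms)
qed

lemma pair_class_finite_classifier:
  assumes [measurable]: "c \<in> measurable M (count_space UNIV)" and "\<And>x. c x < K"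
  shows "pair_class c \<in> measurable (M \<Otimes>\<^sub>M M) (count_space UNIV)"
    "finite ({..<K} \<times> {..<K})" "pair_class c u \<in> {..<K} \<times> {..<K}"
proof -
  have [measurable]: "(\<lambda>u. (c (fst u), c (snd u))) \<in> measurable (M \<Otimes>\<^sub>M M) (count_space UNIV \<Otimes>\<^sub>M count_space UNIV)"
    by measurable
  show "pair_class c \<in> measurable (M \<Otimes>\<^sub>M M) (count_space UNIV)"
    unfolding pair_class_def[abs_def]
    by (metis (no_types) \<open>(\<lambda>u. (c (fst u), c (snd u))) \<in> _\<close> UNIV_Times_UNIV countableI_type pair_measure_countable)
qed (use assms in \<open>auto simp: pair_class_def\<close>)

text \<open>The refinement records the discretised level sets of nearly optimal test functions for the
  cut norms of the first \<open>k + 1\<close> kernels. Any remaining cut norm is thereby paid for by an energy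
  increment.\<close>

lemma energy_increment_refinement:
  fixes w :: "nat \<Rightarrow> 'a \<times> 'a \<Rightarrow> real"
  assumes w: "\<And>i. moments_le (M \<Otimes>\<^sub>M M) (w i) (C i)"
    and c[measurable]: "c \<in> measurable M (count_space UNIV)" and cK: "\<And>x. c x < K"
  shows "\<exists>c'\<in>measurable M (count_space UNIV). (\<forall>x. c' x < K * refinement_factor k) \<and>
    (\<forall>x. c x = c' x div refinement_factor k) \<and> regular_step M k w C c c'"
proof -
  let ?N = "M \<Otimes>\<^sub>M M"
  interpret N: prob_space ?N by (rule prob_space_pair_self)
  note cl = pair_class_finite_classifier[OF c cK]
  define D where "D = (\<lambda>i u. w i u - step_kernel M c (w i) u)"
  define adm where "adm = (\<lambda>f. f \<in> borel_measurable M \<and> (\<forall>x. \<bar>f x\<bar> \<le> (1::real)))"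
  define Q where "Q = (\<lambda>i f g. \<integral>u. D i u * (f (fst u) * g (snd u)) \<partial>?N)"
  have wi: "integrable ?N (w i)" for i using moments_leD(4)[OF w] .
  have si: "moments_le ?N (step_kernel M c (w i)) (C i)" for i
    unfolding step_kernel_def[abs_def] by (rule N.moments_le_cell_mean[OF cl w])
  have Di: "integrable ?N (D i)" for i
    unfolding D_def using wi moments_leD(4)[OF si] by simp
  have D1: "(\<integral>u. \<bar>D i u\<bar> \<partial>?N) \<le> 2 * C i 1" for i
  proof -
    have "(\<integral>u. \<bar>D i u\<bar> \<partial>?N) \<le> (\<integral>u. \<bar>w i u\<bar> ^ 1 + \<bar>step_kernel M c (w i) u\<bar> ^ 1 \<partial>?N)"
      using Di wi moments_leD(4)[OF si] by (intro integral_mono) (auto simp: D_def)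
    also have "\<dots> \<le> 2 * C i 1"
      using moments_leD(2,3)[OF si, of i 1] moments_leD(2,3)[OF w, of i 1]
      by (subst Bochner_Integration.integral_add) auto
    finally show ?thesis .
  qed
  have int: "integrable ?N (\<lambda>u. D i u * p u)" "\<bar>\<integral>u. D i u * p u \<partial>?N\<bar> \<le> b * (2 * C i 1)"
    if [measurable]: "p \<in> borel_measurable ?N" and b: "\<And>u. \<bar>p u\<bar> \<le> b" for i p b
  proof -
    show 1: "integrable ?N (\<lambda>u. D i u * p u)"
      by (rule N.integrable_times_bounded[OF Di, of _ b]) (use b in auto)
    have "\<bar>\<integral>u. D i u * p u \<partial>?N\<bar> \<le> (\<integral>u. \<bar>D i u * p u\<bar> \<partial>?N)"
      using integral_norm_bound[of ?N "\<lambda>u. D i u * p u"] by simp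
    also have "\<dots> \<le> (\<integral>u. b * \<bar>D i u\<bar> \<partial>?N)"
    proof (rule integral_mono)
      show "\<bar>D i u * p u\<bar> \<le> b * \<bar>D i u\<bar>" for u
        using mult_left_mono[OF b, of "\<bar>D i u\<bar>"] by (simp add: abs_mult mult.commute)
    qed (use 1 Di in auto)
    also have "\<dots> \<le> b * (2 * C i 1)" using D1[of i] order_trans[OF abs_ge_zero b]
      by (simp add: mult_left_mono)
    finally show "\<bar>\<integral>u. D i u * p u \<partial>?N\<bar> \<le> b * (2 * C i 1)" .
  qed
  \<comment> \<open>The supremum defining the cut norm need not be attained, so it is approached up
    to \<open>1 / (k + 1)\<close>; its finiteness comes from the \<open>L1\<close> bound on
    \<open>D i\<close>.\<close>
  have "\<exists>f g. adm f \<and> adm g \<and> (\<forall>f' g'. adm f' \<longrightarrow> adm g' \<longrightarrow> \<bar>Q i f' g'\<bar> \<le> \<bar>Q i f g\<bar> + 1 / (real k + 1))" for i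
  proof -
    define X where "X = {\<bar>Q i f g\<bar> | f g. adm f \<and> adm g}"
    have X0: "X \<noteq> {}" unfolding X_def by (auto simp: adm_def intro!: exI[of _ "\<lambda>_. 0"])
    have "x \<le> 1 * (2 * C i 1)" if "x \<in> X" for x
    proof -
      obtain f g where fg: "x = \<bar>Q i f g\<bar>" "adm f" "adm g" using \<open>x \<in> X\<close> by (auto simp: X_def)
      then have [measurable]: "f \<in> borel_measurable M" "g \<in> borel_measurable M" by (auto simp: adm_def)
      show ?thesis unfolding fg(1) Q_def using fg
        by (intro int) (auto simp: adm_def abs_mult intro!: mult_le_one)
    qed
    then have bdd: "bdd_above X" by (rule bdd_aboveI)
    obtain x where x: "x \<in> X" "Sup X - 1 / (real k + 1) < x"
      using less_cSup_iff[OF X0 bdd, of "Sup X - 1 / (real k + 1)"] by auto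
    then obtain f g where fg: "x = \<bar>Q i f g\<bar>" "adm f" "adm g" by (auto simp: X_def)
    have "\<bar>Q i f' g'\<bar> \<le> \<bar>Q i f g\<bar> + 1 / (real k + 1)" if "adm f'" "adm g'" for f' g'
    proof -
      have "\<bar>Q i f' g'\<bar> \<le> Sup X" using that by (intro cSup_upper bdd) (auto simp: X_def)
      then show ?thesis using x(2) fg(1) by linarith
    qed
    then show ?thesis using fg by blast
  qed
  then obtain f0 g0 where fg0: "\<And>i. adm (f0 i)" "\<And>i. adm (g0 i)"
    "\<And>i f' g'. adm f' \<Longrightarrow> adm g' \<Longrightarrow> \<bar>Q i f' g'\<bar> \<le> \<bar>Q i (f0 i) (g0 i)\<bar> + 1 / (real k + 1)"
    by metis
  define v where "v = (\<lambda>s. if even s then f0 (s div 2) else g0 (s div 2))"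
  have v: "v s \<in> borel_measurable M" "\<bar>v s x\<bar> \<le> 1" for s x
    using fg0(1,2) by (auto simp: v_def adm_def)
  define F where "F = (\<lambda>s x. nat \<lfloor>(v s x + 1) * (k + 1)\<rfloor>)"
  define R where "R = refinement_factor k"
  have Fm: "F s \<in> measurable M (count_space UNIV)" for s
    unfolding F_def using v(1)[measurable] by measurable
  have FB: "F s x < 2 * (k + 1) + 1" for s x
    unfolding F_def by (rule floor_discretization(1)[OF v(2)])
  obtain d where d[measurable]: "d \<in> measurable M (count_space UNIV)" and dR: "\<And>x. d x < R"
    and "\<forall>s<2 * (k + 1). \<exists>\<phi>. \<forall>x. F s x = \<phi> (d x)"
    using combine_classifiers[of "2 * (k + 1)" F M "2 * (k + 1) + 1"] Fm FB
    unfolding R_def refinement_factor_def by blast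
  then obtain \<phi> where \<phi>: "\<And>s x. s < 2 * (k + 1) \<Longrightarrow> F s x = \<phi> s (d x)" by metis
  have R: "R > 0" using dR[of undefined] by auto
  \<comment> \<open>Mixed-radix code: the quotient by \<open>R\<close> is the old class, the
    remainder the new information. Refinement thus has the same arithmetic form for all
    kernels.\<close>
  define c' where "c' = (\<lambda>x. c x * R + d x)"
  have c'm[measurable]: "c' \<in> measurable M (count_space UNIV)" unfolding c'_def by measurable
  have c'K: "c' x < K * R" for x
  proof -
    have "c' x < (c x + 1) * R" using dR[of x] by (simp add: c'_def)
    also have "\<dots> \<le> K * R" using cK[of x] by (intro mult_le_mono1) auto
    finally show ?thesis .
  qed
  have div: "c x = c' x div R" and mod: "d x = c' x mod R" for x
    using dR[of x] R by (auto simp: c'_def)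
  note cl' = pair_class_finite_classifier[OF c'm c'K]
  show ?thesis
    unfolding R_def[symmetric] regular_step_def
  proof (intro bexI[of _ c'] conjI allI impI c'm c'K div)
    fix i assume ik: "i \<le> k"
    let ?\<Delta> = "energy ?N (pair_class c') (w i) - energy ?N (pair_class c) (w i)"
    define g' where "g' = (\<lambda>s a. real (\<phi> s (a mod R)) / (k + 1) - 1)"
    have g': "\<bar>g' s (c' x)\<bar> \<le> 1" "\<bar>v s x - g' s (c' x)\<bar> \<le> 1 / (k + 1)"
        "(\<lambda>x. g' s (c' x)) \<in> borel_measurable M" if "s < 2 * (k + 1)" for s x
    proof -
      have "g' s (c' x) = real (F s x) / (k + 1) - 1"
        using \<phi>[OF that] mod[of x] by (simp add: g'_def)
      with floor_discretization(2,3)[OF v(2)[of s x], of k]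
      show "\<bar>g' s (c' x)\<bar> \<le> 1" "\<bar>v s x - g' s (c' x)\<bar> \<le> 1 / (k + 1)" by (simp_all add: F_def)
      show "(\<lambda>x. g' s (c' x)) \<in> borel_measurable M" by (rule measurable_compose[OF c'm]) simp
    qed
    have s: "2 * i < 2 * (k + 1)" "2 * i + 1 < 2 * (k + 1)" using ik by auto
    have v2: "v (2 * i) = f0 i" "v (2 * i + 1) = g0 i" by (auto simp: v_def)
    define p where "p = (\<lambda>j. g' (2 * i) (fst j) * g' (2 * i + 1) (snd j))"
    have pu: "p (pair_class c' u) = g' (2 * i) (c' (fst u)) * g' (2 * i + 1) (c' (snd u))" for u
      by (simp add: p_def pair_class_def)
    have p1: "\<bar>p (pair_class c' u)\<bar> \<le> 1" for u
      unfolding pu abs_mult using g'(1) s by (intro mult_le_one) auto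
    have pm[measurable]: "(\<lambda>u. p (pair_class c' u)) \<in> borel_measurable ?N"
      by (rule measurable_compose[OF cl'(1)]) simp
    have f0m[measurable]: "f0 i \<in> borel_measurable M" "g0 i \<in> borel_measurable M"
      using fg0(1,2)[of i] by (auto simp: adm_def)
    \<comment> \<open>Rounding moves each factor by at most \<open>1 / (k + 1)\<close>, hence the
      product by twice that; the \<open>L1\<close> norm of \<open>D i\<close> is at most
      \<open>2 * C i 1\<close>.\<close>
    have step1: "\<bar>Q i (f0 i) (g0 i) - (\<integral>u. D i u * p (pair_class c' u) \<partial>?N)\<bar> \<le> 2 / (k + 1) * (2 * C i 1)"
    proof -
      have bd: "\<bar>f0 i (fst u) * g0 i (snd u) - p (pair_class c' u)\<bar> \<le> 2 / (k + 1)" for u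
      proof -
        let ?a = "f0 i (fst u)" and ?b = "g0 i (snd u)"
        let ?a' = "g' (2 * i) (c' (fst u))" and ?b' = "g' (2 * i + 1) (c' (snd u))"
        have "?a * ?b - ?a' * ?b' = ?a * (?b - ?b') + (?a - ?a') * ?b'" by (simp add: algebra_simps)
        also have "\<bar>\<dots>\<bar> \<le> \<bar>?a\<bar> * \<bar>?b - ?b'\<bar> + \<bar>?a - ?a'\<bar> * \<bar>?b'\<bar>"
          by (metis abs_mult abs_triangle_ineq)
        also have "\<dots> \<le> 1 * (1 / (k + 1)) + 1 / (k + 1) * 1"
          using g'(2)[OF s(1), of "fst u"] g'(2)[OF s(2), of "snd u"] g'(1)[OF s(2), of "snd u"]
            v(2)[of "2 * i" "fst u"] unfolding v2 by (intro add_mono mult_mono) auto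
        finally show ?thesis by (simp add: pu)
      qed
      have "Q i (f0 i) (g0 i) - (\<integral>u. D i u * p (pair_class c' u) \<partial>?N)
          = (\<integral>u. D i u * (f0 i (fst u) * g0 i (snd u) - p (pair_class c' u)) \<partial>?N)"
        unfolding Q_def
      proof (subst Bochner_Integration.integral_diff[symmetric])
        show "integrable ?N (\<lambda>u. D i u * (f0 i (fst u) * g0 i (snd u)))"
          by (rule int(1)[of _ 1]) (use fg0(1,2)[of i] in \<open>auto simp: adm_def abs_mult intro!: mult_le_one\<close>)
        show "integrable ?N (\<lambda>u. D i u * p (pair_class c' u))"
          by (rule int(1)[of _ 1]) (use p1 in auto)
      qed (simp add: right_diff_distrib)
      also have "\<bar>\<dots>\<bar> \<le> 2 / (k + 1) * (2 * C i 1)"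
        by (rule int(2)) (use bd in auto)
      finally show ?thesis .
    qed
    \<comment> \<open>The rounded test function is constant on the cells of \<open>c'\<close>, so
      the kernel may be replaced by its averages over them. What remains is a difference of two
      averages, whose squared \<open>L2\<close> norm is the energy increment.\<close>
    have step2: "\<bar>\<integral>u. D i u * p (pair_class c' u) \<partial>?N\<bar> \<le> sqrt ?\<Delta>"
    proof -
      define G where "G = (\<lambda>u. step_kernel M c' (w i) u - step_kernel M c (w i) u)"
      have s'i: "moments_le ?N (step_kernel M c' (w i)) (C i)"
        unfolding step_kernel_def[abs_def] by (rule N.moments_le_cell_mean[OF cl' w])
      have Gm: "moments_le ?N G (\<lambda>q. 2 ^ q * (C i q + C i q))"
        unfolding G_def by (rule moments_le_diff[OF s'i si])
      note G = moments_leD[OF Gm]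
      have i: "integrable ?N (\<lambda>u. h u * p (pair_class c' u))" if "integrable ?N h" for h
        by (rule N.integrable_times_bounded[OF that, of _ 1]) (use p1 in auto)
      have "(\<integral>u. D i u * p (pair_class c' u) \<partial>?N)
          = (\<integral>u. w i u * p (pair_class c' u) \<partial>?N) - (\<integral>u. step_kernel M c (w i) u * p (pair_class c' u) \<partial>?N)"
        unfolding D_def using i[OF wi[of i]] i[OF moments_leD(4)[OF si]] by (simp add: left_diff_distrib)
      also have "(\<integral>u. w i u * p (pair_class c' u) \<partial>?N) = (\<integral>u. step_kernel M c' (w i) u * p (pair_class c' u) \<partial>?N)"
        unfolding step_kernel_def by (rule N.integral_mean_orthogonal[OF cl' w, symmetric])
      also have "\<dots> - (\<integral>u. step_kernel M c (w i) u * p (pair_class c' u) \<partial>?N) = (\<integral>u. G u * p (pair_class c' u) \<partial>?N)"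
        unfolding G_def using i[OF moments_leD(4)[OF s'i]] i[OF moments_leD(4)[OF si]] by (simp add: left_diff_distrib)
      also have "\<bar>\<dots>\<bar> \<le> (\<integral>u. \<bar>G u * p (pair_class c' u)\<bar> \<partial>?N)"
        using integral_norm_bound[of ?N "\<lambda>u. G u * p (pair_class c' u)"] by simp
      also have "\<dots> \<le> (\<integral>u. \<bar>G u\<bar> \<partial>?N)"
      proof (rule integral_mono)
        show "\<bar>G u * p (pair_class c' u)\<bar> \<le> \<bar>G u\<bar>" for u
          using p1[of u] by (simp add: abs_mult mult_left_le)
      qed (use i[OF G(4)] G(4) in auto)
      also have "\<dots> \<le> sqrt (\<integral>u. (G u)\<^sup>2 \<partial>?N)"
        by (rule N.abs_integral_le_sqrt(2)) (use G(1) G(2)[of 2] in auto)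
      also have "(\<integral>u. (G u)\<^sup>2 \<partial>?N) = ?\<Delta>"
        unfolding G_def step_kernel_def
        by (rule N.energy_refine[OF cl' w, where \<phi> = "\<lambda>j. (fst j div R, snd j div R)"])
          (simp add: pair_class_def div)
      finally show ?thesis .
    qed
    show "cut_le M (\<lambda>u. w i u - step_kernel M c (w i) u) (sqrt ?\<Delta> + (1 + 4 * C i 1) / (real k + 1))"
      unfolding cut_le_def
    proof (intro ballI impI)
      fix f g :: "'a \<Rightarrow> real"
      assume "f \<in> borel_measurable M" "g \<in> borel_measurable M" "\<forall>x. \<bar>f x\<bar> \<le> 1" "\<forall>x. \<bar>g x\<bar> \<le> 1"
      then have "\<bar>Q i f g\<bar> \<le> \<bar>Q i (f0 i) (g0 i)\<bar> + 1 / (real k + 1)" by (intro fg0(3)) (auto simp: adm_def)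
      also have "\<dots> \<le> sqrt ?\<Delta> + 2 / (k + 1) * (2 * C i 1) + 1 / (real k + 1)"
        using step1 step2 by linarith
      also have "\<dots> = sqrt ?\<Delta> + (1 + 4 * C i 1) / (real k + 1)" by (simp add: field_simps)
      finally show "\<bar>\<integral>u. (w i u - step_kernel M c (w i) u) * (f (fst u) * g (snd u)) \<partial>?N\<bar>
          \<le> sqrt ?\<Delta> + (1 + 4 * C i 1) / (real k + 1)" by (simp add: Q_def D_def)
    qed
  qed
qed

end

definition num_cells :: "nat \<Rightarrow> nat" where
  "num_cells k = (\<Prod>l<k. refinement_factor l)"

lemma num_cells_simps [simp]: "num_cells 0 = 1" "num_cells (Suc k) = num_cells k * refinement_factor k"
  by (simp_all add: num_cells_def)

lemma refinement_factor_pos [simp]: "refinement_factor k > 0"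
  by (simp add: refinement_factor_def)

lemma num_cells_pos [simp]: "num_cells k > 0"
  by (induction k) auto

text \<open>Dependent choice iterates the refinement from the trivial partition. The cell counts and
  the coding by quotients are the same for every \<open>w\<close>, which makes the partitions of
  different kernels comparable entry by entry.\<close>

lemma (in prob_space) regularity_partitions:
  fixes w :: "nat \<Rightarrow> 'a \<times> 'a \<Rightarrow> real"
  assumes w: "\<And>i. moments_le (M \<Otimes>\<^sub>M M) (w i) (C i)"
  shows "\<exists>c. (\<forall>k. c k \<in> measurable M (count_space UNIV) \<and> (\<forall>x. c k x < num_cells k) \<and>
      (\<forall>x. c k x = c (Suc k) x div refinement_factor k) \<and> regular_step M k w C (c k) (c (Suc k)))"
proof -
  define P where "P = (\<lambda>k c. c \<in> measurable M (count_space UNIV) \<and> (\<forall>x. c x < num_cells k))"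
  define Q where "Q = (\<lambda>k c c'. (\<forall>x. c x = c' x div refinement_factor k) \<and> regular_step M k w C c c')"
  have "\<exists>c. \<forall>k. P k (c k) \<and> Q k (c k) (c (Suc k))"
  proof (rule dependent_nat_choice)
    show "\<exists>c. P 0 c" by (rule exI[of _ "\<lambda>_. 0"]) (simp add: P_def)
  next
    fix c k assume "P k c"
    then show "\<exists>c'. P (Suc k) c' \<and> Q k c c'"
      using energy_increment_refinement[of w C c "num_cells k" k, OF w] unfolding P_def Q_def by auto
  qed
  then show ?thesis unfolding P_def Q_def by (simp only: conj_assoc)
qed

section \<open>Diagonal subsequences, densities of step kernels and convergence tools\<close>

lemma bounded_diagonal_subsequence:
  fixes X :: "'i::countable \<Rightarrow> nat \<Rightarrow> real"
  assumes bdd: "\<And>i n. \<bar>X i n\<bar> \<le> B i"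
  shows "\<exists>r. strict_mono r \<and> (\<forall>i. convergent (\<lambda>n. X i (r n)))"
proof -
  define P where "P = (\<lambda>j r. convergent (\<lambda>n. X (from_nat j) (r n)))"
  interpret subseqs P
  proof
    fix j and s :: "nat \<Rightarrow> nat" assume "strict_mono s"
    have "bounded (range (\<lambda>n. X (from_nat j) (s n)))"
      using bdd by (auto simp: bounded_iff intro!: exI[of _ "B (from_nat j)"])
    then obtain l r' where "strict_mono r'" "((\<lambda>n. X (from_nat j) (s n)) \<circ> r') \<longlonglongrightarrow> l"
      using bounded_imp_convergent_subsequence by blast
    then show "\<exists>r'. strict_mono r' \<and> P j (s \<circ> r')"
      by (intro exI[of _ r']) (auto simp: P_def convergent_def o_def)
  qed
  have "convergent (\<lambda>n. X i (diagseq n))" for i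
  proof -
    \<comment> \<open>The diagonal sequence is only known to be a subsequence of stage
      \<open>to_nat i\<close> from index \<open>Suc (to_nat i)\<close> on.\<close>
    have "P (to_nat i) (diagseq \<circ> (+) (Suc (to_nat i)))"
    proof (rule diagseq_holds)
      fix r s :: "nat \<Rightarrow> nat" and l assume "strict_mono r" "P l s"
      then show "P l (s \<circ> r)"
        using convergent_subseq_convergent[of "\<lambda>n. X (from_nat l) (s n)" r] by (simp add: P_def o_def)
    qed
    then have "convergent (\<lambda>n. X i (diagseq (Suc (to_nat i) + n)))"
      by (simp add: P_def o_def)
    then show ?thesis
      using convergent_ignore_initial_segment[of "\<lambda>n. X i (diagseq n)" "Suc (to_nat i)"] by (simp add: add.commute)
  qed
  then show ?thesis using subseq_diagseq by blast
qed

context prob_space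
begin

lemma cut_le_L1:
  assumes h: "integrable (M \<Otimes>\<^sub>M M) h" "(\<integral>u. \<bar>h u\<bar> \<partial>(M \<Otimes>\<^sub>M M)) \<le> \<epsilon>"
  shows "cut_le M h \<epsilon>"
  unfolding cut_le_def
proof (intro ballI impI)
  interpret N: prob_space "M \<Otimes>\<^sub>M M" by (rule prob_space_pair_self)
  fix f g :: "'a \<Rightarrow> real"
  assume [measurable]: "f \<in> borel_measurable M" "g \<in> borel_measurable M"
    and 1: "\<forall>x. \<bar>f x\<bar> \<le> 1" "\<forall>x. \<bar>g x\<bar> \<le> 1"
  let ?p = "\<lambda>u. f (fst u) * g (snd u)"
  have p: "\<bar>?p u\<bar> \<le> 1" for u using 1 by (auto simp: abs_mult intro!: mult_le_one)
  have i: "integrable (M \<Otimes>\<^sub>M M) (\<lambda>u. h u * ?p u)"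
    by (rule N.integrable_times_bounded[OF h(1), of _ 1]) (use p in auto)
  have "\<bar>\<integral>u. h u * ?p u \<partial>(M \<Otimes>\<^sub>M M)\<bar> \<le> (\<integral>u. \<bar>h u * ?p u\<bar> \<partial>(M \<Otimes>\<^sub>M M))"
    using integral_norm_bound[of "M \<Otimes>\<^sub>M M" "\<lambda>u. h u * ?p u"] by simp
  also have "\<dots> \<le> (\<integral>u. \<bar>h u\<bar> \<partial>(M \<Otimes>\<^sub>M M))"
  proof (rule integral_mono)
    show "\<bar>h u * ?p u\<bar> \<le> \<bar>h u\<bar>" for u
      using mult_left_mono[OF p[of u], of "\<bar>h u\<bar>"] by (simp only: abs_mult mult_1_right abs_ge_zero)
  qed (use integrable_abs[OF i] h(1) in auto)
  finally show "\<bar>\<integral>u. h u * ?p u \<partial>(M \<Otimes>\<^sub>M M)\<bar> \<le> \<epsilon>" using h(2) by linarith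
qed

lemma cell_pair_class:
  assumes [measurable]: "c \<in> measurable M (count_space UNIV)"
  shows "cell (M \<Otimes>\<^sub>M M) (pair_class c) p = cell M c (fst p) * cell M c (snd p)"
proof -
  let ?A = "\<lambda>j. {x \<in> space M. c x = j}"
  have "{u \<in> space (M \<Otimes>\<^sub>M M). pair_class c u = p} = ?A (fst p) \<times> ?A (snd p)"
    by (auto simp: space_pair_measure pair_class_def)
  moreover have "emeasure (M \<Otimes>\<^sub>M M) (?A (fst p) \<times> ?A (snd p)) = emeasure M (?A (fst p)) * emeasure M (?A (snd p))"
    by (rule emeasure_pair_measure_Times) measurable
  ultimately show ?thesis
    unfolding cell_def measure_def by (simp add: enn2real_mult)
qed

text \<open>The density of a step kernel is a polynomial in cell measures and block values. This is
  the bridge between different probability spaces: the densities on both are evaluated by the same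
  finite sum.\<close>

lemma graph_density_step:
  fixes p :: "nat set \<Rightarrow> nat \<times> nat \<Rightarrow> real"
  assumes G: "simple_graph k E" and c[measurable]: "c \<in> measurable M (count_space UNIV)"
    and cm: "\<And>x. c x < m"
  shows "graph_density M k E (\<lambda>e u. p e (pair_class c u))
    = (\<Sum>J\<in>{1..k} \<rightarrow>\<^sub>E {..<m}. (\<Prod>v\<in>{1..k}. cell M c (J v)) * (\<Prod>e\<in>E. p e (J (Min e), J (Max e))))"
proof -
  interpret P: product_prob_space "\<lambda>_::nat. M" "{1..k}" by unfold_locales
  let ?V = "{1..k}"
  let ?S = "?V \<rightarrow>\<^sub>E {..<m}"
  let ?P = "\<lambda>J. (\<Prod>e\<in>E. p e (J (Min e), J (Max e)))"
  have fin: "finite ?S" by (intro finite_PiE) auto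
  have i: "integrable M (\<lambda>x. of_bool (c x = j) :: real)" for j
    by (rule integrable_finite_classifier(1)[OF c, of "{..<m}" "\<lambda>i. of_bool (i = j)"]) (use cm in auto)
  have cell: "(\<integral>x. of_bool (c x = j) \<partial>M) = cell M c j" for j
    using cell_int_1[OF c, of "{..<m}" j] cm by (simp add: cell_int_def)
  \<comment> \<open>Only the assignment \<open>J\<close> recording the actual cells of all vertices
    contributes.\<close>
  have "(\<Prod>e\<in>E. p e (pair_class c (x (Min e), x (Max e))))
      = (\<Sum>J\<in>?S. (\<Prod>v\<in>?V. of_bool (c (x v) = J v)) * ?P J)" for x
  proof -
    let ?J = "restrict (\<lambda>v. c (x v)) ?V"
    have JS: "?J \<in> ?S" using cm by auto
    have "(\<Sum>J\<in>?S. (\<Prod>v\<in>?V. of_bool (c (x v) = J v)) * ?P J)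
        = (\<Sum>J\<in>{?J}. (\<Prod>v\<in>?V. of_bool (c (x v) = J v)) * ?P J)"
    proof (rule sum.mono_neutral_right[OF fin])
      show "\<forall>J\<in>?S - {?J}. (\<Prod>v\<in>?V. of_bool (c (x v) = J v)) * ?P J = 0"
      proof
        fix J assume J: "J \<in> ?S - {?J}"
        have "\<exists>v\<in>?V. c (x v) \<noteq> J v"
        proof (rule ccontr)
          assume "\<not> (\<exists>v\<in>?V. c (x v) \<noteq> J v)"
          then have "J = ?J" by (intro PiE_ext[of J ?V "\<lambda>_. {..<m}" ?J]) (use J JS in auto)
          then show False using J by blast
        qed
        then obtain v where "v \<in> ?V" "c (x v) \<noteq> J v" by blast
        then have "(\<Prod>v\<in>?V. of_bool (c (x v) = J v) :: real) = 0"
          by (intro prod_zero) auto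
        then show "(\<Prod>v\<in>?V. of_bool (c (x v) = J v)) * ?P J = 0" by (simp only: mult_zero_left)
      qed
    qed (use JS in auto)
    also have "\<dots> = ?P ?J" by simp
    also have "\<dots> = (\<Prod>e\<in>E. p e (pair_class c (x (Min e), x (Max e))))"
      using simple_graph_edge(1,2)[OF G] by (intro prod.cong refl) (simp add: pair_class_def)
    finally show ?thesis by simp
  qed
  then have "graph_density M k E (\<lambda>e u. p e (pair_class c u))
      = (\<integral>x. (\<Sum>J\<in>?S. (\<Prod>v\<in>?V. of_bool (c (x v) = J v)) * ?P J) \<partial>(\<Pi>\<^sub>M i\<in>?V. M))"
    unfolding graph_density_def by (simp only:)
  also have "\<dots> = (\<Sum>J\<in>?S. (\<integral>x. (\<Prod>v\<in>?V. of_bool (c (x v) = J v)) * ?P J \<partial>(\<Pi>\<^sub>M i\<in>?V. M)))"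
    by (intro Bochner_Integration.integral_sum integrable_mult_left P.product_integrable_prod i finite_atLeastAtMost)
  also have "\<dots> = (\<Sum>J\<in>?S. (\<integral>x. (\<Prod>v\<in>?V. of_bool (c (x v) = J v)) \<partial>(\<Pi>\<^sub>M i\<in>?V. M)) * ?P J)"
    by (simp only: integral_mult_left_zero)
  also have "\<dots> = (\<Sum>J\<in>?S. (\<Prod>v\<in>?V. cell M c (J v)) * ?P J)"
  proof (rule sum.cong[OF refl])
    fix J
    have "(\<integral>x. (\<Prod>v\<in>?V. of_bool (c (x v) = J v)) \<partial>(\<Pi>\<^sub>M i\<in>?V. M))
        = (\<Prod>v\<in>?V. (\<integral>x. of_bool (c x = J v) \<partial>M) :: real)"
      by (rule P.product_integral_prod) (simp, rule i)
    then show "(\<integral>x. (\<Prod>v\<in>?V. of_bool (c (x v) = J v)) \<partial>(\<Pi>\<^sub>M i\<in>?V. M)) * ?P J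
        = (\<Prod>v\<in>?V. cell M c (J v)) * ?P J" by (simp only: cell)
  qed
  finally show ?thesis .
qed

lemma cell_int_refine:
  fixes d :: "'a \<Rightarrow> 'i" and e :: "'a \<Rightarrow> 'k" and \<phi> :: "'i \<Rightarrow> 'k"
  assumes d: "d \<in> measurable M (count_space UNIV)" "finite S" "\<And>x. x \<in> space M \<Longrightarrow> d x \<in> S"
    and h: "integrable M h" and \<phi>: "\<And>x. x \<in> space M \<Longrightarrow> e x = \<phi> (d x)"
  shows "cell_int M e h p = (\<Sum>j\<in>{j\<in>S. \<phi> j = p}. cell_int M d h j)"
proof -
  have "cell_int M e h p = (\<integral>x. h x * of_bool (\<phi> (d x) = p) \<partial>M)"
    unfolding cell_int_def by (rule Bochner_Integration.integral_cong) (auto simp: \<phi>)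
  also have "\<dots> = (\<Sum>j\<in>S. of_bool (\<phi> j = p) * cell_int M d h j)"
    using integral_times_classifier[OF d h, of "\<lambda>j. of_bool (\<phi> j = p)"] by simp
  also have "\<dots> = (\<Sum>j\<in>{j\<in>S. \<phi> j = p}. cell_int M d h j)"
    using d(2) by (intro sum.mono_neutral_cong_right) auto
  finally show ?thesis .
qed

lemma cell_refine:
  fixes d :: "'a \<Rightarrow> 'i" and e :: "'a \<Rightarrow> 'k" and \<phi> :: "'i \<Rightarrow> 'k"
  assumes d: "d \<in> measurable M (count_space UNIV)" "finite S" "\<And>x. x \<in> space M \<Longrightarrow> d x \<in> S"
    and \<phi>: "\<And>x. x \<in> space M \<Longrightarrow> e x = \<phi> (d x)"
  shows "cell M e p = (\<Sum>j\<in>{j\<in>S. \<phi> j = p}. cell M d j)"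
proof -
  have "cell_int M e (\<lambda>_. 1) p = cell M e p"
  proof (rule cell_int_1[of _ "\<phi> ` S"])
    show "e \<in> measurable M (count_space UNIV)"
      by (subst measurable_cong[where g = "\<lambda>x. \<phi> (d x)"]) (auto simp: \<phi> intro: measurable_compose[OF d(1)])
  qed (use d \<phi> in auto)
  moreover have "cell_int M d (\<lambda>_. 1) j = cell M d j" for j by (rule cell_int_1[OF d])
  ultimately show ?thesis using cell_int_refine[OF d, of "\<lambda>_. 1" e \<phi> p] \<phi> by simp
qed

text \<open>Along a fast subsequence the increments are summable in \<open>L\<^sup>1\<close>, hence almost everywhere; one
  subsequence is chosen for all indices \<open>i\<close> at once.\<close>

lemma L1_Cauchy_imp_AE_convergent_subsequence:
  fixes X :: "nat \<Rightarrow> nat \<Rightarrow> 'a \<Rightarrow> real"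
  assumes X: "\<And>i k. integrable M (X i k)"
    and Cauchy: "\<And>i \<epsilon>. \<epsilon> > 0 \<Longrightarrow> \<exists>k0. \<forall>k\<ge>k0. \<forall>k'\<ge>k. (\<integral>x. \<bar>X i k' x - X i k x\<bar> \<partial>M) \<le> \<epsilon>"
  shows "\<exists>\<kappa>. strict_mono \<kappa> \<and> (\<forall>i. AE x in M. convergent (\<lambda>l. X i (\<kappa> l) x))"
proof -
  have "\<exists>k0. \<forall>k\<ge>k0. \<forall>k'\<ge>k. (\<integral>x. \<bar>X i k' x - X i k x\<bar> \<partial>M) \<le> (1/2) ^ l" for i l
    by (rule Cauchy) simp
  then obtain K where K: "\<And>i l k k'. k \<ge> K i l \<Longrightarrow> k' \<ge> k \<Longrightarrow> (\<integral>x. \<bar>X i k' x - X i k x\<bar> \<partial>M) \<le> (1/2) ^ l"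
    by metis
  \<comment> \<open>Summing over all \<open>l' \<le> l\<close> and \<open>i \<le> l\<close>
    dominates every \<open>K i l\<close> with \<open>i \<le> l\<close>; the summand \<open>l\<close>
    makes the sequence strictly increasing.\<close>
  define \<kappa> where "\<kappa> = (\<lambda>l. l + (\<Sum>l'\<le>l. \<Sum>i\<le>l. K i l'))"
  have \<kappa>K: "K i l \<le> \<kappa> l" if "i \<le> l" for i l
  proof -
    have "K i l \<le> (\<Sum>i\<le>l. K i l)" using that by (intro member_le_sum) auto
    also have "\<dots> \<le> (\<Sum>l'\<le>l. \<Sum>i\<le>l. K i l')" by (intro member_le_sum) auto
    finally show ?thesis by (simp add: \<kappa>_def)
  qed
  have mono: "strict_mono \<kappa>"
  proof (rule strict_mono_Suc_iff[THEN iffD2], rule allI)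
    fix l
    have "(\<Sum>l'\<le>l. \<Sum>i\<le>l. K i l') \<le> (\<Sum>l'\<le>Suc l. \<Sum>i\<le>Suc l. K i l')"
    proof -
      have "(\<Sum>l'\<le>l. \<Sum>i\<le>l. K i l') \<le> (\<Sum>l'\<le>l. \<Sum>i\<le>Suc l. K i l')" by (intro sum_mono) simp
      also have "\<dots> \<le> (\<Sum>l'\<le>Suc l. \<Sum>i\<le>Suc l. K i l')" by simp
      finally show ?thesis .
    qed
    then show "\<kappa> l < \<kappa> (Suc l)" unfolding \<kappa>_def by linarith
  qed
  have "AE x in M. convergent (\<lambda>l. X i (\<kappa> l) x)" for i
  proof -
    note [measurable] = borel_measurable_integrable[OF X]
    \<comment> \<open>The shift by \<open>i\<close> skips the stages at which \<kappa> does not yet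
      take the index \<open>i\<close> into account.\<close>
    define Y where "Y = (\<lambda>l x. X i (\<kappa> (Suc (l + i))) x - X i (\<kappa> (l + i)) x)"
    have Yi: "integrable M (Y l)" for l unfolding Y_def using X by auto
    have Ym[measurable]: "Y l \<in> borel_measurable M" for l using Yi by auto
    have Y: "(\<integral>x. norm (Y l x) \<partial>M) \<le> (1/2) ^ l" for l
    proof -
      have "(\<integral>x. norm (Y l x) \<partial>M) \<le> (1/2) ^ (l + i)"
        unfolding Y_def real_norm_def
        by (rule K) (use \<kappa>K[of i "l + i"] mono in \<open>auto intro: strict_mono_leD\<close>)
      also have "\<dots> \<le> (1/2) ^ l" by (intro power_decreasing) auto
      finally show ?thesis .
    qed
    have "(\<integral>\<^sup>+x. (\<Sum>l. ennreal (norm (Y l x))) \<partial>M) = (\<Sum>l. \<integral>\<^sup>+x. ennreal (norm (Y l x)) \<partial>M)"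
      by (rule nn_integral_suminf) measurable
    also have "\<dots> \<le> (\<Sum>l. ennreal ((1/2) ^ l))"
      using Yi Y by (intro suminf_le) (auto simp: nn_integral_eq_integral ennreal_leI)
    also have "\<dots> = ennreal 2" 
      by (subst suminf_ennreal2) (auto simp: suminf_geometric summable_geometric)
    finally have "(\<integral>\<^sup>+x. (\<Sum>l. ennreal (norm (Y l x))) \<partial>M) \<noteq> \<infinity>"
      by (auto simp: top_unique)
    then have "AE x in M. (\<Sum>l. ennreal (norm (Y l x))) \<noteq> \<infinity>"
      by (intro nn_integral_noteq_infinite) auto
    then show ?thesis
    proof eventually_elim
      case (elim x)
      then have "summable (\<lambda>l. norm (Y l x))"
        by (intro summable_suminf_not_top) auto
      then have "summable (\<lambda>l. Y l x)" by (rule summable_norm_cancel)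
      then have "convergent (\<lambda>n. \<Sum>l<n. Y l x)" by (simp add: summable_iff_convergent)
      moreover have "(\<Sum>l<n. Y l x) = X i (\<kappa> (n + i)) x - X i (\<kappa> i) x" for n
        by (induction n) (auto simp: Y_def)
      ultimately have "convergent (\<lambda>n. X i (\<kappa> (n + i)) x - X i (\<kappa> i) x)" by simp
      then have "convergent (\<lambda>n. (X i (\<kappa> (n + i)) x - X i (\<kappa> i) x) + X i (\<kappa> i) x)"
        by (rule convergent_add) (rule convergent_const)
      then show ?case
        using convergent_ignore_initial_segment[of "\<lambda>l. X i (\<kappa> l) x" i] by simp
    qed
  qed
  then show ?thesis using mono by blast
qed

end

section \<open>Limits of scalar kernels\<close>

abbreviation lborel_unit :: "real measure" where
  "lborel_unit \<equiv> restrict_space lborel {0..1}"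

abbreviation lborel_square :: "(real \<times> real) measure" where
  "lborel_square \<equiv> lborel_unit \<Otimes>\<^sub>M lborel_unit"

lemma prob_space_lborel_unit: "prob_space lborel_unit"
  by (rule prob_space_restrict_space) auto

text \<open>Intervals of lengths \<open>a k j\<close> are laid side by side from left to right. The
  cells refining cell \<open>j\<close> have consecutive codes, so their intervals fill exactly the
  interval of \<open>j\<close> and the partitions are nested.\<close>

lemma limit_partition:
  fixes a :: "nat \<Rightarrow> nat \<Rightarrow> real"
  assumes a0: "\<And>k j. a k j \<ge> 0" and a1: "\<And>k. (\<Sum>j<num_cells k. a k j) = 1"
    and ref: "\<And>k j. j < num_cells k \<Longrightarrow>
      a k j = (\<Sum>q\<in>{q\<in>{..<num_cells (Suc k)}. q div refinement_factor k = j}. a (Suc k) q)"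
  shows "\<exists>\<gamma>. \<forall>k. \<gamma> k \<in> measurable lborel_unit (count_space UNIV) \<and> (\<forall>x. \<gamma> k x < num_cells k) \<and>
     (\<forall>x. \<gamma> k x = \<gamma> (Suc k) x div refinement_factor k) \<and>
     (\<forall>j<num_cells k. cell lborel_unit (\<gamma> k) j = a k j)"
proof -
  define L where "L = (\<lambda>k j. \<Sum>j'<j. a k j')"
  \<comment> \<open>The class of \<open>x\<close> is the number of inner breakpoints up to
    \<open>x\<close>. Coinciding breakpoints are counted together, which takes care of cells of
    measure 0; the final breakpoint 1 is left out, so that the class stays below
    \<open>num_cells k\<close> for every real \<open>x\<close>.\<close>
  define \<gamma> where "\<gamma> = (\<lambda>k x. card {j\<in>{1..<num_cells k}. L k j \<le> x})"
  have L0: "L k 0 = 0" "L k (num_cells k) = 1" "L k (Suc j) = L k j + a k j" for k j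
    using a1 by (simp_all add: L_def)
  have Lmono: "L k i \<le> L k j" if "i \<le> j" for k i j
    unfolding L_def using that a0 by (intro sum_mono2) auto
  have Lref: "L k j = L (Suc k) (j * refinement_factor k)" if "j \<le> num_cells k" for k j
  proof -
    let ?n = "num_cells (Suc k)" and ?R = "refinement_factor k"
    have "L k j = (\<Sum>j'<j. \<Sum>q\<in>{q\<in>{q\<in>{..<?n}. q div ?R < j}. q div ?R = j'}. a (Suc k) q)"
      unfolding L_def
    proof (rule sum.cong[OF refl])
      fix j' assume j': "j' \<in> {..<j}"
      have "{q\<in>{q\<in>{..<?n}. q div ?R < j}. q div ?R = j'} = {q\<in>{..<?n}. q div ?R = j'}"
        using j' by auto
      then show "a k j' = (\<Sum>q\<in>{q\<in>{q\<in>{..<?n}. q div ?R < j}. q div ?R = j'}. a (Suc k) q)"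
        using ref[of j' k] j' that by simp
    qed
    also have "\<dots> = (\<Sum>q\<in>{q\<in>{..<?n}. q div ?R < j}. a (Suc k) q)"
      by (rule sum.group) auto
    also have "{q\<in>{..<?n}. q div ?R < j} = {..<j * ?R}"
      using less_le_trans[OF _ mult_le_mono1[OF that, of ?R]]
      by (auto simp: less_mult_imp_div_less div_less_iff_less_mult)
    finally show ?thesis by (simp add: L_def)
  qed
  have le_iff: "j \<le> \<gamma> k x \<longleftrightarrow> L k j \<le> x" if "1 \<le> j" "j < num_cells k" for j k x
  proof
    assume "L k j \<le> x"
    then have "{1..j} \<subseteq> {j\<in>{1..<num_cells k}. L k j \<le> x}"
      using that Lmono[of _ j k] by (auto intro: order_trans[of _ "L k j"])
    from card_mono[OF _ this] show "j \<le> \<gamma> k x" by (simp add: \<gamma>_def)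
  next
    assume j: "j \<le> \<gamma> k x"
    show "L k j \<le> x"
    proof (rule ccontr)
      assume "\<not> L k j \<le> x"
      then have "{j\<in>{1..<num_cells k}. L k j \<le> x} \<subseteq> {1..<j}"
        using Lmono[of j _ k] by (fastforce simp: not_le)
      from card_mono[OF _ this] have "\<gamma> k x \<le> j - 1" by (simp add: \<gamma>_def)
      with j that show False by linarith
    qed
  qed
  have less: "\<gamma> k x < num_cells k" for k x
  proof -
    have "\<gamma> k x \<le> card {1..<num_cells k}" unfolding \<gamma>_def by (intro card_mono) auto
    then show ?thesis using num_cells_pos[of k] by (simp only: card_atLeastLessThan)
  qed
  have nested: "\<gamma> k x = \<gamma> (Suc k) x div refinement_factor k" for k x
  proof -
    let ?R = "refinement_factor k" and ?q = "\<gamma> (Suc k) x div refinement_factor k"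
    have q: "?q < num_cells k" using less[of "Suc k" x] by (simp add: less_mult_imp_div_less)
    have "j \<le> \<gamma> k x \<longleftrightarrow> j \<le> ?q" if j: "1 \<le> j" "j < num_cells k" for j
    proof -
      have "j * ?R < num_cells (Suc k)" "1 \<le> j * ?R" using j refinement_factor_pos[of k] by (auto simp: Suc_le_eq simp del: refinement_factor_pos)
      then show ?thesis using le_iff[OF j] le_iff[of "j * ?R" "Suc k" x] Lref[of j k] j
        by (simp add: less_eq_div_iff_mult_less_eq)
    qed
    from this[of "\<gamma> k x"] this[of ?q] less[of k x] q show ?thesis
      by (metis One_nat_def Suc_leI le_antisym le_refl le_zero_eq not_gr_zero)
  qed
  have level: "{x. \<gamma> k x = j} = {x. (j = 0 \<or> L k j \<le> x) \<and> (j + 1 < num_cells k \<longrightarrow> x < L k (j + 1))}"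
    if j: "j < num_cells k" for k j
  proof -
    have "\<gamma> k x = j \<longleftrightarrow> (j = 0 \<or> L k j \<le> x) \<and> (j + 1 < num_cells k \<longrightarrow> x < L k (j + 1))" for x
    proof -
      have 1: "j \<le> \<gamma> k x \<longleftrightarrow> j = 0 \<or> L k j \<le> x" using le_iff[of j k x] j by (cases "j = 0") auto
      have 2: "\<gamma> k x \<le> j \<longleftrightarrow> (j + 1 < num_cells k \<longrightarrow> x < L k (j + 1))"
      proof (cases "j + 1 < num_cells k")
        case True
        then show ?thesis using le_iff[of "j + 1" k x] by auto
      next
        case False
        then show ?thesis using less[of k x] by auto
      qed
      show ?thesis using 1 2 by auto
    qed
    then show ?thesis by (rule Collect_cong)
  qed
  have borel: "{x. \<gamma> k x = j} \<in> sets borel" for k j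
  proof (cases "j < num_cells k")
    case True
    show ?thesis unfolding level[OF True] by measurable
  next
    case False
    then have "{x. \<gamma> k x = j} = {}" using less[of k] by auto
    then show ?thesis by simp
  qed
  have "cell lborel_unit (\<gamma> k) j = a k j" if j: "j < num_cells k" for k j
  proof -
    have "cell lborel_unit (\<gamma> k) j = measure lborel ({x. \<gamma> k x = j} \<inter> {0..1})"
      unfolding cell_def using borel[of k j]
      by (subst measure_restrict_space) (auto simp: space_restrict_space intro!: arg_cong[where f = "measure lborel"])
    also have "\<dots> = a k j"
    proof (cases "j + 1 < num_cells k")
      case True
      have "L k (j + 1) \<le> 1" using Lmono[of "j + 1" "num_cells k" k] True L0(2)[of k] by simp
      moreover have "0 \<le> L k j" using Lmono[of 0 j k] L0(1) by simp
      ultimately have "{x. \<gamma> k x = j} \<inter> {0..1} = {L k j..<L k (j + 1)}"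
        using True L0(1)[of k] unfolding level[OF j] by auto
      then show ?thesis using L0(3)[of k j] a0[of k j] by simp
    next
      case False
      with j have n: "num_cells k = Suc j" by simp
      have "0 \<le> L k j" using Lmono[of 0 j k] L0(1) by simp
      then have "{x. \<gamma> k x = j} \<inter> {0..1} = {L k j..1}"
        using False L0(1)[of k] unfolding level[OF j] by auto
      moreover have "1 = L k j + a k j" using L0(2)[of k] L0(3)[of k j] by (simp add: n)
      ultimately show ?thesis using a0[of k j] by simp
    qed
    finally show ?thesis .
  qed
  moreover have "\<gamma> k \<in> measurable lborel_unit (count_space UNIV)" for k
  proof -
    have "\<gamma> k \<in> measurable borel (count_space UNIV)"
      by (rule measurable_count_space_eq_countable[THEN iffD2])
         (use borel in \<open>auto simp: vimage_def\<close>)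
    then show ?thesis by (intro measurable_restrict_space1) simp
  qed
  ultimately show ?thesis using less nested by blast
qed

context prob_space
begin

text \<open>\<open>u\<close> is a martingale for the nested partitions, so the squared
  \<open>L2\<close> distance between two of its members is an increment of the sequence of their
  second moments. These increase and are bounded by \<open>C 2\<close>, hence form a Cauchy
  sequence.\<close>

lemma martingale_L1_Cauchy:
  fixes d :: "nat \<Rightarrow> 'a \<Rightarrow> 'i" and S :: "nat \<Rightarrow> 'i set" and z :: "nat \<Rightarrow> 'i \<Rightarrow> real"
  assumes d: "\<And>k. d k \<in> measurable M (count_space UNIV)" "\<And>k. finite (S k)" "\<And>k x. x \<in> space M \<Longrightarrow> d k x \<in> S k"
    and \<phi>: "\<And>k x. d k x = \<phi> k (d (Suc k) x)"
    and z: "\<And>k p. p \<in> S k \<Longrightarrow> z k p = (\<Sum>q\<in>{q\<in>S (Suc k). \<phi> k q = p}. z (Suc k) q)"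
    and z0: "\<And>k p. p \<in> S k \<Longrightarrow> cell M (d k) p = 0 \<Longrightarrow> z k p = 0"
  defines "u \<equiv> \<lambda>k x. z k (d k x) / cell M (d k) (d k x)"
  assumes mom: "\<And>k. moments_le M (u k) C" and "\<epsilon> > 0"
  shows "\<exists>k0. \<forall>k\<ge>k0. \<forall>k'\<ge>k. (\<integral>x. \<bar>u k' x - u k x\<bar> \<partial>M) \<le> \<epsilon>"
proof -
  \<comment> \<open>The martingale property, by descent from \<open>k'\<close> to \<open>k\<close>.
    At \<open>k'\<close> itself, dividing and multiplying by the cell measure is harmless because of
    \<open>z0\<close>.\<close>
  have ci: "cell_int M (d k) (u k') p = z k p" if "k \<le> k'" "p \<in> S k" for k k' p
    using that
  proof (induction k arbitrary: p rule: inc_induct)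
    case base
    have "cell_int M (d k') (u k') p
        = (\<Sum>j\<in>S k'. z k' j / cell M (d k') j * of_bool (j = p) * cell M (d k') j)"
      unfolding cell_int_def u_def
      by (rule integral_classifier[OF d, of "\<lambda>j. z k' j / cell M (d k') j * of_bool (j = p)"])
    also have "\<dots> = (\<Sum>j\<in>{p}. z k' j / cell M (d k') j * of_bool (j = p) * cell M (d k') j)"
      by (rule sum.mono_neutral_right) (use d base in auto)
    also have "\<dots> = z k' p" using z0[OF base] by (cases "cell M (d k') p = 0") auto
    finally show ?case .
  next
    case (step k)
    have "cell_int M (d k) (u k') p = (\<Sum>q\<in>{q\<in>S (Suc k). \<phi> k q = p}. cell_int M (d (Suc k)) (u k') q)"
      by (rule cell_int_refine[OF d moments_leD(4)[OF mom], of "d k" "\<phi> k"]) (assumption, rule \<phi>)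
    also have "\<dots> = z k p" using step.IH by (subst z[OF step.prems]) (auto intro!: sum.cong)
    finally show ?case .
  qed
  define En where "En = (\<lambda>k. \<integral>x. (u k x)\<^sup>2 \<partial>M)"
  have factor: "\<exists>\<Phi>. \<forall>x. d k x = \<Phi> (d k' x)" if "k \<le> k'" for k k'
    using that
  proof (induction k rule: inc_induct)
    case base
    show ?case by (rule exI[of _ "\<lambda>x. x"]) simp
  next
    case (step k)
    then obtain \<Phi> where "\<forall>x. d (Suc k) x = \<Phi> (d k' x)" by blast
    then show ?case using \<phi>[of k] by (intro exI[of _ "\<lambda>j. \<phi> k (\<Phi> j)"]) simp
  qed
  have diff: "(\<integral>x. (u k' x - u k x)\<^sup>2 \<partial>M) = En k' - En k" if kk: "k \<le> k'" for k k'
  proof -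
    obtain \<Phi> where \<Phi>: "\<And>x. d k x = \<Phi> (d k' x)" using factor[OF kk] by blast
    have cm: "cell_mean M (d l) (u k') (d l x) = u l x" if "x \<in> space M" "l \<le> k'" for l x
      using ci[OF that(2) d(3)[OF that(1)]] by (simp add: cell_mean_def u_def)
    have "(\<integral>x. (u k' x - u k x)\<^sup>2 \<partial>M)
        = (\<integral>x. (cell_mean M (d k') (u k') (d k' x) - cell_mean M (d k) (u k') (d k x))\<^sup>2 \<partial>M)"
      by (rule Bochner_Integration.integral_cong) (use cm kk in auto)
    also have "\<dots> = energy M (d k') (u k') - energy M (d k) (u k')"
      by (rule energy_refine[OF d mom, where e = "d k" and \<phi> = \<Phi>]) (assumption, rule \<Phi>)
    also have "energy M (d l) (u k') = En l" if "l \<le> k'" for l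
      unfolding energy_def En_def by (rule Bochner_Integration.integral_cong) (use cm that in auto)
    then have "energy M (d k') (u k') - energy M (d k) (u k') = En k' - En k" using kk by simp
    finally show ?thesis .
  qed
  have "incseq En"
  proof (rule monoI)
    fix k k' :: nat assume "k \<le> k'"
    have "0 \<le> (\<integral>x. (u k' x - u k x)\<^sup>2 \<partial>M)" by (rule Bochner_Integration.integral_nonneg) simp
    then show "En k \<le> En k'" using diff[OF \<open>k \<le> k'\<close>] by simp
  qed
  moreover have "En k \<le> C 2" for k using moments_leD(3)[OF mom, of k 2] by (simp add: En_def)
  ultimately have "Cauchy En"
    by (meson LIMSEQ_imp_Cauchy incseq_convergent)
  then obtain k0 where k0: "\<And>k k'. k \<ge> k0 \<Longrightarrow> k' \<ge> k0 \<Longrightarrow> \<bar>En k - En k'\<bar> < \<epsilon>\<^sup>2"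
    using \<open>\<epsilon> > 0\<close> unfolding Cauchy_def dist_real_def by (metis zero_less_power)
  show ?thesis
  proof (intro exI[of _ k0] allI impI)
    fix k k' :: nat assume k: "k0 \<le> k" "k \<le> k'"
    note m = moments_leD[OF moments_le_diff[OF mom[of k'] mom[of k]]]
    have "(\<integral>x. \<bar>u k' x - u k x\<bar> \<partial>M) \<le> sqrt (\<integral>x. (u k' x - u k x)\<^sup>2 \<partial>M)"
      by (rule abs_integral_le_sqrt(2)) (use m(1) m(2)[of 2] in auto)
    also have "\<dots> \<le> sqrt (\<epsilon>\<^sup>2)"
      unfolding diff[OF k(2)] using k0[of k' k] k by (intro real_sqrt_le_mono) linarith
    finally show "(\<integral>x. \<bar>u k' x - u k x\<bar> \<partial>M) \<le> \<epsilon>" using \<open>\<epsilon> > 0\<close> by simp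
  qed
qed

text \<open>Fatou's lemma, stated for the extended integral because integrability of the limit is a
  conclusion drawn from it.\<close>

lemma nn_integral_power_AE_limit:
  fixes X :: "nat \<Rightarrow> 'a \<Rightarrow> real"
  assumes [measurable]: "\<And>l. X l \<in> borel_measurable M"
    and lim: "AE x in M. (\<lambda>l. X l x) \<longlonglongrightarrow> u x"
    and le: "\<And>l. l \<ge> l0 \<Longrightarrow> (\<integral>\<^sup>+x. ennreal (\<bar>X l x\<bar> ^ q) \<partial>M) \<le> c"
  shows "(\<integral>\<^sup>+x. ennreal (\<bar>u x\<bar> ^ q) \<partial>M) \<le> c"
proof -
  have "(\<integral>\<^sup>+x. ennreal (\<bar>u x\<bar> ^ q) \<partial>M) = (\<integral>\<^sup>+x. liminf (\<lambda>l. ennreal (\<bar>X l x\<bar> ^ q)) \<partial>M)"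
  proof (rule nn_integral_cong_AE)
    show "AE x in M. ennreal (\<bar>u x\<bar> ^ q) = liminf (\<lambda>l. ennreal (\<bar>X l x\<bar> ^ q))"
      using lim
    proof eventually_elim
      case (elim x)
      then have "(\<lambda>l. ennreal (\<bar>X l x\<bar> ^ q)) \<longlonglongrightarrow> ennreal (\<bar>u x\<bar> ^ q)"
        by (intro tendsto_ennrealI tendsto_power tendsto_rabs)
      then show ?case by (intro lim_imp_Liminf[symmetric]) auto
    qed
  qed
  also have "\<dots> \<le> liminf (\<lambda>l. \<integral>\<^sup>+x. ennreal (\<bar>X l x\<bar> ^ q) \<partial>M)"
    by (rule nn_integral_liminf) measurable
  also have "\<dots> \<le> liminf (\<lambda>l. c)"
    by (intro Liminf_mono eventually_sequentiallyI[of l0]) (rule le)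
  also have "\<dots> = c" by (simp add: Liminf_const)
  finally show ?thesis .
qed

lemma AE_limit_moments:
  fixes X :: "nat \<Rightarrow> 'a \<Rightarrow> real"
  assumes mom: "\<And>l. moments_le M (X l) C" and [measurable]: "u \<in> borel_measurable M"
    and lim: "AE x in M. (\<lambda>l. X l x) \<longlonglongrightarrow> u x"
  shows "moments_le M u C"
  unfolding moments_le_def
proof (intro conjI allI assms(2))
  fix q
  note m = moments_leD[OF mom]
  have le: "(\<integral>\<^sup>+x. ennreal (\<bar>u x\<bar> ^ q) \<partial>M) \<le> ennreal (C q)"
    by (rule nn_integral_power_AE_limit[OF m(1) lim])
       (use m(2,3)[of _ q] in \<open>auto simp: nn_integral_eq_integral intro!: ennreal_leI\<close>)
  show i: "integrable M (\<lambda>x. \<bar>u x\<bar> ^ q)"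
    by (rule integrableI_nonneg) (use le in \<open>auto intro: le_less_trans\<close>)
  show "(\<integral>x. \<bar>u x\<bar> ^ q \<partial>M) \<le> C q"
    using le m(5)[of q] by (subst (asm) nn_integral_eq_integral[OF i]) (auto simp: ennreal_le_iff)
qed

lemma AE_limit_L1:
  fixes X :: "nat \<Rightarrow> 'a \<Rightarrow> real"
  assumes X: "\<And>l. integrable M (X l)" and u: "integrable M u"
    and lim: "AE x in M. (\<lambda>l. X l x) \<longlonglongrightarrow> u x"
    and h: "integrable M h" "\<And>l. l \<ge> l0 \<Longrightarrow> (\<integral>x. \<bar>X l x - h x\<bar> \<partial>M) \<le> \<epsilon>" and "\<epsilon> \<ge> 0"
  shows "(\<integral>x. \<bar>u x - h x\<bar> \<partial>M) \<le> \<epsilon>"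
proof -
  have "(\<integral>\<^sup>+x. ennreal (\<bar>u x - h x\<bar> ^ 1) \<partial>M) \<le> ennreal \<epsilon>"
  proof (rule nn_integral_power_AE_limit[where X = "\<lambda>l x. X l x - h x"])
    show "(\<lambda>x. X l x - h x) \<in> borel_measurable M" for l using X h(1) by auto
    show "AE x in M. (\<lambda>l. X l x - h x) \<longlonglongrightarrow> u x - h x"
      using lim by eventually_elim (intro tendsto_intros)
    show "(\<integral>\<^sup>+x. ennreal (\<bar>X l x - h x\<bar> ^ 1) \<partial>M) \<le> ennreal \<epsilon>" if "l \<ge> l0" for l
      using X h(1) h(2)[OF that] by (auto simp: nn_integral_eq_integral intro!: ennreal_leI)
  qed
  also have "(\<integral>\<^sup>+x. ennreal (\<bar>u x - h x\<bar> ^ 1) \<partial>M) = ennreal (\<integral>x. \<bar>u x - h x\<bar> \<partial>M)"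
    using u h(1) by (simp add: nn_integral_eq_integral)
  finally show ?thesis using \<open>\<epsilon> \<ge> 0\<close> by (simp add: ennreal_le_iff)
qed

lemma cell_int_swap:
  assumes c[measurable]: "c \<in> measurable M (count_space UNIV)"
    and w[measurable]: "w \<in> borel_measurable (M \<Otimes>\<^sub>M M)" and sym: "\<And>x y. w (x, y) = w (y, x)"
  shows "cell_int (M \<Otimes>\<^sub>M M) (pair_class c) w (i, j) = cell_int (M \<Otimes>\<^sub>M M) (pair_class c) w (j, i)"
proof -
  interpret P: pair_sigma_finite M M by unfold_locales
  have [measurable]: "Measurable.pred (M \<Otimes>\<^sub>M M) (\<lambda>u. c (fst u) = j)" "Measurable.pred (M \<Otimes>\<^sub>M M) (\<lambda>u. c (snd u) = j)" for j
    by measurable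
  have "(\<lambda>u. w u * of_bool (c (fst u) = i \<and> c (snd u) = j)) \<in> borel_measurable (M \<Otimes>\<^sub>M M)" by measurable
  from P.integral_product_swap[OF this] show ?thesis
    by (simp add: cell_int_def pair_class_def case_prod_beta' sym[of "snd _" "fst _"] conj_commute)
qed

lemma sum_cell:
  assumes "d \<in> measurable M (count_space UNIV)" "finite S" "\<And>x. x \<in> space M \<Longrightarrow> d x \<in> S"
  shows "(\<Sum>j\<in>S. cell M d j) = 1"
  using integral_classifier[OF assms, of "\<lambda>_. 1"] by (simp add: prob_space)

lemma cell_int_abs_le:
  assumes h: "moments_le M h C" and d: "d \<in> measurable M (count_space UNIV)"
  shows "\<bar>cell_int M d h j\<bar> \<le> C 1"
proof -
  note m = moments_leD[OF h]
  have i: "integrable M (\<lambda>x. h x * of_bool (d x = j))"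
    by (rule integrable_times_bounded[OF m(4), of _ 1]) (auto intro: measurable_compose[OF d])
  have "\<bar>cell_int M d h j\<bar> \<le> (\<integral>x. \<bar>h x * of_bool (d x = j)\<bar> \<partial>M)"
    unfolding cell_int_def using integral_norm_bound[of M "\<lambda>x. h x * of_bool (d x = j)"] by simp
  also have "\<dots> \<le> (\<integral>x. \<bar>h x\<bar> ^ 1 \<partial>M)"
    by (rule integral_mono[OF integrable_abs[OF i] m(2)]) auto
  also have "\<dots> \<le> C 1" by (rule m(3))
  finally show ?thesis .
qed

text \<open>Cauchy-Schwarz on one cell. In the limit it forces block integrals to vanish on blocks
  whose limiting measure is 0.\<close>

lemma cell_int_square_le:
  assumes h: "moments_le M h C"
    and d: "d \<in> measurable M (count_space UNIV)" "finite S" "\<And>x. x \<in> space M \<Longrightarrow> d x \<in> S"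
  shows "(cell_int M d h j)\<^sup>2 \<le> cell M d j * C 2"
proof -
  have eq: "cell_int M d h j = cell_mean M d h j * cell M d j" by (rule cell_int_eq_mean[OF d h])
  have "(cell_int M d h j)\<^sup>2 = cell M d j * (cell M d j * \<bar>cell_mean M d h j\<bar> ^ 2)"
    unfolding eq by (simp add: power2_eq_square)
  also have "cell M d j * \<bar>cell_mean M d h j\<bar> ^ 2 \<le> cell_int M d (\<lambda>x. \<bar>h x\<bar> ^ 2) j"
    by (rule cell_jensen[OF d h])
  also have "\<dots> \<le> (\<integral>x. \<bar>h x\<bar> ^ 2 \<partial>M)"
    unfolding cell_int_def
    by (rule integral_mono[OF integrable_times_bounded[of _ _ 1]])
       (use moments_leD(2)[OF h, of 2] in \<open>auto intro: measurable_compose[OF d(1)]\<close>)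
  also have "\<dots> \<le> C 2" by (rule moments_leD(3)[OF h])
  finally show ?thesis by (simp add: mult_left_mono cell_def)
qed

text \<open>Turns the distance between two step functions on one partition into a finite sum of
  numbers whose limits are known; in this form nothing is divided by a cell measure.\<close>

lemma integral_abs_mean_diff:
  fixes v :: "'i \<Rightarrow> real"
  assumes h: "moments_le M h C"
    and d: "d \<in> measurable M (count_space UNIV)" "finite S" "\<And>x. x \<in> space M \<Longrightarrow> d x \<in> S"
  shows "(\<integral>x. \<bar>cell_mean M d h (d x) - v (d x)\<bar> \<partial>M) = (\<Sum>j\<in>S. \<bar>cell_int M d h j - v j * cell M d j\<bar>)"
proof -
  have "(\<integral>x. \<bar>cell_mean M d h (d x) - v (d x)\<bar> \<partial>M) = (\<Sum>j\<in>S. \<bar>cell_mean M d h j - v j\<bar> * cell M d j)"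
    using integral_classifier[OF d, of "\<lambda>j. \<bar>cell_mean M d h j - v j\<bar>"] .
  also have "\<dots> = (\<Sum>j\<in>S. \<bar>cell_int M d h j - v j * cell M d j\<bar>)"
  proof (rule sum.cong[OF refl])
    fix j
    have eq: "cell_int M d h j = cell_mean M d h j * cell M d j" by (rule cell_int_eq_mean[OF d h])
    have "\<bar>cell_mean M d h j - v j\<bar> * cell M d j = \<bar>(cell_mean M d h j - v j) * cell M d j\<bar>"
      by (simp add: abs_mult cell_def)
    then show "\<bar>cell_mean M d h j - v j\<bar> * cell M d j = \<bar>cell_int M d h j - v j * cell M d j\<bar>"
      unfolding eq by (simp add: left_diff_distrib)
  qed
  finally show ?thesis .
qed

lemma moments_le_classifier:
  fixes p :: "'i \<Rightarrow> real"
  assumes d: "d \<in> measurable M (count_space UNIV)" "finite S" "\<And>x. x \<in> space M \<Longrightarrow> d x \<in> S"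
  shows "moments_le M (\<lambda>x. p (d x)) (\<lambda>q. (\<Sum>j\<in>S. \<bar>p j\<bar>) ^ q)"
  unfolding moments_le_def
proof (intro conjI allI)
  show "(\<lambda>x. p (d x)) \<in> borel_measurable M" by (rule finite_classifier_measurable[OF d])
  fix q
  show i: "integrable M (\<lambda>x. \<bar>p (d x)\<bar> ^ q)" using integrable_finite_classifier(1)[OF d, of "\<lambda>j. \<bar>p j\<bar> ^ q"] .
  have "(\<integral>x. \<bar>p (d x)\<bar> ^ q \<partial>M) \<le> (\<integral>x. (\<Sum>j\<in>S. \<bar>p j\<bar>) ^ q \<partial>M)"
    by (rule integral_mono[OF i]) (use finite_classifier_measurable(2)[OF d] in \<open>auto intro!: power_mono\<close>)
  then show "(\<integral>x. \<bar>p (d x)\<bar> ^ q \<partial>M) \<le> (\<Sum>j\<in>S. \<bar>p j\<bar>) ^ q" by (simp add: prob_space)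
qed

end

text \<open>The limit kernels are the \<open>L\<^sup>1\<close> limits of the martingales formed by the limiting block averages
  over the regularity partitions.\<close>

theorem (in prob_space) kernel_compactness:
  fixes w :: "nat \<Rightarrow> nat \<Rightarrow> 'a \<times> 'a \<Rightarrow> real"
  assumes w: "\<And>i n. moments_le (M \<Otimes>\<^sub>M M) (w i n) (C i)"
    and sym: "\<And>i n x y. w i n (x, y) = w i n (y, x)"
  obtains r u where "strict_mono (r :: nat \<Rightarrow> nat)"
    and "\<And>i. moments_le lborel_square (u i) (C i)"
    and "\<And>i x y. u i (x, y) = u i (y, x)"
    and "\<And>k E \<iota>. simple_graph k E \<Longrightarrow> (\<lambda>n. graph_density M k E (\<lambda>e. w (\<iota> e) (r n)))
      \<longlonglongrightarrow> graph_density lborel_unit k E (\<lambda>e. u (\<iota> e))"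
    and "\<And>S s. finite S \<Longrightarrow> (\<And>n. AE x in M \<Otimes>\<^sub>M M. 0 \<le> (\<Sum>i\<in>S. s i * w i n x)) \<Longrightarrow>
      AE x in lborel_square. 0 \<le> (\<Sum>i\<in>S. s i * u i x)"
proof -
  let ?N = "M \<Otimes>\<^sub>M M" and ?I = "lborel_unit"
  let ?J = "?I \<Otimes>\<^sub>M ?I"
  interpret N: prob_space ?N by (rule prob_space_pair_self)
  interpret I: prob_space ?I by (rule prob_space_lborel_unit)
  interpret J: prob_space ?J by (rule I.prob_space_pair_self)
  define P where "P = (\<lambda>n c. \<forall>k. c k \<in> measurable M (count_space UNIV) \<and> (\<forall>x. c k x < num_cells k) \<and>
      (\<forall>x. c k x = c (Suc k) x div refinement_factor k) \<and> regular_step M k (\<lambda>i. w i n) C (c k) (c (Suc k)))"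
  have "\<forall>n. \<exists>c. P n c"
    unfolding P_def using regularity_partitions[of "\<lambda>i. w i _" C, OF w] by (rule allI)
  then obtain c where "\<And>n. P n (c n)" by metis
  then have c: "\<And>n k. c n k \<in> measurable M (count_space UNIV)" "\<And>n k x. c n k x < num_cells k"
      "\<And>n k x. c n k x = c n (Suc k) x div refinement_factor k"
    and cut: "\<And>n k i. i \<le> k \<Longrightarrow> cut_le M (\<lambda>u. w i n u - step_kernel M (c n k) (w i n) u)
        (sqrt (energy ?N (pair_class (c n (Suc k))) (w i n)
            - energy ?N (pair_class (c n k)) (w i n)) + (1 + 4 * C i 1) / (real k + 1))"
    unfolding P_def regular_step_def by blast+
  define S where "S = (\<lambda>k. {..<num_cells k} \<times> {..<num_cells k})"
  define \<phi> where "\<phi> = (\<lambda>k p. (fst p div refinement_factor k, snd p div refinement_factor k))"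
  have pc: "pair_class (c n k) \<in> measurable ?N (count_space UNIV)" "finite (S k)" "pair_class (c n k) x \<in> S k" for n k x
    unfolding S_def by (rule pair_class_finite_classifier[OF c(1,2)])+
  have pc\<phi>: "pair_class (c n k) x = \<phi> k (pair_class (c n (Suc k)) x)" for n k x
    using c(3)[of n k] by (simp add: pair_class_def \<phi>_def)
  define an where "an = (\<lambda>n k j. cell M (c n k) j)"
  define zn where "zn = (\<lambda>n i k p. cell_int ?N (pair_class (c n k)) (w i n) p)"
  define en where "en = (\<lambda>n i k. energy ?N (pair_class (c n k)) (w i n))"
  have cellN: "cell ?N (pair_class (c n k)) p = an n k (fst p) * an n k (snd p)" for n k p
    unfolding an_def by (rule cell_pair_class[OF c(1)])
  \<comment> \<open>All numerical data, namely cell measures, block integrals and energies, are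
    collected in one countable family so that a single diagonal argument covers them.\<close>
  define X :: "(nat \<times> nat) + ((nat \<times> nat \<times> nat \<times> nat) + (nat \<times> nat)) \<Rightarrow> nat \<Rightarrow> real" where
    "X = (\<lambda>s n. case s of Inl (k, j) \<Rightarrow> an n k j
      | Inr (Inl (i, k, p)) \<Rightarrow> zn n i k p | Inr (Inr (i, k)) \<Rightarrow> en n i k)"
  define B :: "(nat \<times> nat) + ((nat \<times> nat \<times> nat \<times> nat) + (nat \<times> nat)) \<Rightarrow> real" where
    "B = (\<lambda>s. case s of Inl (k, j) \<Rightarrow> 1 | Inr (Inl (i, k, p)) \<Rightarrow> C i 1 | Inr (Inr (i, k)) \<Rightarrow> C i 2)"
  have "\<bar>X s n\<bar> \<le> B s" for s n
  proof -
    have "\<bar>an n k j\<bar> \<le> 1" for k j by (simp add: an_def cell_def)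
    moreover have "\<bar>zn n i k p\<bar> \<le> C i 1" for i k p
      unfolding zn_def by (rule N.cell_int_abs_le[OF w pc(1)])
    moreover have "\<bar>en n i k\<bar> \<le> C i 2" for i k
      using N.energy_le[OF pc w] unfolding en_def by simp
    ultimately show ?thesis by (auto simp: X_def B_def split: sum.split)
  qed
  then obtain r where r: "strict_mono r" and conv: "\<And>s. convergent (\<lambda>n. X s (r n))"
    using bounded_diagonal_subsequence by metis
  define a where "a = (\<lambda>k j. lim (\<lambda>n. an (r n) k j))"
  define z where "z = (\<lambda>i k p. lim (\<lambda>n. zn (r n) i k p))"
  define en' where "en' = (\<lambda>i k. lim (\<lambda>n. en (r n) i k))"
  have a: "(\<lambda>n. an (r n) k j) \<longlonglongrightarrow> a k j" for k j
    using conv[of "Inl (k, j)"] by (simp add: X_def a_def convergent_LIMSEQ_iff)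
  have z: "(\<lambda>n. zn (r n) i k p) \<longlonglongrightarrow> z i k p" for i k p
    using conv[of "Inr (Inl (i, k, p))"] by (simp add: X_def z_def convergent_LIMSEQ_iff)
  have en': "(\<lambda>n. en (r n) i k) \<longlonglongrightarrow> en' i k" for i k
    using conv[of "Inr (Inr (i, k))"] by (simp add: X_def en'_def convergent_LIMSEQ_iff)
  have a0: "a k j \<ge> 0" for k j
    by (rule LIMSEQ_le_const[OF a]) (auto simp: an_def cell_def)
  have a1: "(\<Sum>j<num_cells k. a k j) = 1" for k
  proof -
    have "(\<lambda>n. \<Sum>j<num_cells k. an (r n) k j) \<longlonglongrightarrow> (\<Sum>j<num_cells k. a k j)"
      by (intro tendsto_sum a)
    moreover have "(\<Sum>j<num_cells k. an n k j) = 1" for n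
      unfolding an_def by (rule sum_cell[OF c(1)]) (use c(2) in auto)
    ultimately have "(\<lambda>n. 1) \<longlonglongrightarrow> (\<Sum>j<num_cells k. a k j)" by (simp only:)
    then show ?thesis by (simp only: LIMSEQ_const_iff)
  qed
  have a_ref: "a k j = (\<Sum>q\<in>{q\<in>{..<num_cells (Suc k)}. q div refinement_factor k = j}. a (Suc k) q)" for k j
  proof (rule LIMSEQ_unique[OF a])
    have eq: "an n k j = (\<Sum>q\<in>{q\<in>{..<num_cells (Suc k)}. q div refinement_factor k = j}. an n (Suc k) q)" for n
      unfolding an_def
    proof (rule cell_refine[where \<phi> = "\<lambda>q. q div refinement_factor k"])
      show "c n k x = c n (Suc k) x div refinement_factor k" for x by (rule c(3))
    qed (use c(1) c(2)[of n "Suc k"] in auto)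
    show "(\<lambda>n. an (r n) k j)
        \<longlonglongrightarrow> (\<Sum>q\<in>{q\<in>{..<num_cells (Suc k)}. q div refinement_factor k = j}. a (Suc k) q)"
      unfolding eq by (intro tendsto_sum a)
  qed
  have z_ref: "z i k p = (\<Sum>q\<in>{q\<in>S (Suc k). \<phi> k q = p}. z i (Suc k) q)" for i k p
  proof (rule LIMSEQ_unique[OF z])
    have eq: "zn n i k p = (\<Sum>q\<in>{q\<in>S (Suc k). \<phi> k q = p}. zn n i (Suc k) q)" for n
      unfolding zn_def
      by (rule N.cell_int_refine[OF pc moments_leD(4)[OF w], of "pair_class (c n k)" "\<phi> k"]) (rule pc\<phi>)
    show "(\<lambda>n. zn (r n) i k p) \<longlonglongrightarrow> (\<Sum>q\<in>{q\<in>S (Suc k). \<phi> k q = p}. z i (Suc k) q)"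
      unfolding eq by (intro tendsto_sum z)
  qed
  have z_sq: "(z i k p)\<^sup>2 \<le> a k (fst p) * a k (snd p) * C i 2" for i k p
  proof (rule LIMSEQ_le)
    show "(\<lambda>n. (zn (r n) i k p)\<^sup>2) \<longlonglongrightarrow> (z i k p)\<^sup>2" by (intro tendsto_power z)
    show "(\<lambda>n. an (r n) k (fst p) * an (r n) k (snd p) * C i 2) \<longlonglongrightarrow> a k (fst p) * a k (snd p) * C i 2"
      by (intro tendsto_mult a tendsto_const)
    show "\<exists>n0. \<forall>n\<ge>n0. (zn (r n) i k p)\<^sup>2 \<le> an (r n) k (fst p) * an (r n) k (snd p) * C i 2"
      unfolding zn_def cellN[symmetric] using N.cell_int_square_le[OF w pc] by blast
  qed
  have z0: "z i k p = 0" if "a k (fst p) * a k (snd p) = 0" for i k p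
    using z_sq[of i k p] that by simp
  have z_swap: "z i k (j, j') = z i k (j', j)" for i k j j'
    unfolding z_def zn_def using cell_int_swap[OF c(1) moments_leD(1)[OF w] sym] by simp
  have "\<exists>\<gamma>. \<forall>k. \<gamma> k \<in> measurable ?I (count_space UNIV) \<and> (\<forall>x. \<gamma> k x < num_cells k) \<and>
     (\<forall>x. \<gamma> k x = \<gamma> (Suc k) x div refinement_factor k) \<and>
     (\<forall>j<num_cells k. cell ?I (\<gamma> k) j = a k j)"
    by (rule limit_partition[OF a0 a1 a_ref])
  then obtain \<gamma> where \<gamma>: "\<And>k. \<gamma> k \<in> measurable ?I (count_space UNIV)" "\<And>k x. \<gamma> k x < num_cells k"
      "\<And>k x. \<gamma> k x = \<gamma> (Suc k) x div refinement_factor k"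
    and \<gamma>a: "\<And>k j. j < num_cells k \<Longrightarrow> cell ?I (\<gamma> k) j = a k j"
    by blast
  have p\<gamma>: "pair_class (\<gamma> k) \<in> measurable ?J (count_space UNIV)" "finite (S k)" "pair_class (\<gamma> k) x \<in> S k" for k x
    unfolding S_def by (rule I.pair_class_finite_classifier[OF \<gamma>(1,2)])+
  have p\<gamma>\<phi>: "pair_class (\<gamma> k) x = \<phi> k (pair_class (\<gamma> (Suc k)) x)" for k x
    using \<gamma>(3)[of k] by (simp add: pair_class_def \<phi>_def)
  have cellJ: "cell ?J (pair_class (\<gamma> k)) p = a k (fst p) * a k (snd p)" if "p \<in> S k" for k p
    using that \<gamma>a unfolding I.cell_pair_class[OF \<gamma>(1)] by (auto simp: S_def)
  \<comment> \<open>The limiting block average, equal to 0 on blocks of limiting measure 0; by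
    \<open>z0\<close> no mass is lost there.\<close>
  define v where "v = (\<lambda>i k p. z i k p / (a k (fst p) * a k (snd p)))"
  define uk where "uk = (\<lambda>i k x. v i k (pair_class (\<gamma> k) x))"
  have uk_eq: "uk i k = (\<lambda>x. z i k (pair_class (\<gamma> k) x) / cell ?J (pair_class (\<gamma> k)) (pair_class (\<gamma> k) x))" for i k
    by (simp add: uk_def v_def cellJ[OF p\<gamma>(3)] fun_eq_iff)
  have va: "v i k p * (a k (fst p) * a k (snd p)) = z i k p" for i k p
    using z0[of k p i] by (simp add: v_def)
  have uk_sym: "uk i k (x, y) = uk i k (y, x)" for i k x y
    using z_swap by (simp add: uk_def v_def pair_class_def mult.commute)
  have uk_mom: "moments_le ?J (uk i k) (C i)" for i k
    unfolding moments_le_def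
  proof (intro conjI allI)
    show "uk i k \<in> borel_measurable ?J" unfolding uk_def by (rule J.finite_classifier_measurable[OF p\<gamma>])
    fix q
    show "integrable ?J (\<lambda>x. \<bar>uk i k x\<bar> ^ q)"
      unfolding uk_def using J.integrable_finite_classifier(1)[OF p\<gamma>, of "\<lambda>j. \<bar>v i k j\<bar> ^ q"] .
    \<comment> \<open>Blocks of limiting measure 0 are removed before passing to the limit, since
      their averages for finite \<open>n\<close> need not converge.\<close>
    let ?S' = "{p\<in>S k. a k (fst p) * a k (snd p) \<noteq> 0}"
    let ?mn = "\<lambda>n p. zn (r n) i k p / (an (r n) k (fst p) * an (r n) k (snd p))"
    have "(\<integral>x. \<bar>uk i k x\<bar> ^ q \<partial>?J) = (\<Sum>p\<in>S k. \<bar>v i k p\<bar> ^ q * cell ?J (pair_class (\<gamma> k)) p)"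
      unfolding uk_def using J.integral_classifier[OF p\<gamma>, of "\<lambda>j. \<bar>v i k j\<bar> ^ q"] .
    also have "\<dots> = (\<Sum>p\<in>S k. \<bar>v i k p\<bar> ^ q * (a k (fst p) * a k (snd p)))"
      by (intro sum.cong) (auto simp: cellJ)
    also have "\<dots> = (\<Sum>p\<in>?S'. \<bar>v i k p\<bar> ^ q * (a k (fst p) * a k (snd p)))"
      by (intro sum.mono_neutral_right) (use p\<gamma>(2) in auto)
    also have "\<dots> \<le> C i q"
    proof (rule LIMSEQ_le_const2)
      show "(\<lambda>n. \<Sum>p\<in>?S'. \<bar>?mn n p\<bar> ^ q * (an (r n) k (fst p) * an (r n) k (snd p)))
          \<longlonglongrightarrow> (\<Sum>p\<in>?S'. \<bar>v i k p\<bar> ^ q * (a k (fst p) * a k (snd p)))"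
        unfolding v_def by (intro tendsto_intros a z) auto
      have "(\<Sum>p\<in>?S'. \<bar>?mn n p\<bar> ^ q * (an (r n) k (fst p) * an (r n) k (snd p))) \<le> C i q" for n
      proof -
        let ?d = "pair_class (c (r n) k)"
        have "(\<Sum>p\<in>?S'. \<bar>?mn n p\<bar> ^ q * (an (r n) k (fst p) * an (r n) k (snd p)))
            \<le> (\<Sum>p\<in>S k. \<bar>?mn n p\<bar> ^ q * (an (r n) k (fst p) * an (r n) k (snd p)))"
          by (intro sum_mono2) (use p\<gamma>(2) in \<open>auto simp: an_def cell_def\<close>)
        also have "\<dots> = (\<integral>x. \<bar>cell_mean ?N ?d (w i (r n)) (?d x)\<bar> ^ q \<partial>?N)"
          using N.integral_classifier[OF pc, of "\<lambda>j. \<bar>cell_mean ?N ?d (w i (r n)) j\<bar> ^ q"]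
          by (simp add: cell_mean_def cellN zn_def)
        also have "\<dots> \<le> C i q" by (rule moments_leD(3)[OF N.moments_le_cell_mean[OF pc w]])
        finally show ?thesis .
      qed
      then show "\<exists>n0. \<forall>n\<ge>n0. (\<Sum>p\<in>?S'. \<bar>?mn n p\<bar> ^ q * (an (r n) k (fst p) * an (r n) k (snd p))) \<le> C i q"
        by blast
    qed
    finally show "(\<integral>x. \<bar>uk i k x\<bar> ^ q \<partial>?J) \<le> C i q" .
  qed
  have Cauchy: "\<exists>k0. \<forall>k\<ge>k0. \<forall>k'\<ge>k. (\<integral>x. \<bar>uk i k' x - uk i k x\<bar> \<partial>?J) \<le> \<epsilon>" if "\<epsilon> > 0" for i \<epsilon>
    unfolding uk_eq
    by (rule J.martingale_L1_Cauchy[where d = "\<lambda>k. pair_class (\<gamma> k)" and z = "z i" and C = "C i", OF p\<gamma> p\<gamma>\<phi> z_ref _ _ \<open>\<epsilon> > 0\<close>])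
      (use uk_mom[of i, unfolded uk_eq] in \<open>auto simp: cellJ intro: z0\<close>)
  have "\<exists>\<kappa>. strict_mono \<kappa> \<and> (\<forall>i. AE x in ?J. convergent (\<lambda>l. uk i (\<kappa> l) x))"
    by (rule J.L1_Cauchy_imp_AE_convergent_subsequence[OF moments_leD(4)[OF uk_mom] Cauchy])
  then obtain \<kappa> where \<kappa>: "strict_mono \<kappa>" and AEc: "\<And>i. AE x in ?J. convergent (\<lambda>l. uk i (\<kappa> l) x)"
    by blast
  \<comment> \<open>The limit is taken at every point, also where the sequence diverges. Symmetry of
    \<open>uk\<close> therefore gives symmetry of \<open>u\<close> everywhere.\<close>
  define u where "u = (\<lambda>i x. lim (\<lambda>l. uk i (\<kappa> l) x))"
  note [measurable] = moments_leD(1)[OF uk_mom]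
  have um[measurable]: "u i \<in> borel_measurable ?J" for i
    unfolding u_def by (rule borel_measurable_lim_metric) measurable
  have AEu: "AE x in ?J. (\<lambda>l. uk i (\<kappa> l) x) \<longlonglongrightarrow> u i x" for i
    using AEc[of i] by eventually_elim (simp add: u_def convergent_LIMSEQ_iff)
  have u_mom: "moments_le ?J (u i) (C i)" for i
    by (rule J.AE_limit_moments[OF uk_mom um AEu])
  have u_L1: "\<exists>k0. \<forall>k\<ge>k0. (\<integral>x. \<bar>uk i k x - u i x\<bar> \<partial>?J) \<le> \<epsilon>" if \<epsilon>: "\<epsilon> > 0" for i \<epsilon>
  proof -
    obtain k0 where k0: "\<And>k k'. k \<ge> k0 \<Longrightarrow> k' \<ge> k \<Longrightarrow> (\<integral>x. \<bar>uk i k' x - uk i k x\<bar> \<partial>?J) \<le> \<epsilon>"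
      using Cauchy[OF \<epsilon>] by blast
    have "(\<integral>x. \<bar>u i x - uk i k x\<bar> \<partial>?J) \<le> \<epsilon>" if k: "k \<ge> k0" for k
    proof (rule J.AE_limit_L1[OF moments_leD(4)[OF uk_mom] moments_leD(4)[OF u_mom] AEu moments_leD(4)[OF uk_mom]])
      show "(\<integral>x. \<bar>uk i (\<kappa> l) x - uk i k x\<bar> \<partial>?J) \<le> \<epsilon>" if "l \<ge> k" for l
        by (rule k0[OF k]) (use that \<kappa> in \<open>auto intro: order_trans seq_suble\<close>)
    qed (use \<epsilon> in simp)
    then show ?thesis by (auto simp: abs_minus_commute)
  qed
  have en_incr: "incseq (en' i)" for i
  proof (rule incseq_SucI, rule LIMSEQ_le[OF en' en'])
    have "en n i k \<le> en n i (Suc k)" for n k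
    proof -
      have "0 \<le> (\<integral>x. (cell_mean ?N (pair_class (c n (Suc k))) (w i n) (pair_class (c n (Suc k)) x)
          - cell_mean ?N (pair_class (c n k)) (w i n) (pair_class (c n k) x))\<^sup>2 \<partial>?N)"
        by (rule Bochner_Integration.integral_nonneg) simp
      also have "\<dots> = en n i (Suc k) - en n i k"
        unfolding en_def by (rule N.energy_refine[OF pc w, where \<phi> = "\<phi> k"]) (rule pc\<phi>)
      finally show ?thesis by simp
    qed
    then show "\<exists>n0. \<forall>n\<ge>n0. en (r n) i k \<le> en (r n) i (Suc k)" for k by blast
  qed
  have en_le: "en' i k \<le> C i 2" for i k
    by (rule LIMSEQ_le_const2[OF en']) (unfold en_def, intro exI allI impI, rule N.energy_le(2)[OF pc w])
  have en_conv: "convergent (en' i)" for i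
  proof -
    have "\<forall>k. en' i k \<le> C i 2" using en_le by blast
    from incseq_convergent[OF en_incr this] obtain l where "en' i \<longlonglongrightarrow> l" by metis
    then show ?thesis by (auto simp: convergent_def)
  qed
  define err where "err = (\<lambda>n i k. sqrt (en n i (Suc k) - en n i k) + (1 + 4 * C i 1) / (real k + 1))"
  define err' where "err' = (\<lambda>i k. sqrt (en' i (Suc k) - en' i k) + (1 + 4 * C i 1) / (real k + 1))"
  have err: "(\<lambda>n. err (r n) i k) \<longlonglongrightarrow> err' i k" for i k
    unfolding err_def err'_def by (intro tendsto_intros en')
  \<comment> \<open>A convergent energy sequence has increments tending to 0.\<close>
  have err': "(\<lambda>k. err' i k) \<longlonglongrightarrow> 0" for i
  proof -
    obtain l where l: "en' i \<longlonglongrightarrow> l" using en_conv[of i] by (auto simp: convergent_def)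
    have "(\<lambda>k. (1 + 4 * C i 1) / (real k + 1)) \<longlonglongrightarrow> 0" by real_asymp
    then have "(\<lambda>k. err' i k) \<longlonglongrightarrow> sqrt (l - l) + 0"
      unfolding err'_def using l LIMSEQ_Suc[OF l] by (intro tendsto_add tendsto_real_sqrt tendsto_diff)
    then show ?thesis by simp
  qed
  \<comment> \<open>The distance, for finite \<open>n\<close>, between the true block averages and
    the limiting values placed on the cells of the \<open>n\<close>-th partition.\<close>
  define G where "G = (\<lambda>n i k. \<integral>x. \<bar>step_kernel M (c n k) (w i n) x - v i k (pair_class (c n k) x)\<bar> \<partial>?N)"
  have G: "(\<lambda>n. G (r n) i k) \<longlonglongrightarrow> 0" for i k
  proof -
    have "G n i k = (\<Sum>p\<in>S k. \<bar>zn n i k p - v i k p * (an n k (fst p) * an n k (snd p))\<bar>)" for n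
      unfolding G_def step_kernel_def N.integral_abs_mean_diff[OF w pc] zn_def cellN ..
    moreover have "(\<lambda>n. \<Sum>p\<in>S k. \<bar>zn (r n) i k p - v i k p * (an (r n) k (fst p) * an (r n) k (snd p))\<bar>)
        \<longlonglongrightarrow> (\<Sum>p\<in>S k. \<bar>z i k p - v i k p * (a k (fst p) * a k (snd p))\<bar>)"
      by (intro tendsto_intros a z)
    ultimately show ?thesis by (simp add: va)
  qed
  \<comment> \<open>A chain of comparisons: \<open>w\<close> with its block averages in cut norm,
    these with the limiting block values in \<open>L1\<close>, the resulting step density with its
    limit on the unit interval by the polynomial formula, and that limit with the density of
    \<open>u\<close> in \<open>L1\<close>.\<close>
  have density: "(\<lambda>n. graph_density M K E (\<lambda>e. w (\<iota> e) (r n))) \<longlonglongrightarrow> graph_density ?I K E (\<lambda>e. u (\<iota> e))"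
    if gr: "simple_graph K E" for K E \<iota>
  proof (rule LIMSEQ_I)
    fix \<eta> :: real assume "\<eta> > 0"
    then have \<eta>: "\<eta> / 5 > 0" by simp
    have finE: "finite E" using gr by (rule simple_graph_finite)
    have Cpos: "C i q \<ge> 0" for i q by (rule moments_leD(5)[OF u_mom])
    define C' where "C' = (\<lambda>q. \<Sum>e\<in>E. C (\<iota> e) q)"
    have CC': "C (\<iota> e) q \<le> C' q" if "e \<in> E" for e q
      unfolding C'_def using that finE Cpos by (intro member_le_sum) auto
    obtain \<delta>1 where \<delta>1: "\<delta>1 > 0" and dens1: "density_modulus M (card E) C' \<delta>1 (\<eta> / 5)"
      by (rule graph_density_cut_continuous[OF \<eta>])
    obtain \<delta>3 where \<delta>3: "\<delta>3 > 0" and dens3: "density_modulus ?I (card E) C' \<delta>3 (\<eta> / 5)"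
      by (rule I.graph_density_cut_continuous[OF \<eta>])
    \<comment> \<open>\<open>\<iota> e \<le> k\<close> is required because the partition at level
      \<open>k\<close> controls only the kernels with index at most \<open>k\<close>.\<close>
    define Q where "Q = (\<lambda>k e. \<iota> e \<le> k \<and> err' (\<iota> e) k < \<delta>1 \<and> (\<integral>x. \<bar>uk (\<iota> e) k x - u (\<iota> e) x\<bar> \<partial>?J) \<le> \<delta>3)"
    have "\<forall>\<^sub>F k in sequentially. Q k e" for e
      using eventually_ge_at_top[of "\<iota> e"] order_tendstoD(2)[OF err' \<delta>1, of "\<iota> e"] u_L1[OF \<delta>3, of "\<iota> e"]
      unfolding eventually_sequentially[symmetric] by eventually_elim (simp add: Q_def)
    then have "\<forall>\<^sub>F k in sequentially. \<forall>e\<in>E. Q k e"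
      using finE by (simp add: eventually_ball_finite)
    from eventually_happens'[OF sequentially_bot this] have "\<exists>k. \<forall>e\<in>E. Q k e" .
    then obtain k where k: "\<And>e. e \<in> E \<Longrightarrow> \<iota> e \<le> k" "\<And>e. e \<in> E \<Longrightarrow> err' (\<iota> e) k < \<delta>1"
        "\<And>e. e \<in> E \<Longrightarrow> (\<integral>x. \<bar>uk (\<iota> e) k x - u (\<iota> e) x\<bar> \<partial>?J) \<le> \<delta>3"
      unfolding Q_def by blast
    define st where "st = (\<lambda>n e. step_kernel M (c n k) (w (\<iota> e) n))"
    define vc where "vc = (\<lambda>n e x. v (\<iota> e) k (pair_class (c n k) x))"
    define C'' where "C'' = (\<lambda>q. C' q + (\<Sum>e\<in>E. (\<Sum>p\<in>S k. \<bar>v (\<iota> e) k p\<bar>) ^ q))"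
    have C'pos: "C' q \<ge> 0" for q unfolding C'_def by (intro sum_nonneg Cpos)
    obtain \<delta>2 where \<delta>2: "\<delta>2 > 0" and dens2: "density_modulus M (card E) C'' \<delta>2 (\<eta> / 5)"
      by (rule graph_density_cut_continuous[OF \<eta>])
    have st_mom: "moments_le ?N (st n e) (C (\<iota> e))" for n e
      unfolding st_def step_kernel_def[abs_def] by (rule N.moments_le_cell_mean[OF pc w])
    have vc_mom: "moments_le ?N (vc n e) (\<lambda>q. (\<Sum>p\<in>S k. \<bar>v (\<iota> e) k p\<bar>) ^ q)" for n e
      unfolding vc_def by (rule N.moments_le_classifier[OF pc])
    have "\<forall>\<^sub>F n in sequentially. err (r n) (\<iota> e) k \<le> \<delta>1 \<and> G (r n) (\<iota> e) k \<le> \<delta>2" if "e \<in> E" for e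
      using order_tendstoD(2)[OF err k(2)[OF that]] order_tendstoD(2)[OF G \<delta>2, of "\<iota> e" k]
      by eventually_elim auto
    then have ev1: "\<forall>\<^sub>F n in sequentially. \<forall>e\<in>E. err (r n) (\<iota> e) k \<le> \<delta>1 \<and> G (r n) (\<iota> e) k \<le> \<delta>2"
      using finE by (simp add: eventually_ball_finite)
    have dens_step: "(\<lambda>n. graph_density M K E (vc (r n))) \<longlonglongrightarrow> graph_density ?I K E (\<lambda>e. uk (\<iota> e) k)"
    proof -
      have "graph_density M K E (vc n) = (\<Sum>J\<in>{1..K} \<rightarrow>\<^sub>E {..<num_cells k}.
          (\<Prod>l\<in>{1..K}. an n k (J l)) * (\<Prod>e\<in>E. v (\<iota> e) k (J (Min e), J (Max e))))" for n
        unfolding vc_def an_def by (rule graph_density_step[OF gr c(1,2)])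
      moreover have "graph_density ?I K E (\<lambda>e. uk (\<iota> e) k) = (\<Sum>J\<in>{1..K} \<rightarrow>\<^sub>E {..<num_cells k}.
          (\<Prod>l\<in>{1..K}. a k (J l)) * (\<Prod>e\<in>E. v (\<iota> e) k (J (Min e), J (Max e))))"
        unfolding uk_def
        by (subst I.graph_density_step[OF gr \<gamma>(1,2), of "\<lambda>e. v (\<iota> e) k"], intro sum.cong refl arg_cong2[where f = "(*)"] prod.cong) (auto simp: \<gamma>a PiE_iff)
      moreover have "(\<lambda>n. \<Sum>J\<in>{1..K} \<rightarrow>\<^sub>E {..<num_cells k}.
          (\<Prod>l\<in>{1..K}. an (r n) k (J l)) * (\<Prod>e\<in>E. v (\<iota> e) k (J (Min e), J (Max e))))
          \<longlonglongrightarrow> (\<Sum>J\<in>{1..K} \<rightarrow>\<^sub>E {..<num_cells k}.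
          (\<Prod>l\<in>{1..K}. a k (J l)) * (\<Prod>e\<in>E. v (\<iota> e) k (J (Min e), J (Max e))))"
        by (intro tendsto_sum tendsto_mult tendsto_prod a tendsto_const)
      ultimately show ?thesis by (simp only:)
    qed
    have "\<forall>\<^sub>F n in sequentially. dist (graph_density M K E (vc (r n))) (graph_density ?I K E (\<lambda>e. uk (\<iota> e) k)) < \<eta> / 5"
      by (rule tendstoD[OF dens_step \<eta>])
    with ev1 have "\<forall>\<^sub>F n in sequentially. norm (graph_density M K E (\<lambda>e. w (\<iota> e) (r n)) - graph_density ?I K E (\<lambda>e. u (\<iota> e))) < \<eta>"
    proof eventually_elim
      case (elim n)
      have 1: "\<bar>graph_density M K E (\<lambda>e. w (\<iota> e) (r n)) - graph_density M K E (st (r n))\<bar> \<le> \<eta> / 5"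
      proof (rule density_modulusD[OF dens1 gr refl])
        fix e assume e: "e \<in> E"
        show "moments_le ?N (w (\<iota> e) (r n)) C'" by (rule moments_le_mono[OF w CC'[OF e]])
        show "moments_le ?N (st (r n) e) C'" by (rule moments_le_mono[OF st_mom CC'[OF e]])
        have "cut_le M (\<lambda>x. w (\<iota> e) (r n) x - st (r n) e x) (err (r n) (\<iota> e) k)"
          unfolding st_def err_def en_def by (rule cut[OF k(1)[OF e]])
        then show "cut_le M (\<lambda>x. w (\<iota> e) (r n) x - st (r n) e x) \<delta>1"
          by (rule cut_le_mono) (use elim(1) e in blast)
      qed
      have 2: "\<bar>graph_density M K E (st (r n)) - graph_density M K E (vc (r n))\<bar> \<le> \<eta> / 5"
      proof (rule density_modulusD[OF dens2 gr refl])
        fix e assume e: "e \<in> E"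
        have "C (\<iota> e) q \<le> C'' q" for q
          unfolding C''_def using CC'[OF e, of q] by (intro add_increasing2 sum_nonneg zero_le_power) auto
        then show "moments_le ?N (st (r n) e) C''" by (rule moments_le_mono[OF st_mom])
        have "(\<Sum>p\<in>S k. \<bar>v (\<iota> e) k p\<bar>) ^ q \<le> C'' q" for q
          unfolding C''_def using C'pos e finE
          by (intro add_increasing member_le_sum[where f = "\<lambda>e. (\<Sum>p\<in>S k. \<bar>v (\<iota> e) k p\<bar>) ^ q"]) (auto intro: sum_nonneg)
        then show "moments_le ?N (vc (r n) e) C''" by (rule moments_le_mono[OF vc_mom])
        show "cut_le M (\<lambda>x. st (r n) e x - vc (r n) e x) \<delta>2"
        proof (rule cut_le_L1)
          show "integrable ?N (\<lambda>x. st (r n) e x - vc (r n) e x)"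
            by (intro Bochner_Integration.integrable_diff moments_leD(4)[OF st_mom] moments_leD(4)[OF vc_mom])
          show "(\<integral>x. \<bar>st (r n) e x - vc (r n) e x\<bar> \<partial>?N) \<le> \<delta>2"
            using elim(1) e by (auto simp: G_def st_def vc_def)
        qed
      qed
      have 3: "\<bar>graph_density ?I K E (\<lambda>e. uk (\<iota> e) k) - graph_density ?I K E (\<lambda>e. u (\<iota> e))\<bar> \<le> \<eta> / 5"
      proof (rule density_modulusD[OF dens3 gr refl])
        fix e assume e: "e \<in> E"
        show "moments_le ?J (uk (\<iota> e) k) C'" by (rule moments_le_mono[OF uk_mom CC'[OF e]])
        show "moments_le ?J (u (\<iota> e)) C'" by (rule moments_le_mono[OF u_mom CC'[OF e]])
        show "cut_le ?I (\<lambda>x. uk (\<iota> e) k x - u (\<iota> e) x) \<delta>3"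
          by (rule I.cut_le_L1[OF _ k(3)[OF e]])
             (intro Bochner_Integration.integrable_diff moments_leD(4)[OF uk_mom] moments_leD(4)[OF u_mom])
      qed
      show ?case using 1 2 3 elim(2) \<open>\<eta> > 0\<close> unfolding dist_real_def real_norm_def by linarith
    qed
    then show "\<exists>n0. \<forall>n\<ge>n0. norm (graph_density M K E (\<lambda>e. w (\<iota> e) (r n)) - graph_density ?I K E (\<lambda>e. u (\<iota> e))) < \<eta>"
      by (simp add: eventually_sequentially)
  qed
  \<comment> \<open>The inequality passes to block integrals, to their limits, to quotients by
    nonnegative block measures and to almost everywhere limits. After block integration it holds on
    every block, and only the last passage costs a null set.\<close>
  have pos: "AE x in ?J. 0 \<le> (\<Sum>i\<in>T. s i * u i x)"
    if T: "finite T" and wpos: "\<And>n. AE x in ?N. 0 \<le> (\<Sum>i\<in>T. s i * w i n x)" for T s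
  proof -
    have zn_pos: "0 \<le> (\<Sum>i\<in>T. s i * zn n i k p)" for n k p
    proof -
      let ?b = "\<lambda>x. of_bool (pair_class (c n k) x = p) :: real"
      have i: "integrable ?N (\<lambda>x. w i n x * ?b x)" for i
        by (rule N.integrable_times_bounded[OF moments_leD(4)[OF w], of _ 1])
           (auto intro: measurable_compose[OF pc(1)])
      have "(\<Sum>i\<in>T. s i * zn n i k p) = (\<integral>x. (\<Sum>i\<in>T. s i * (w i n x * ?b x)) \<partial>?N)"
        unfolding zn_def cell_int_def using i by simp
      also have "\<dots> \<ge> 0"
      proof (rule integral_nonneg_AE)
        show "AE x in ?N. 0 \<le> (\<Sum>i\<in>T. s i * (w i n x * ?b x))"
          using wpos[of n]
        proof eventually_elim
          case (elim x)
          have "(\<Sum>i\<in>T. s i * (w i n x * ?b x)) = (\<Sum>i\<in>T. s i * w i n x) * ?b x"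
            by (simp add: sum_distrib_right mult.assoc)
          then show ?case using elim by simp
        qed
      qed
      finally show ?thesis .
    qed
    have z_pos: "0 \<le> (\<Sum>i\<in>T. s i * z i k p)" for k p
      by (rule LIMSEQ_le_const[of "\<lambda>n. \<Sum>i\<in>T. s i * zn (r n) i k p"])
         (use zn_pos in \<open>auto intro!: tendsto_intros z\<close>)
    have uk_pos: "0 \<le> (\<Sum>i\<in>T. s i * uk i k x)" for k x
    proof -
      let ?p = "pair_class (\<gamma> k) x"
      have "(\<Sum>i\<in>T. s i * uk i k x) = (\<Sum>i\<in>T. s i * z i k ?p) / (a k (fst ?p) * a k (snd ?p))"
        by (simp add: uk_def v_def sum_divide_distrib)
      also have "\<dots> \<ge> 0" using z_pos a0 by (intro divide_nonneg_nonneg mult_nonneg_nonneg)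
      finally show ?thesis .
    qed
    have "AE x in ?J. \<forall>i. (\<lambda>l. uk i (\<kappa> l) x) \<longlonglongrightarrow> u i x"
      using AEu by (subst AE_all_countable) blast
    then show ?thesis
    proof eventually_elim
      case (elim x)
      have "(\<lambda>l. \<Sum>i\<in>T. s i * uk i (\<kappa> l) x) \<longlonglongrightarrow> (\<Sum>i\<in>T. s i * u i x)"
        using elim by (intro tendsto_intros) auto
      then show ?case by (rule LIMSEQ_le_const) (use uk_pos in auto)
    qed
  qed
  show ?thesis
  proof (rule that[OF r u_mom _ density pos])
    show "u i (x, y) = u i (y, x)" for i x y
      unfolding u_def using uk_sym by simp
  qed
qed

section \<open>Lebesgue measurable kernels on the unit square\<close>

lemma lborel_unit_pair: "lborel_square = restrict_space lborel unit_square"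
proof (rule pair_measure_eqI)
  have fin: "sigma_finite_measure lborel_unit"
    by (rule finite_measure.sigma_finite_measure[OF prob_space.finite_measure[OF prob_space_lborel_unit]])
  show "sigma_finite_measure lborel_unit" "sigma_finite_measure lborel_unit" by (rule fin)+
  have id: "(\<lambda>u. (fst u, snd u)) \<in> measurable lborel_square (borel :: (real \<times> real) measure)"
    unfolding borel_prod[symmetric]
    by (intro measurable_Pair measurable_compose[OF measurable_fst] measurable_compose[OF measurable_snd]
        measurable_restrict_space1) auto
  show "sets lborel_square = sets (restrict_space lborel unit_square)"
  proof (rule antisym)
    show "sets lborel_square \<subseteq> sets (restrict_space lborel unit_square)"
      unfolding sets_pair_measure
    proof (rule sets.sigma_sets_subset'; (rule subsetI)?)
      fix X assume "X \<in> {a \<times> b |a b. a \<in> sets lborel_unit \<and> b \<in> sets lborel_unit}"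
      then obtain a b where X: "X = a \<times> b" "a \<in> sets borel" "b \<in> sets borel" "a \<subseteq> {0..1}" "b \<subseteq> {0..1}"
        by (auto simp: sets_restrict_space_iff)
      then show "X \<in> sets (restrict_space lborel unit_square)"
        by (auto simp: sets_restrict_space_iff borel_Times)
    qed (auto simp: space_restrict_space sets_restrict_space_iff borel_Times)
    show "sets (restrict_space lborel unit_square) \<subseteq> sets lborel_square"
    proof
      fix X assume "X \<in> sets (restrict_space lborel unit_square)"
      then have X: "X \<in> sets borel" "X \<subseteq> unit_square" by (auto simp: sets_restrict_space_iff borel_Times)
      have "(\<lambda>u. (fst u, snd u)) -` X \<inter> space lborel_square \<in> sets lborel_square"
        by (rule measurable_sets[OF id X(1)])
      also have "(\<lambda>u. (fst u, snd u)) -` X \<inter> space lborel_square = X"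
        using X(2) by (auto simp: space_pair_measure space_restrict_space)
      finally show "X \<in> sets lborel_square" .
    qed
  qed
  fix A B assume "A \<in> sets lborel_unit" "B \<in> sets lborel_unit"
  then have AB: "A \<in> sets borel" "B \<in> sets borel" "A \<subseteq> {0..1}" "B \<subseteq> {0..1}"
    by (auto simp: sets_restrict_space_iff)
  have "emeasure (restrict_space lborel unit_square) (A \<times> B) = emeasure (lborel \<Otimes>\<^sub>M lborel) (A \<times> B)"
    unfolding lborel_prod using AB by (intro emeasure_restrict_space) (auto intro!: borel_Times)
  also have "\<dots> = emeasure lborel A * emeasure lborel B"
    using AB by (intro lborel.emeasure_pair_measure_Times) auto
  also have "\<dots> = emeasure lborel_unit A * emeasure lborel_unit B"
    using AB by (simp add: emeasure_restrict_space)
  finally show "emeasure lborel_unit A * emeasure lborel_unit B = emeasure (restrict_space lborel unit_square) (A \<times> B)" ..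
qed

lemma unit_square_borel [measurable]: "unit_square \<in> sets borel"
  by (intro borel_Times) auto

lemma AE_lebesgue_on_square:
  "(AE u in lebesgue_on unit_square. P u) \<longleftrightarrow> (AE u in lborel_square. P u)"
  unfolding lborel_unit_pair
  by (subst (1 2) AE_restrict_space_iff) (auto simp: AE_completion_iff)

lemma borel_measurable_lebesgue_on_square:
  fixes g :: "real \<times> real \<Rightarrow> real"
  assumes "g \<in> borel_measurable lborel_square"
  shows "g \<in> borel_measurable (lebesgue_on unit_square)"
proof -
  have "(\<lambda>u. indicator unit_square u *\<^sub>R g u) \<in> borel_measurable lborel"
    using assms unfolding lborel_unit_pair by (subst (asm) borel_measurable_restrict_space_iff) (auto simp: mult.commute)
  then have "(\<lambda>u. indicator unit_square u *\<^sub>R g u) \<in> borel_measurable lebesgue" by (rule measurable_completion)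
  then show ?thesis by (subst borel_measurable_restrict_space_iff) (auto simp: mult.commute)
qed

lemma integral_lebesgue_on_square:
  fixes g :: "real \<times> real \<Rightarrow> real"
  assumes g: "g \<in> borel_measurable lborel_square"
  shows "integrable (lebesgue_on unit_square) g \<longleftrightarrow> integrable lborel_square g"
    "(\<integral>u. g u \<partial>(lebesgue_on unit_square)) = (\<integral>u. g u \<partial>lborel_square)"
proof -
  have m: "(\<lambda>u. indicator unit_square u *\<^sub>R g u) \<in> borel_measurable lborel"
    using g unfolding lborel_unit_pair by (subst (asm) borel_measurable_restrict_space_iff) (auto simp: mult.commute)
  show "integrable (lebesgue_on unit_square) g \<longleftrightarrow> integrable lborel_square g"
    unfolding lborel_unit_pair using integrable_completion[OF m]
    by (subst (1 2) integrable_restrict_space) auto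
  show "(\<integral>u. g u \<partial>(lebesgue_on unit_square)) = (\<integral>u. g u \<partial>lborel_square)"
    unfolding lborel_unit_pair using integral_completion[OF m]
    by (subst (1 2) integral_restrict_space) auto
qed

lemma integral_lebesgue_on_square_AE:
  fixes g :: "real \<times> real \<Rightarrow> real"
  assumes g: "g \<in> borel_measurable lborel_square" and f: "f \<in> borel_measurable (lebesgue_on unit_square)"
    and ae: "AE u in lborel_square. f u = g u"
  shows "integrable (lebesgue_on unit_square) f \<longleftrightarrow> integrable lborel_square g"
    "(\<integral>u. f u \<partial>(lebesgue_on unit_square)) = (\<integral>u. g u \<partial>lborel_square)"
  using integrable_cong_AE[OF f borel_measurable_lebesgue_on_square[OF g]]
    integral_cong_AE[OF f borel_measurable_lebesgue_on_square[OF g]] integral_lebesgue_on_square[OF g] ae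
  unfolding AE_lebesgue_on_square by simp_all

lemma AE_unit_square_swap:
  assumes "AE u in lborel_square. P u"
  shows "AE u in lborel_square. P (snd u, fst u)"
proof -
  interpret I: prob_space lborel_unit by (rule prob_space_lborel_unit)
  interpret P: pair_sigma_finite lborel_unit lborel_unit by unfold_locales
  have "AE u in distr lborel_square lborel_square (\<lambda>(x, y). (y, x)). P u"
    by (subst P.distr_pair_swap[symmetric]) (rule assms)
  from AE_distrD[OF measurable_pair_swap' this] show ?thesis by (simp add: case_prod_beta')
qed

text \<open>A Lebesgue measurable function agrees almost everywhere with a Borel function; averaging
  the latter with its reflection restores symmetry at every point. Borel versions are needed because
  the counting lemma works with product measures before completion.\<close>

lemma symmetric_borel_version:
  fixes f :: "real \<times> real \<Rightarrow> real"
  assumes f: "f \<in> borel_measurable (lebesgue_on unit_square)" and sym: "symmetric_on_square f"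
  shows "\<exists>g\<in>borel_measurable lborel_square.
    (\<forall>x y. g (x, y) = g (y, x)) \<and> (AE u in lborel_square. f u = g u)"
proof -
  let ?J = lborel_square
  have "(\<lambda>u. indicator unit_square u *\<^sub>R f u) \<in> borel_measurable lebesgue"
    using f by (subst (asm) borel_measurable_restrict_space_iff) (auto simp: mult.commute)
  then obtain g where g: "g \<in> borel_measurable lborel" "AE u in lborel. indicator unit_square u *\<^sub>R f u = g u"
    using completion_ex_borel_measurable_real[of "\<lambda>u. indicator unit_square u *\<^sub>R f u" lborel] by auto
  have gm[measurable]: "g \<in> borel_measurable ?J"
    unfolding lborel_unit_pair by (rule measurable_restrict_space1[OF g(1)])
  have fg: "AE u in ?J. f u = g u"
    unfolding lborel_unit_pair
    by (subst AE_restrict_space_iff) (use g(2) in \<open>auto elim!: eventually_mono\<close>)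
  define h where "h = (\<lambda>u. (g u + g (snd u, fst u)) / 2)"
  show ?thesis
  proof (intro bexI[of _ h] conjI allI)
    show "h (x, y) = h (y, x)" for x y by (simp add: h_def)
    show "AE u in ?J. f u = h u"
      using fg AE_unit_square_swap[OF fg] AE_space
    proof eventually_elim
      case (elim u)
      then have "f u = f (snd u, fst u)"
        using sym by (auto simp: symmetric_on_square_def space_pair_measure space_restrict_space)
      then show ?case using elim by (simp add: h_def)
    qed
    show "h \<in> borel_measurable ?J" unfolding h_def by measurable
  qed
qed

lemma (in complete_measure) measurable_cong_AE:
  assumes f: "f \<in> measurable M N" and ae: "AE x in M. f x = g x" and g: "\<And>x. x \<in> space M \<Longrightarrow> g x \<in> space N"
  shows "g \<in> measurable M N"
proof (rule measurableI[OF g])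
  fix A assume "A \<in> sets N"
  show "g -` A \<inter> space M \<in> sets M"
    by (rule in_sets_AE[OF _ measurable_sets[OF f \<open>A \<in> sets N\<close>]])
       (use ae in \<open>auto elim!: eventually_mono\<close>)
qed

text \<open>A null set of the square pulls back to a null set of the cube along each edge, so the
  integrand may be exchanged for a product of Borel kernels. Completeness of
  \<open>lebesgue_cube\<close> supplies its measurability.\<close>

lemma hom_density_eq:
  fixes V :: "real \<times> real \<Rightarrow> ('b::real_normed_vector \<Rightarrow>\<^sub>L real)"
  assumes G: "simple_graph k E"
    and h: "\<And>e. e \<in> E \<Longrightarrow> h e \<in> borel_measurable lborel_square"
      "\<And>e. e \<in> E \<Longrightarrow> AE u in lborel_square. blinfun_apply (V u) (f e) = h e u"
  shows "hom_density k E f V = graph_density lborel_unit k E h"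
proof -
  interpret I: prob_space lborel_unit by (rule prob_space_lborel_unit)
  let ?P = "\<Pi>\<^sub>M i\<in>{1..k}. lborel_unit"
  let ?\<Phi> = "\<lambda>x. \<Prod>e\<in>E. blinfun_apply (V (x (Min e), x (Max e))) (f e)"
  let ?\<Psi> = "\<lambda>x. \<Prod>e\<in>E. h e (x (Min e), x (Max e))"
  have m: "?\<Psi> \<in> borel_measurable ?P"
    by (intro borel_measurable_prod measurable_compose[OF I.measurable_PiM_pair h(1)] simple_graph_edge(1,2)[OF G])
  have "AE x in ?P. \<forall>e\<in>E. blinfun_apply (V (x (Min e), x (Max e))) (f e) = h e (x (Min e), x (Max e))"
  proof (rule AE_finite_allI[OF simple_graph_finite[OF G]])
    fix e assume e: "e \<in> E"
    show "AE x in ?P. blinfun_apply (V (x (Min e), x (Max e))) (f e) = h e (x (Min e), x (Max e))"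
      by (rule I.AE_PiM_pair[OF _ simple_graph_edge(1-3)[OF G e] h(2)[OF e]]) simp
  qed
  then have "AE x in ?P. ?\<Psi> x = ?\<Phi> x" by eventually_elim (auto intro: prod.cong)
  then have ae: "AE x in completion ?P. ?\<Psi> x = ?\<Phi> x" by (rule AE_completion)
  have "?\<Phi> \<in> borel_measurable (completion ?P)"
    by (rule completion.measurable_cong_AE[OF measurable_completion[OF m] ae]) simp
  from integral_cong_AE[OF measurable_completion[OF m] this ae] show ?thesis
    unfolding hom_density_def lebesgue_cube_def graph_density_def using integral_completion[OF m] by simp
qed

section \<open>Dual-valued kernels\<close>

text \<open>The single inequality in the hypothesis encodes linearity and boundedness at once.\<close>

lemma blinfun_extension_dense:
  fixes d :: "nat \<Rightarrow> 'b::real_normed_vector"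
  assumes dense: "closure (range d) = UNIV" and "g \<ge> 0"
    and rel: "\<And>a b c (q1 :: rat) (q2 :: rat).
      \<bar>of_rat q1 * \<phi> a + of_rat q2 * \<phi> b - \<phi> c\<bar> \<le> norm (of_rat q1 *\<^sub>R d a + of_rat q2 *\<^sub>R d b - d c) * g"
  shows "\<exists>\<Phi> :: 'b \<Rightarrow>\<^sub>L real. (\<forall>j. blinfun_apply \<Phi> (d j) = \<phi> j) \<and> norm \<Phi> \<le> g"
proof -
  \<comment> \<open>The case \<open>q1 = 1\<close>, \<open>q2 = 0\<close>: \<phi> is Lipschitz along
    \<open>d\<close>, so it depends only on the vector even if \<open>d\<close> repeats
    values.\<close>
  have rel0: "\<bar>\<phi> a - \<phi> c\<bar> \<le> norm (d a - d c) * g" for a c using rel[of 1 a 0 a c] by simp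
  define \<psi> where "\<psi> = (\<lambda>x. \<phi> (SOME j. d j = x))"
  have \<psi>: "\<psi> (d j) = \<phi> j" for j
  proof -
    have "d (SOME i. d i = d j) = d j" by (rule someI) simp
    then show ?thesis using rel0[of "SOME i. d i = d j" j] by (simp add: \<psi>_def)
  qed
  have "uniformly_continuous_on (range d) \<psi>"
    unfolding uniformly_continuous_on_def
  proof (intro allI impI)
    fix e :: real assume "e > 0"
    \<comment> \<open>Adding 1 to the Lipschitz constant avoids a division by 0 when
      \<open>g = 0\<close>.\<close>
    have "dist (\<psi> y) (\<psi> x) < e" if "x \<in> range d" "y \<in> range d" "dist y x < e / (g + 1)" for x y
    proof -
      have "dist (\<psi> y) (\<psi> x) \<le> dist y x * g"
        using that rel0 by (auto simp: \<psi> dist_norm)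
      also have "\<dots> \<le> dist y x * (g + 1)" by (intro mult_left_mono) auto
      also have "\<dots> < e" using that(3) \<open>g \<ge> 0\<close> by (simp add: field_simps)
      finally show ?thesis .
    qed
    then show "\<exists>\<delta>>0. \<forall>x\<in>range d. \<forall>x'\<in>range d. dist x' x < \<delta> \<longrightarrow> dist (\<psi> x') (\<psi> x) < e"
      using \<open>e > 0\<close> \<open>g \<ge> 0\<close> by (intro exI[of _ "e / (g + 1)"]) auto
  qed
  then obtain F where F: "uniformly_continuous_on UNIV F" "\<And>x. x \<in> range d \<Longrightarrow> \<psi> x = F x"
    unfolding dense[symmetric] by (rule uniformly_continuous_on_extension_on_closure) blast
  have Fd: "F (d j) = \<phi> j" for j using F(2)[of "d j"] \<psi>[of j] by simp
  have contF: "continuous_on UNIV F" using F(1) by (rule uniformly_continuous_imp_continuous)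
  have tF: "(\<lambda>n. F (X n)) \<longlonglongrightarrow> F x" if "X \<longlonglongrightarrow> x" for X x
    using continuous_on_tendsto_compose[OF contF that] by simp
  have appr: "\<exists>s. (\<lambda>n. d (s n)) \<longlonglongrightarrow> x" for x
  proof -
    have "x \<in> closure (range d)" using dense by simp
    then obtain X where "\<And>n. X n \<in> range d" "X \<longlonglongrightarrow> x" unfolding closure_sequential by blast
    then show ?thesis
      by (intro exI[of _ "\<lambda>n. SOME j. d j = X n"]) (metis (mono_tags, lifting) image_iff someI_ex tendsto_cong always_eventually)
  qed
  have rat_appr: "\<exists>q :: nat \<Rightarrow> rat. (\<lambda>n. of_rat (q n) :: real) \<longlonglongrightarrow> x" for x
  proof -
    have "x \<in> closure \<rat>" by (simp add: Rats_closure_real)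
    then obtain y where y: "\<And>n. y n \<in> \<rat>" "y \<longlonglongrightarrow> x" unfolding closure_sequential by blast
    have "\<forall>n. \<exists>q. y n = of_rat q" using y(1) by (blast elim: Rats_cases)
    then obtain q :: "nat \<Rightarrow> rat" where "y = (\<lambda>n. of_rat (q n))" by metis
    then show ?thesis using y(2) by blast
  qed
  \<comment> \<open>By continuity the inequality extends to all vectors and real coefficients. With
    \<open>z\<close> the combination itself the right side is 0, which is linearity; with
    \<open>s = 1\<close>, \<open>t = 0\<close> and \<open>z = 0\<close> it becomes the norm
    bound.\<close>
  have relF: "\<bar>s * F x + t * F y - F z\<bar> \<le> norm (s *\<^sub>R x + t *\<^sub>R y - z) * g" for s t x y z
  proof -
    obtain X Y Z where XYZ: "(\<lambda>n. d (X n)) \<longlonglongrightarrow> x" "(\<lambda>n. d (Y n)) \<longlonglongrightarrow> y" "(\<lambda>n. d (Z n)) \<longlonglongrightarrow> z"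
      using appr by metis
    obtain p q :: "nat \<Rightarrow> rat" where pq: "(\<lambda>n. of_rat (p n) :: real) \<longlonglongrightarrow> s" "(\<lambda>n. of_rat (q n) :: real) \<longlonglongrightarrow> t"
      using rat_appr by metis
    show ?thesis
    proof (rule LIMSEQ_le)
      show "(\<lambda>n. \<bar>of_rat (p n) * F (d (X n)) + of_rat (q n) * F (d (Y n)) - F (d (Z n))\<bar>)
          \<longlonglongrightarrow> \<bar>s * F x + t * F y - F z\<bar>"
        by (intro tendsto_intros pq tF XYZ)
      show "(\<lambda>n. norm (of_rat (p n) *\<^sub>R d (X n) + of_rat (q n) *\<^sub>R d (Y n) - d (Z n)) * g)
          \<longlonglongrightarrow> norm (s *\<^sub>R x + t *\<^sub>R y - z) * g"
        by (intro tendsto_intros pq XYZ)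
      show "\<exists>n0. \<forall>n\<ge>n0. \<bar>of_rat (p n) * F (d (X n)) + of_rat (q n) * F (d (Y n)) - F (d (Z n))\<bar>
          \<le> norm (of_rat (p n) *\<^sub>R d (X n) + of_rat (q n) *\<^sub>R d (Y n) - d (Z n)) * g"
        unfolding Fd using rel by blast
    qed
  qed
  have F_lin: "F (s *\<^sub>R x + t *\<^sub>R y) = s * F x + t * F y" for s t x y
    using relF[of s x t y "s *\<^sub>R x + t *\<^sub>R y"] by simp
  have F0: "F 0 = 0" using F_lin[of 0 0 0 0] by simp
  have F_bd: "\<bar>F x\<bar> \<le> norm x * g" for x using relF[of 1 x 0 x 0] F0 by simp
  have bl: "bounded_linear F"
  proof (rule bounded_linear_intro)
    show "F (x + y) = F x + F y" for x y using F_lin[of 1 x 1 y] by simp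
    show "F (r *\<^sub>R x) = r *\<^sub>R F x" for r x using F_lin[of r x 0 x] by simp
    show "norm (F x) \<le> norm x * g" for x using F_bd by simp
  qed
  show ?thesis
  proof (intro exI[of _ "Blinfun F"] conjI allI)
    show "blinfun_apply (Blinfun F) (d j) = \<phi> j" for j by (simp add: bounded_linear_Blinfun_apply[OF bl] Fd)
    show "norm (Blinfun F) \<le> g"
      by (rule norm_blinfun_bound[OF \<open>g \<ge> 0\<close>])
         (use F_bd in \<open>simp add: bounded_linear_Blinfun_apply[OF bl] mult.commute\<close>)
  qed
qed

section \<open>Borel representatives of the pairings and dependence of densities on the
  decoration\<close>

lemma moments_le_lebesgue_on_square:
  assumes g: "g \<in> borel_measurable lborel_square" and f: "f \<in> borel_measurable (lebesgue_on unit_square)"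
    and ae: "AE u in lborel_square. f u = g u"
  shows "moments_le (lebesgue_on unit_square) f C \<longleftrightarrow> moments_le lborel_square g C"
proof -
  have 1: "(\<lambda>u. \<bar>g u\<bar> ^ q) \<in> borel_measurable lborel_square" for q using g by measurable
  have 2: "(\<lambda>u. \<bar>f u\<bar> ^ q) \<in> borel_measurable (lebesgue_on unit_square)" for q using f by measurable
  have 3: "AE u in lborel_square. \<bar>f u\<bar> ^ q = \<bar>g u\<bar> ^ q" for q using ae by eventually_elim simp
  show ?thesis
    unfolding moments_le_def using f g integral_lebesgue_on_square_AE[OF 1 2 3] by simp
qed

text \<open>One representative is fixed for each vector, symmetric at every point. Linearity in the
  vector is available only up to null sets that vary with the vectors, so identities between
  representatives are stated almost everywhere.\<close>

definition borel_kernel ::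
    "(real \<times> real \<Rightarrow> ('b::real_normed_vector \<Rightarrow>\<^sub>L real)) \<Rightarrow> 'b \<Rightarrow> real \<times> real \<Rightarrow> real" where
  "borel_kernel V b = (SOME h. h \<in> borel_measurable lborel_square \<and>
    (\<forall>x y. h (x, y) = h (y, x)) \<and> (AE u in lborel_square. blinfun_apply (V u) b = h u))"

definition graphon_moments_le ::
    "(real \<times> real \<Rightarrow> ('b::real_normed_vector \<Rightarrow>\<^sub>L real)) \<Rightarrow> (nat \<Rightarrow> real) \<Rightarrow> bool" where
  "graphon_moments_le V C \<longleftrightarrow> graphon V \<and> moments_le (lebesgue_on unit_square) (\<lambda>u. norm (V u)) C"

context
  fixes V :: "real \<times> real \<Rightarrow> ('b::real_normed_vector \<Rightarrow>\<^sub>L real)" and C :: "nat \<Rightarrow> real"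
  assumes V: "graphon_moments_le V C"
begin

lemma borel_kernel:
  "borel_kernel V b \<in> borel_measurable lborel_square"
  "borel_kernel V b (x, y) = borel_kernel V b (y, x)"
  "AE u in lborel_square. blinfun_apply (V u) b = borel_kernel V b u"
proof -
  have "(\<lambda>u. blinfun_apply (V u) b) \<in> borel_measurable (lebesgue_on unit_square)"
    using V by (simp add: graphon_moments_le_def graphon_def weak_star_measurable_def)
  moreover have "symmetric_on_square (\<lambda>u. blinfun_apply (V u) b)"
    using V by (auto simp: graphon_moments_le_def graphon_def symmetric_on_square_def)
  ultimately have "\<exists>h. h \<in> borel_measurable lborel_square \<and>
    (\<forall>x y. h (x, y) = h (y, x)) \<and> (AE u in lborel_square. blinfun_apply (V u) b = h u)"
    using symmetric_borel_version by blast
  from someI_ex[OF this] show "borel_kernel V b \<in> borel_measurable lborel_square"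
      "borel_kernel V b (x, y) = borel_kernel V b (y, x)"
      "AE u in lborel_square. blinfun_apply (V u) b = borel_kernel V b u"
    unfolding borel_kernel_def by blast+
qed

lemma borel_kernel_moments:
  "moments_le lborel_square (borel_kernel V b) (\<lambda>q. norm b ^ q * C q)"
proof -
  have m: "(\<lambda>u. blinfun_apply (V u) b) \<in> borel_measurable (lebesgue_on unit_square)"
    using V by (simp add: graphon_moments_le_def graphon_def weak_star_measurable_def)
  have "moments_le (lebesgue_on unit_square) (\<lambda>u. norm b * norm (V u)) (\<lambda>q. norm b ^ q * C q)"
    using moments_le_cmult[of "lebesgue_on unit_square" "\<lambda>u. norm (V u)" C "norm b"] V
    by (simp add: graphon_moments_le_def)
  then have "moments_le (lebesgue_on unit_square) (\<lambda>u. blinfun_apply (V u) b) (\<lambda>q. norm b ^ q * C q)"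
  proof (rule moments_le_dominated[OF _ m])
    show "AE u in lebesgue_on unit_square. \<bar>blinfun_apply (V u) b\<bar> \<le> \<bar>norm b * norm (V u)\<bar>"
      using norm_blinfun[of "V _" b] by (intro AE_I2) (simp add: mult.commute)
  qed
  then show ?thesis using moments_le_lebesgue_on_square[OF borel_kernel(1) m borel_kernel(3)] by blast
qed

lemma borel_kernel_combination:
  "AE u in lborel_square.
    blinfun_apply (V u) (s *\<^sub>R a + t *\<^sub>R b) = s * borel_kernel V a u + t * borel_kernel V b u"
  using borel_kernel(3)[of a] borel_kernel(3)[of b]
  by eventually_elim (simp add: blinfun.add_right blinfun.scaleR_right)

lemma hom_density_borel_kernel:
  "simple_graph k E \<Longrightarrow> hom_density k E f V = graph_density lborel_unit k E (\<lambda>e. borel_kernel V (f e))"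
  by (rule hom_density_eq) (assumption | rule borel_kernel)+

lemma moment_bound_nonneg: "C q \<ge> 0"
  using V moments_leD(5) by (auto simp: graphon_moments_le_def)

text \<open>The bound involves the new decoration of \<open>e0\<close> only through
  \<open>B\<close>; thus one density modulus serves all vectors of norm at most
  \<open>B\<close>.\<close>

lemma borel_kernel_moments_edge:
  assumes G: "simple_graph k E" and e: "e \<in> E" and c: "norm c \<le> B"
  shows "moments_le lborel_square (borel_kernel V ((f(e0 := c)) e))
    (\<lambda>q. (\<Sum>e\<in>E. norm (f e) ^ q * C q) + B ^ q * C q)"
proof (rule moments_le_mono[OF borel_kernel_moments])
  fix q
  have c_le: "norm c ^ q * C q \<le> B ^ q * C q"
    using c moment_bound_nonneg by (intro mult_right_mono power_mono) auto
  have pos: "norm x ^ q * C q \<ge> 0" for x :: 'b using moment_bound_nonneg by simp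
  have f_le: "norm (f e) ^ q * C q \<le> (\<Sum>e\<in>E. norm (f e) ^ q * C q)"
    using e simple_graph_finite[OF G] pos by (intro member_le_sum) auto
  show "norm ((f(e0 := c)) e) ^ q * C q \<le> (\<Sum>e\<in>E. norm (f e) ^ q * C q) + B ^ q * C q"
    using c_le f_le pos[of c] pos[of "f e"] by (cases "e = e0") simp_all
qed

lemma hom_density_linear:
  assumes G: "simple_graph k E" and e0: "e0 \<in> E"
  shows "hom_density k E (f(e0 := s *\<^sub>R a + t *\<^sub>R b)) V
    = s * hom_density k E (f(e0 := a)) V + t * hom_density k E (f(e0 := b)) V"
proof -
  interpret I: prob_space lborel_unit by (rule prob_space_lborel_unit)
  let ?J = lborel_square
  define h where "h = (\<lambda>e. borel_kernel V ((f(e0 := a)) e))"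
  let ?g = "borel_kernel V b"
  note mom = borel_kernel_moments_edge[OF G, of _ _ "norm a + norm b" f e0]
  have hm: "moments_le ?J (h e) (\<lambda>q. (\<Sum>e\<in>E. norm (f e) ^ q * C q) + (norm a + norm b) ^ q * C q)" if "e \<in> E" for e
    unfolding h_def by (rule mom[OF that]) simp
  have gm: "moments_le ?J ?g (\<lambda>q. (\<Sum>e\<in>E. norm (f e) ^ q * C q) + (norm a + norm b) ^ q * C q)"
    using mom[OF e0, of b] by simp
  have "hom_density k E (f(e0 := s *\<^sub>R a + t *\<^sub>R b)) V
      = graph_density lborel_unit k E (h(e0 := \<lambda>u. s * h e0 u + t * ?g u))"
  proof (rule hom_density_eq[OF G])
    fix e assume "e \<in> E"
    show "(h(e0 := \<lambda>u. s * h e0 u + t * ?g u)) e \<in> borel_measurable ?J"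
      using borel_kernel(1) by (auto simp: h_def)
    show "AE u in ?J. blinfun_apply (V u) ((f(e0 := s *\<^sub>R a + t *\<^sub>R b)) e)
        = (h(e0 := \<lambda>u. s * h e0 u + t * ?g u)) e u"
      using borel_kernel(3) borel_kernel_combination by (cases "e = e0") (auto simp: h_def)
  qed
  also have "\<dots> = s * graph_density lborel_unit k E h + t * graph_density lborel_unit k E (h(e0 := ?g))"
    by (rule I.graph_density_upd[OF G e0 hm gm])
  also have "graph_density lborel_unit k E h = hom_density k E (f(e0 := a)) V"
    unfolding h_def by (rule hom_density_borel_kernel[OF G, symmetric])
  also have "h(e0 := ?g) = (\<lambda>e. borel_kernel V ((f(e0 := b)) e))" by (auto simp: h_def)
  then have "graph_density lborel_unit k E (h(e0 := ?g)) = hom_density k E (f(e0 := b)) V"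
    using hom_density_borel_kernel[OF G] by simp
  finally show ?thesis .
qed

end

text \<open>Kernels of nearby vectors are close in \<open>L1\<close>, hence in cut norm, at a rate
  depending only on \<open>C\<close>. Since \<delta> is chosen before \<open>V\<close>, the estimate
  holds simultaneously along the sequence and at the limit.\<close>

lemma hom_density_equicontinuous:
  fixes b :: "'b::real_normed_vector"
  assumes G: "simple_graph k E" and e0: "e0 \<in> E" and "\<eta> > 0"
  shows "\<exists>\<delta>>0. \<forall>V b'. graphon_moments_le V C \<longrightarrow> dist b' b < \<delta> \<longrightarrow>
    \<bar>hom_density k E (f(e0 := b')) V - hom_density k E (f(e0 := b)) V\<bar> \<le> \<eta>"
proof -
  interpret I: prob_space lborel_unit by (rule prob_space_lborel_unit)
  let ?J = lborel_square
  define C' where "C' = (\<lambda>q. (\<Sum>e\<in>E. norm (f e) ^ q * C q) + (norm b + 1) ^ q * C q)"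
  obtain \<delta>0 where \<delta>0: "\<delta>0 > 0" and dens: "density_modulus lborel_unit (card E) C' \<delta>0 \<eta>"
    by (rule I.graph_density_cut_continuous[OF \<open>\<eta> > 0\<close>])
  \<comment> \<open>The bound 1 keeps the norm of \<open>b'\<close> at most
    \<open>norm b + 1\<close>, so that \<open>C'\<close> applies; the other term makes the
    \<open>L1\<close> distance of the kernels at most \<open>\<delta>0\<close>.\<close>
  define \<delta> where "\<delta> = min 1 (\<delta>0 / (\<bar>C 1\<bar> + 1))"
  show ?thesis
  proof (intro exI[of _ \<delta>] conjI allI impI)
    show "\<delta> > 0" using \<delta>0 by (simp add: \<delta>_def add_nonneg_pos)
    fix V :: "real \<times> real \<Rightarrow> ('b \<Rightarrow>\<^sub>L real)" and b'
    assume V: "graphon_moments_le V C" and b': "dist b' b < \<delta>"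
    have Cpos: "C q \<ge> 0" for q by (rule moment_bound_nonneg[OF V])
    have nb': "norm b' \<le> norm b + 1"
      using b' norm_triangle_sub[of b' b] by (simp add: \<delta>_def dist_norm)
    note mom = borel_kernel_moments_edge[OF V G, of _ _ "norm b + 1" f e0, folded C'_def]
    show "\<bar>hom_density k E (f(e0 := b')) V - hom_density k E (f(e0 := b)) V\<bar> \<le> \<eta>"
      unfolding hom_density_borel_kernel[OF V G]
    proof (rule density_modulusD[OF dens G refl mom mom])
      fix e assume "e \<in> E"
      show "cut_le lborel_unit (\<lambda>x. borel_kernel V ((f(e0 := b')) e) x - borel_kernel V ((f(e0 := b)) e) x) \<delta>0"
      proof (rule I.cut_le_L1)
        note i = moments_leD(4)[OF borel_kernel_moments[OF V]]
        note [measurable] = borel_kernel(1)[OF V]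
        show "integrable ?J (\<lambda>x. borel_kernel V ((f(e0 := b')) e) x - borel_kernel V ((f(e0 := b)) e) x)"
          by (intro Bochner_Integration.integrable_diff i)
        show "(\<integral>x. \<bar>borel_kernel V ((f(e0 := b')) e) x - borel_kernel V ((f(e0 := b)) e) x\<bar> \<partial>?J) \<le> \<delta>0"
        proof (cases "e = e0")
          case True
          have "AE x in ?J. borel_kernel V b' x - borel_kernel V b x = borel_kernel V (b' - b) x"
            using borel_kernel(3)[OF V, of b] borel_kernel(3)[OF V, of b'] borel_kernel(3)[OF V, of "b' - b"]
            by eventually_elim (simp add: blinfun.diff_right)
          then have "AE x in ?J. \<bar>borel_kernel V b' x - borel_kernel V b x\<bar> = \<bar>borel_kernel V (b' - b) x\<bar> ^ 1"
            by eventually_elim simp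
          then have "(\<integral>x. \<bar>borel_kernel V b' x - borel_kernel V b x\<bar> \<partial>?J) = (\<integral>x. \<bar>borel_kernel V (b' - b) x\<bar> ^ 1 \<partial>?J)"
            by (intro integral_cong_AE) measurable
          also have "\<dots> \<le> norm (b' - b) ^ 1 * C 1"
            by (rule moments_leD(3)[OF borel_kernel_moments[OF V]])
          also have "\<dots> \<le> \<delta>0 / (\<bar>C 1\<bar> + 1) * (\<bar>C 1\<bar> + 1)"
            using b' Cpos[of 1] \<delta>0 by (intro mult_mono) (auto simp: \<delta>_def dist_norm)
          also have "\<dots> = \<delta>0" by (simp add: add_nonneg_eq_0_iff)
          finally show ?thesis using True by simp
        qed (use \<delta>0 in simp)
      qed
    qed (use nb' in auto)
  qed
qed

section \<open>Norm bounds and reconstruction of a dual-valued kernel\<close>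

lemma Lp_symD:
  assumes "g \<in> Lp_sym p"
  shows "g \<in> borel_measurable (lebesgue_on unit_square)" "integrable (lebesgue_on unit_square) (\<lambda>u. \<bar>g u\<bar> powr p)"
    "symmetric_on_square g"
  using assms by (simp_all add: Lp_sym_def)

lemma L_allD: "g \<in> L_all \<Longrightarrow> p \<ge> 1 \<Longrightarrow> g \<in> Lp_sym p"
  by (simp add: L_all_def)

lemma le_powr_if_root_le:
  fixes x c p :: real
  assumes "x \<ge> 0" "p > 0" "x powr (1 / p) \<le> c"
  shows "x \<le> c powr p"
proof -
  have "x = (x powr (1 / p)) powr p" using assms(1,2) by (simp add: powr_powr)
  also have "\<dots> \<le> c powr p" using assms by (intro powr_mono2) auto
  finally show ?thesis .
qed

text \<open>The bounds on \<open>graphon_norm\<close> concern exponents \<open>p \<ge> 1\<close>;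
  the zeroth moment is the total mass 1 of the square and is supplied separately.\<close>

lemma graphon_moments:
  assumes V: "graphon V" and bd: "\<And>p. p \<ge> 1 \<Longrightarrow> graphon_norm p V \<le> c p"
  shows "graphon_moments_le V (\<lambda>q. if q = 0 then 1 else c (real q) powr real q)"
proof -
  let ?L = "lebesgue_on unit_square"
  interpret I: prob_space lborel_unit by (rule prob_space_lborel_unit)
  interpret J: prob_space lborel_square by (rule I.prob_space_pair_self)
  have L: "(\<lambda>u. norm (V u)) \<in> Lp_sym p" if "p \<ge> 1" for p
    using V that by (intro L_allD) (auto simp: graphon_def)
  have m: "(\<lambda>u. norm (V u)) \<in> borel_measurable ?L"
    by (rule Lp_symD(1)[OF L[OF order_refl]])
  have "integrable ?L (\<lambda>u. \<bar>norm (V u)\<bar> ^ q) \<and>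
      (\<integral>u. \<bar>norm (V u)\<bar> ^ q \<partial>?L) \<le> (if q = 0 then 1 else c (real q) powr real q)" for q :: nat
  proof (cases "q = 0")
    case True
    have "integrable ?L (\<lambda>_. 1 :: real)" "(\<integral>_. 1 \<partial>?L) = (1 :: real)"
      using integral_lebesgue_on_square[of "\<lambda>_. 1"] J.integrable_const[of "1 :: real"]
      by (simp_all only: borel_measurable_const lebesgue_integral_const J.prob_space scaleR_one simp_thms mult_1)
    then show ?thesis unfolding True power_0 if_P[OF refl] by (simp only: order_refl simp_thms)
  next
    case False
    then have q: "real q \<ge> 1" by simp
    have eq: "norm (V u) powr real q = \<bar>norm (V u)\<bar> ^ q" for u
      unfolding abs_norm_cancel by (rule powr_realpow') (use False in auto)
    let ?X = "\<integral>u. norm (V u) powr real q \<partial>?L"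
    have X0: "?X \<ge> 0" by (rule Bochner_Integration.integral_nonneg) (rule powr_ge_zero)
    have X_le: "?X \<le> c (real q) powr real q"
      by (rule le_powr_if_root_le[OF X0 _ bd[OF q, unfolded graphon_norm_def]]) (use q in linarith)
    have X_int: "integrable ?L (\<lambda>u. norm (V u) powr real q)"
      using Lp_symD(2)[OF L[OF q]] unfolding abs_norm_cancel .
    show ?thesis using X_le X_int unfolding eq if_not_P[OF False] by (rule conjI[rotated])
  qed
  with V m show ?thesis unfolding graphon_moments_le_def moments_le_def by blast
qed

text \<open>Both sides of the pointwise bound are continuous, so it suffices to test it on a dense
  sequence. Sublevel sets of the norm of a dual-valued kernel are thereby described by countably
  many measurable conditions.\<close>

lemma norm_blinfun_le_dense:
  fixes \<Phi> :: "'b::real_normed_vector \<Rightarrow>\<^sub>L real"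
  assumes dense: "closure (range d) = UNIV"
  shows "norm \<Phi> \<le> t \<longleftrightarrow> 0 \<le> t \<and> (\<forall>j. \<bar>blinfun_apply \<Phi> (d j)\<bar> \<le> t * norm (d j))"
proof
  assume "norm \<Phi> \<le> t"
  moreover have "0 \<le> norm \<Phi>" by simp
  ultimately have "0 \<le> t" by linarith
  moreover have "\<bar>blinfun_apply \<Phi> x\<bar> \<le> t * norm x" for x
    using norm_blinfun[of \<Phi> x] mult_right_mono[OF \<open>norm \<Phi> \<le> t\<close>, of "norm x"] by simp
  ultimately show "0 \<le> t \<and> (\<forall>j. \<bar>blinfun_apply \<Phi> (d j)\<bar> \<le> t * norm (d j))" by blast
next
  assume t: "0 \<le> t \<and> (\<forall>j. \<bar>blinfun_apply \<Phi> (d j)\<bar> \<le> t * norm (d j))"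
  have "closed {x. \<bar>blinfun_apply \<Phi> x\<bar> \<le> t * norm x}"
    by (intro closed_Collect_le continuous_intros)
  then have "closure (range d) \<subseteq> {x. \<bar>blinfun_apply \<Phi> x\<bar> \<le> t * norm x}"
    using t by (intro closure_minimal) auto
  then show "norm \<Phi> \<le> t" using t dense by (intro norm_blinfun_bound) auto
qed

text \<open>The functional at a good point is chosen without regard to measurability or symmetry.
  Both follow afterwards, because its values on the dense sequence are prescribed and determine
  it.\<close>

lemma dual_valued_kernel:
  fixes d :: "nat \<Rightarrow> 'b::real_normed_vector" and u :: "nat \<Rightarrow> real \<times> real \<Rightarrow> real"
  assumes dense: "closure (range d) = UNIV"
    and u: "\<And>j. u j \<in> borel_measurable lborel_square" "\<And>j x y. u j (x, y) = u j (y, x)"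
    and g: "moments_le lborel_square g C" "\<And>x y. g (x, y) = g (y, x)"
      "AE x in lborel_square. 0 \<le> g x"
    and rel: "\<And>a b c (q1 :: rat) (q2 :: rat). AE x in lborel_square.
      \<bar>of_rat q1 * u a x + of_rat q2 * u b x - u c x\<bar> \<le> norm (of_rat q1 *\<^sub>R d a + of_rat q2 *\<^sub>R d b - d c) * g x"
  shows "\<exists>U :: real \<times> real \<Rightarrow> ('b \<Rightarrow>\<^sub>L real). graphon_moments_le U C \<and>
    (\<forall>j. AE x in lborel_square. blinfun_apply (U x) (d j) = u j x)"
proof -
  let ?J = lborel_square
  interpret I: prob_space lborel_unit by (rule prob_space_lborel_unit)
  interpret J: prob_space ?J by (rule I.prob_space_pair_self)
  note [measurable] = u(1) moments_leD(1)[OF g(1)]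
  define R where "R = (\<lambda>x (a, b, c, q1 :: rat, q2 :: rat).
    \<bar>of_rat q1 * u a x + of_rat q2 * u b x - u c x\<bar> \<le> norm (of_rat q1 *\<^sub>R d a + of_rat q2 *\<^sub>R d b - d c) * g x)"
  \<comment> \<open>The countably many inequalities are required at once, so that this set is
    measurable and of full measure; it is also invariant under reflection.\<close>
  define good where "good = (\<lambda>x. 0 \<le> g x \<and> (\<forall>i. R x i))"
  have Rm[measurable]: "Measurable.pred ?J (\<lambda>x. R x i)" for i
    unfolding R_def by (cases i) (simp add: split_beta)
  have good_m[measurable]: "Measurable.pred ?J good"
    unfolding good_def by measurable
  have "AE x in ?J. R x i" for i
    using rel unfolding R_def by (cases i) auto
  then have "AE x in ?J. \<forall>i. R x i" by (subst AE_all_countable) blast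
  with g(3) have AE_good: "AE x in ?J. good x" by eventually_elim (simp add: good_def)
  have "\<exists>\<Phi> :: 'b \<Rightarrow>\<^sub>L real. (\<forall>j. blinfun_apply \<Phi> (d j) = u j x) \<and> norm \<Phi> \<le> g x" if "good x" for x
  proof (rule blinfun_extension_dense[OF dense])
    show "g x \<ge> 0" using that by (simp add: good_def)
    fix a b c :: nat and q1 q2 :: rat
    have "R x (a, b, c, q1, q2)" using that by (simp add: good_def)
    then show "\<bar>of_rat q1 * u a x + of_rat q2 * u b x - u c x\<bar>
        \<le> norm (of_rat q1 *\<^sub>R d a + of_rat q2 *\<^sub>R d b - d c) * g x" by (simp add: R_def)
  qed
  then have "\<forall>x. \<exists>\<Phi> :: 'b \<Rightarrow>\<^sub>L real. good x \<longrightarrow> (\<forall>j. blinfun_apply \<Phi> (d j) = u j x) \<and> norm \<Phi> \<le> g x" by blast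
  from choice[OF this] obtain \<Phi> :: "real \<times> real \<Rightarrow> ('b \<Rightarrow>\<^sub>L real)"
    where \<Phi>: "\<And>x j. good x \<Longrightarrow> blinfun_apply (\<Phi> x) (d j) = u j x" "\<And>x. good x \<Longrightarrow> norm (\<Phi> x) \<le> g x"
    by blast
  define U where "U = (\<lambda>x. if good x then \<Phi> x else 0)"
  have Ud: "blinfun_apply (U x) (d j) = (if good x then u j x else 0)" for x j
    using \<Phi>(1) by (simp add: U_def)
  have Udm[measurable]: "(\<lambda>x. blinfun_apply (U x) (d j)) \<in> borel_measurable ?J" for j
    unfolding Ud by measurable
  have Ubm: "(\<lambda>x. blinfun_apply (U x) b) \<in> borel_measurable ?J" for b
  proof -
    have "b \<in> closure (range d)" using dense by simp
    then obtain X where X: "\<And>n. X n \<in> range d" "X \<longlonglongrightarrow> b" unfolding closure_sequential by blast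
    show ?thesis
    proof (rule borel_measurable_LIMSEQ_real)
      show "(\<lambda>n. blinfun_apply (U x) (X n)) \<longlonglongrightarrow> blinfun_apply (U x) b" for x
        by (intro tendsto_intros X)
      show "(\<lambda>x. blinfun_apply (U x) (X n)) \<in> borel_measurable ?J" for n
        using X(1)[of n] Udm by auto
    qed
  qed
  have norm_m[measurable]: "(\<lambda>x. norm (U x)) \<in> borel_measurable ?J"
  proof (rule borel_measurableI_le)
    fix t :: real
    show "{x \<in> space ?J. norm (U x) \<le> t} \<in> sets ?J"
      unfolding norm_blinfun_le_dense[OF dense] by measurable
  qed
  have norm_le: "AE x in ?J. norm (U x) \<le> g x"
    using AE_good by eventually_elim (simp add: U_def \<Phi>(2))
  have mom: "moments_le ?J (\<lambda>x. norm (U x)) C"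
    by (rule moments_le_dominated[OF g(1) norm_m])
       (use norm_le in \<open>auto elim!: eventually_mono intro: order_trans[OF _ abs_ge_self]\<close>)
  have sym: "U (x, y) = U (y, x)" for x y
  proof -
    have R: "R (x, y) = R (y, x)"
      unfolding R_def by (simp add: u(2)[of _ x y] g(2)[of x y] fun_eq_iff)
    have good: "good (x, y) = good (y, x)"
      unfolding good_def R g(2)[of x y] ..
    have "closed {b. blinfun_apply (U (x, y)) b = blinfun_apply (U (y, x)) b}"
      by (intro closed_Collect_eq continuous_intros)
    then have "closure (range d) \<subseteq> {b. blinfun_apply (U (x, y)) b = blinfun_apply (U (y, x)) b}"
      using good u(2)[of _ x y] by (intro closure_minimal) (auto simp: Ud)
    then show ?thesis using dense by (intro blinfun_eqI) auto
  qed
  have graphon: "graphon U"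
    unfolding graphon_def
  proof (intro conjI)
    show "symmetric_on_square U" using sym by (simp add: symmetric_on_square_def)
    show "weak_star_measurable U"
      unfolding weak_star_measurable_def by (intro allI borel_measurable_lebesgue_on_square Ubm)
    show "(\<lambda>u. norm (U u)) \<in> L_all"
      unfolding L_all_def Lp_sym_def
    proof (intro INT_I CollectI conjI)
      fix p :: real assume "p \<in> {1..}"
      then have p: "p \<ge> 1" by simp
      show "symmetric_on_square (\<lambda>u. norm (U u))" using sym by (simp add: symmetric_on_square_def)
      show "(\<lambda>u. norm (U u)) \<in> borel_measurable (lebesgue_on unit_square)"
        by (rule borel_measurable_lebesgue_on_square[OF norm_m])
      have m: "(\<lambda>u. \<bar>norm (U u)\<bar> powr p) \<in> borel_measurable ?J" by measurable
      \<comment> \<open>A real exponent is dominated by the next integer,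
        \<open>t powr p \<le> 1 + t ^ ?q\<close> for \<open>t \<ge> 0\<close>, and constants are
        integrable on the square.\<close>
      let ?q = "nat \<lceil>p\<rceil>"
      have le: "\<bar>norm (U u)\<bar> powr p \<le> 1 + \<bar>norm (U u)\<bar> ^ ?q" for u
      proof (cases "norm (U u) \<le> 1")
        case True
        then have "\<bar>norm (U u)\<bar> powr p \<le> 1 powr p" using p by (intro powr_mono2) auto
        then show ?thesis by (simp add: add_increasing2)
      next
        case False
        then have "\<bar>norm (U u)\<bar> powr p \<le> \<bar>norm (U u)\<bar> powr real ?q"
          using p by (intro powr_mono) (auto intro: real_nat_ceiling_ge)
        also have "\<dots> = \<bar>norm (U u)\<bar> ^ ?q" using False by (intro powr_realpow) auto
        finally show ?thesis by simp
      qed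
      have "integrable ?J (\<lambda>u. \<bar>norm (U u)\<bar> powr p)"
        by (rule Bochner_Integration.integrable_bound[of _ "\<lambda>u. 1 + \<bar>norm (U u)\<bar> ^ ?q"])
           (use moments_leD(2)[OF mom, of ?q] m le in \<open>auto intro!: AE_I2 intro: order_trans[OF _ abs_ge_self]\<close>)
      then show "integrable (lebesgue_on unit_square) (\<lambda>u. \<bar>norm (U u)\<bar> powr p)"
        using integral_lebesgue_on_square(1)[OF m] by blast
    qed
  qed
  have "moments_le (lebesgue_on unit_square) (\<lambda>u. norm (U u)) C"
    using moments_le_lebesgue_on_square[OF norm_m borel_measurable_lebesgue_on_square[OF norm_m]] mom by simp
  then have "graphon_moments_le U C" using graphon by (simp add: graphon_moments_le_def)
  moreover have "AE x in ?J. blinfun_apply (U x) (d j) = u j x" for j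
    using AE_good by eventually_elim (simp add: Ud)
  ultimately show ?thesis by blast
qed

text \<open>For a fixed edge the decorations with convergent density form a closed subspace, so convergence
  spreads from \<open>\<F>\<close> to all of the space edge by edge.\<close>

lemma hom_density_convergence_extends:
  fixes W :: "nat \<Rightarrow> real \<times> real \<Rightarrow> ('b::real_normed_vector \<Rightarrow>\<^sub>L real)"
  assumes W: "\<And>n. graphon_moments_le (W n) C" and U: "graphon_moments_le U C"
    and gen: "generating \<F>" and G: "simple_graph k E"
    and conv: "\<And>f. (\<And>e. e \<in> E \<Longrightarrow> f e \<in> \<F>) \<Longrightarrow> (\<lambda>n. hom_density k E f (W n)) \<longlonglongrightarrow> hom_density k E f U"
  shows "(\<lambda>n. hom_density k E f (W n)) \<longlonglongrightarrow> hom_density k E f U"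
proof -
  \<comment> \<open>\<open>A\<close> collects the edges whose decoration is already unrestricted;
    outside \<open>A\<close> it still lies in \<F>.\<close>
  have "(\<lambda>n. hom_density k E f (W n)) \<longlonglongrightarrow> hom_density k E f U"
    if "A \<subseteq> E" "\<And>e. e \<in> E - A \<Longrightarrow> f e \<in> \<F>" for A f
    using finite_subset[OF that(1) simple_graph_finite[OF G]] that
  proof (induction A arbitrary: f rule: finite_induct)
    case empty
    then show ?case using conv by simp
  next
    case (insert e0 A)
    have e0: "e0 \<in> E" using insert.prems by simp
    define D where "D = {b. (\<lambda>n. hom_density k E (f(e0 := b)) (W n)) \<longlonglongrightarrow> hom_density k E (f(e0 := b)) U}"
    have comb: "s *\<^sub>R a + t *\<^sub>R b \<in> D" if "a \<in> D" "b \<in> D" for s t a b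
      using that unfolding D_def mem_Collect_eq hom_density_linear[OF W G e0] hom_density_linear[OF U G e0]
      by (intro tendsto_intros)
    have "\<F> \<subseteq> D"
    proof
      fix b assume b: "b \<in> \<F>"
      show "b \<in> D" unfolding D_def mem_Collect_eq
        by (rule insert.IH) (use insert.prems b in auto)
    qed
    moreover have "0 \<in> D"
      using hom_density_linear[OF W G e0, of f 0 0 0 0] hom_density_linear[OF U G e0, of f 0 0 0 0]
      by (simp add: D_def)
    then have "subspace D"
      using comb[of _ _ 1 1] comb[of _ 0 _ 0] by (auto simp: subspace_def)
    ultimately have span: "span \<F> \<subseteq> D" by (rule span_minimal)
    have "f e0 \<in> D"
      unfolding D_def mem_Collect_eq
    proof (rule LIMSEQ_I)
      fix \<eta> :: real assume "\<eta> > 0"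
      then have \<eta>: "\<eta> / 4 > 0" by simp
      \<comment> \<open>One radius serves all \<open>W n\<close> and \<open>U\<close>; this
        uniformity permits exchanging the limit in \<open>n\<close> with the approximation of the
        decoration.\<close>
      obtain \<delta> where \<delta>: "\<delta> > 0" and eq: "\<And>V b'. graphon_moments_le V C \<Longrightarrow> dist b' (f e0) < \<delta> \<Longrightarrow>
          \<bar>hom_density k E (f(e0 := b')) V - hom_density k E (f(e0 := f e0)) V\<bar> \<le> \<eta> / 4"
        using hom_density_equicontinuous[OF G e0 \<eta>, of C "f e0" f] by blast
      have "f e0 \<in> closure (span \<F>)" using gen by (simp add: generating_def)
      then obtain b' where b': "b' \<in> span \<F>" "dist b' (f e0) < \<delta>"
        using \<delta> by (auto simp: closure_approachable)
      then have "b' \<in> D" using span by blast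
      then have "(\<lambda>n. hom_density k E (f(e0 := b')) (W n)) \<longlonglongrightarrow> hom_density k E (f(e0 := b')) U"
        by (simp add: D_def)
      from LIMSEQ_D[OF this \<eta>] obtain n0 where n0: "\<And>n. n \<ge> n0 \<Longrightarrow>
          norm (hom_density k E (f(e0 := b')) (W n) - hom_density k E (f(e0 := b')) U) < \<eta> / 4" by blast
      show "\<exists>n0. \<forall>n\<ge>n0. norm (hom_density k E (f(e0 := f e0)) (W n) - hom_density k E (f(e0 := f e0)) U) < \<eta>"
      proof (intro exI[of _ n0] allI impI)
        fix n assume "n \<ge> n0"
        from n0[OF this] eq[OF W[of n] b'(2)] eq[OF U b'(2)] \<open>\<eta> > 0\<close>
        show "norm (hom_density k E (f(e0 := f e0)) (W n) - hom_density k E (f(e0 := f e0)) U) < \<eta>"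
          unfolding real_norm_def by linarith
      qed
    qed
    then show ?case by (simp add: D_def)
  qed
  from this[of E f] show ?thesis by simp
qed

section \<open>Assembling the limit graphon\<close>

theorem theorem3p7:
  fixes \<F> :: "'b::banach set"
    and W :: "nat \<Rightarrow> real \<times> real \<Rightarrow> ('b \<Rightarrow>\<^sub>L real)"
  assumes separable: "separable_space (euclidean :: 'b topology)"
    and "countable \<F>" and "generating \<F>"
    and graphons: "\<And>n. graphon (W n)"
    and finite_range: "\<And>n. finite (W n ` unit_square)"
    and bounded: "\<And>p::real. p \<ge> 1 \<Longrightarrow> \<exists>c>0. \<forall>n. graphon_norm p (W n) \<le> c"
    and conv: "\<And>k E f. decorated_graph \<F> k E f \<Longrightarrow>
      convergent (\<lambda>n. hom_density k E f (W n))"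
  shows "\<exists>U :: real \<times> real \<Rightarrow> ('b \<Rightarrow>\<^sub>L real). graphon U \<and>
    (\<forall>k E f. decorated_graph UNIV k E f \<longrightarrow>
      (\<lambda>n. hom_density k E f (W n)) \<longlonglongrightarrow> hom_density k E f U)"
proof -
  let ?J = lborel_square
  interpret I: prob_space lborel_unit by (rule prob_space_lborel_unit)
  obtain c where c: "\<And>p n. p \<ge> 1 \<Longrightarrow> graphon_norm p (W n) \<le> c p"
    using bounded by metis
  define C where "C = (\<lambda>q. if q = 0 then 1 else c (real q) powr real q)"
  have WC: "graphon_moments_le (W n) C" for n
    unfolding C_def by (rule graphon_moments[OF graphons]) (rule c)
  obtain D :: "'b set" where D: "countable D" "closure D = UNIV"
    using separable by (auto simp: separable_space_def)
  \<comment> \<open>A countable dense set supplies density, and \<F> is adjoined so that the given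
    decorations themselves are among the test vectors.\<close>
  define d where "d = from_nat_into (D \<union> \<F>)"
  have "D \<noteq> {}" using D(2) by auto
  then have range_d: "range d = D \<union> \<F>"
    unfolding d_def using D(1) \<open>countable \<F>\<close> by (intro range_from_nat_into) auto
  have dense: "closure (range d) = UNIV"
    unfolding range_d using closure_mono[of D "D \<union> \<F>"] D(2) by auto
  have "\<exists>h. h \<in> borel_measurable ?J \<and> (\<forall>x y. h (x, y) = h (y, x)) \<and> (AE u in ?J. norm (W n u) = h u)" for n
  proof -
    have "(\<lambda>u. norm (W n u)) \<in> Lp_sym 1"
      using graphons[of n] by (intro L_allD) (simp_all add: graphon_def)
    from symmetric_borel_version[OF Lp_symD(1,3)[OF this]] show ?thesis by (simp only: Bex_def)
  qed
  then have "\<forall>n. \<exists>h. h \<in> borel_measurable ?J \<and> (\<forall>x y. h (x, y) = h (y, x)) \<and> (AE u in ?J. norm (W n u) = h u)"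
    by (rule allI)
  from choice[OF this] obtain N where "\<forall>n. N n \<in> borel_measurable ?J \<and> (\<forall>x y. N n (x, y) = N n (y, x)) \<and>
      (AE u in ?J. norm (W n u) = N n u)" by (elim exE)
  then have N: "\<And>n. N n \<in> borel_measurable ?J" "\<And>n x y. N n (x, y) = N n (y, x)"
      "\<And>n. AE u in ?J. norm (W n u) = N n u"
    by (simp_all only:)
  have N_mom: "moments_le ?J (N n) C" for n
    using moments_le_lebesgue_on_square[OF N(1) _ N(3)] WC[of n] moments_leD(1)
    unfolding graphon_moments_le_def by blast
  \<comment> \<open>Index 0 is reserved for the norm, so that it takes part in the same linear
    inequalities as the pairings.\<close>
  define w where "w = (\<lambda>i n. case i of 0 \<Rightarrow> N n | Suc j \<Rightarrow> borel_kernel (W n) (d j))"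
  define C' where "C' = (\<lambda>i q. case i of 0 \<Rightarrow> C q | Suc j \<Rightarrow> norm (d j) ^ q * C q)"
  have w_mom: "moments_le ?J (w i n) (C' i)" for i n
    using N_mom borel_kernel_moments[OF WC] by (cases i) (auto simp: w_def C'_def)
  have w_sym: "w i n (x, y) = w i n (y, x)" for i n x y
    using N(2)[of n x y] borel_kernel(2)[OF WC[of n], of _ x y] by (cases i) (auto simp: w_def)
  obtain r u where r: "strict_mono (r :: nat \<Rightarrow> nat)"
    and u: "\<And>i. moments_le ?J (u i) (C' i)" and u_sym: "\<And>i x y. u i (x, y) = u i (y, x)"
    and u_conv: "\<And>k E \<iota>. simple_graph k E \<Longrightarrow> (\<lambda>n. graph_density lborel_unit k E (\<lambda>e. w (\<iota> e) (r n)))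
      \<longlonglongrightarrow> graph_density lborel_unit k E (\<lambda>e. u (\<iota> e))"
    and u_pos: "\<And>S s. finite S \<Longrightarrow> (\<And>n. AE x in ?J. 0 \<le> (\<Sum>i\<in>S. s i * w i n x)) \<Longrightarrow>
      AE x in ?J. 0 \<le> (\<Sum>i\<in>S. s i * u i x)"
    by (rule I.kernel_compactness[of w C', OF w_mom w_sym]) blast
  have "\<exists>U :: real \<times> real \<Rightarrow> ('b \<Rightarrow>\<^sub>L real). graphon_moments_le U C \<and>
      (\<forall>j. AE x in ?J. blinfun_apply (U x) (d j) = u (Suc j) x)"
  proof (rule dual_valued_kernel[OF dense, where g = "u 0"])
    show "u (Suc j) \<in> borel_measurable ?J" for j by (rule moments_leD(1)[OF u])
    show "moments_le ?J (u 0) C" using u[of 0] by (simp add: C'_def)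
    have "AE x in ?J. 0 \<le> N n x" for n using N(3)[of n] by eventually_elim (metis norm_ge_zero)
    then show "AE x in ?J. 0 \<le> u 0 x" using u_pos[of "{0}" "\<lambda>_. 1"] by (simp add: w_def)
    fix a b c :: nat and q1 q2 :: rat
    let ?\<beta> = "norm (of_rat q1 *\<^sub>R d a + of_rat q2 *\<^sub>R d b - d c)"
    let ?S = "{0, Suc a, Suc b, Suc c}"
    \<comment> \<open>Coefficients of a linear form in which the signs \<open>\<sigma> = 1\<close>
      and \<open>\<sigma> = -1\<close> together encode an absolute value. Indicators are added up
      because \<open>a\<close>, \<open>b\<close> and \<open>c\<close> may coincide.\<close>
    define s where "s = (\<lambda>\<sigma> i. ?\<beta> * of_bool (i = 0) + \<sigma> * (of_rat q1 * of_bool (i = Suc a)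
      + of_rat q2 * of_bool (i = Suc b) - of_bool (i = Suc c)))"
    have sum: "(\<Sum>i\<in>?S. s \<sigma> i * y i) = ?\<beta> * y 0 + \<sigma> * (of_rat q1 * y (Suc a) + of_rat q2 * y (Suc b) - y (Suc c))"
      for \<sigma> and y :: "nat \<Rightarrow> real"
    proof -
      have pick: "(\<Sum>i\<in>?S. of_bool (i = l) * y i) = y l" if "l \<in> ?S" for l
      proof -
        have "(\<Sum>i\<in>?S. of_bool (i = l) * y i) = (\<Sum>i\<in>{l}. of_bool (i = l) * y i)"
          by (rule sum.mono_neutral_right) (use that in auto)
        then show ?thesis by simp
      qed
      have pick0: "(\<Sum>i\<in>?S. of_bool (i = 0) * y i) = y 0" by (rule pick) blast
      have picka: "(\<Sum>i\<in>?S. of_bool (i = Suc a) * y i) = y (Suc a)" by (rule pick) blast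
      have pickb: "(\<Sum>i\<in>?S. of_bool (i = Suc b) * y i) = y (Suc b)" by (rule pick) blast
      have pickc: "(\<Sum>i\<in>?S. of_bool (i = Suc c) * y i) = y (Suc c)" by (rule pick) blast
      have "(\<Sum>i\<in>?S. s \<sigma> i * y i) = (\<Sum>i\<in>?S. ?\<beta> * (of_bool (i = 0) * y i)
          + \<sigma> * (of_rat q1 * (of_bool (i = Suc a) * y i) + of_rat q2 * (of_bool (i = Suc b) * y i) - of_bool (i = Suc c) * y i))"
        by (rule sum.cong[OF refl]) (simp add: s_def algebra_simps)
      also have "\<dots> = ?\<beta> * (\<Sum>i\<in>?S. of_bool (i = 0) * y i) + \<sigma> * (of_rat q1 * (\<Sum>i\<in>?S. of_bool (i = Suc a) * y i)
          + of_rat q2 * (\<Sum>i\<in>?S. of_bool (i = Suc b) * y i) - (\<Sum>i\<in>?S. of_bool (i = Suc c) * y i))"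
        by (simp only: sum.distrib sum_subtractf sum_distrib_left[symmetric])
      also have "\<dots> = ?\<beta> * y 0 + \<sigma> * (of_rat q1 * y (Suc a) + of_rat q2 * y (Suc b) - y (Suc c))"
        by (simp only: pick0 picka pickb pickc)
      finally show ?thesis .
    qed
    have "AE x in ?J. 0 \<le> (\<Sum>i\<in>?S. s \<sigma> i * u i x)" if \<sigma>: "\<bar>\<sigma>\<bar> = 1" for \<sigma>
    proof (rule u_pos)
      fix n
      show "AE x in ?J. 0 \<le> (\<Sum>i\<in>?S. s \<sigma> i * w i n x)"
        using N(3)[of n] borel_kernel(3)[OF WC[of n], of "d a"] borel_kernel(3)[OF WC[of n], of "d b"]
          borel_kernel(3)[OF WC[of n], of "d c"]
      proof eventually_elim
        case (elim x)
        let ?t = "of_rat q1 * w (Suc a) n x + of_rat q2 * w (Suc b) n x - w (Suc c) n x"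
        have "?t = blinfun_apply (W n x) (of_rat q1 *\<^sub>R d a + of_rat q2 *\<^sub>R d b - d c)"
          using elim by (simp add: w_def blinfun.add_right blinfun.diff_right blinfun.scaleR_right)
        then have "\<bar>?t\<bar> \<le> ?\<beta> * w 0 n x"
          using norm_blinfun[of "W n x" "of_rat q1 *\<^sub>R d a + of_rat q2 *\<^sub>R d b - d c"] elim(1)
          by (simp add: w_def mult.commute)
        moreover have "\<bar>\<sigma> * ?t\<bar> = \<bar>?t\<bar>" using \<sigma> by (simp add: abs_mult)
        ultimately show ?case unfolding sum by linarith
      qed
    qed simp
    from this[of 1] this[of "-1"] show "AE x in ?J. \<bar>of_rat q1 * u (Suc a) x + of_rat q2 * u (Suc b) x - u (Suc c) x\<bar> \<le> ?\<beta> * u 0 x"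
      unfolding sum by (auto elim!: eventually_elim2)
  qed (rule u_sym)+
  then obtain U :: "real \<times> real \<Rightarrow> ('b \<Rightarrow>\<^sub>L real)" where U: "graphon_moments_le U C"
    and Uu: "\<And>j. AE x in ?J. blinfun_apply (U x) (d j) = u (Suc j) x" by blast
  show ?thesis
  proof (intro exI[of _ U] conjI allI impI)
    show "graphon U" using U by (simp add: graphon_moments_le_def)
    fix k E and f :: "nat set \<Rightarrow> 'b"
    assume "decorated_graph UNIV k E f"
    then have G: "simple_graph k E" by (simp add: decorated_graph_def)
    show "(\<lambda>n. hom_density k E f (W n)) \<longlonglongrightarrow> hom_density k E f U"
    proof (rule hom_density_convergence_extends[OF WC U \<open>generating \<F>\<close> G])
      fix f assume f: "\<And>e. e \<in> E \<Longrightarrow> f e \<in> \<F>"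
      then have "\<forall>e\<in>E. \<exists>j. f e = d j" using range_d by blast
      then obtain \<iota> where \<iota>: "\<And>e. e \<in> E \<Longrightarrow> f e = d (\<iota> e)" by metis
      have "hom_density k E f (W (r n)) = graph_density lborel_unit k E (\<lambda>e. w (Suc (\<iota> e)) (r n))" for n
      proof (rule hom_density_eq[OF G])
        fix e assume e: "e \<in> E"
        show "w (Suc (\<iota> e)) (r n) \<in> borel_measurable ?J"
          by (simp add: w_def borel_kernel(1)[OF WC])
        show "AE x in ?J. blinfun_apply (W (r n) x) (f e) = w (Suc (\<iota> e)) (r n) x"
          using borel_kernel(3)[OF WC[of "r n"], of "d (\<iota> e)"] by (simp only: w_def nat.case \<iota>[OF e])
      qed
      moreover have "hom_density k E f U = graph_density lborel_unit k E (\<lambda>e. u (Suc (\<iota> e)))"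
      proof (rule hom_density_eq[OF G])
        fix e assume e: "e \<in> E"
        show "u (Suc (\<iota> e)) \<in> borel_measurable ?J" by (rule moments_leD(1)[OF u])
        show "AE x in ?J. blinfun_apply (U x) (f e) = u (Suc (\<iota> e)) x"
          unfolding \<iota>[OF e] by (rule Uu)
      qed
      ultimately have sub: "(\<lambda>n. hom_density k E f (W (r n))) \<longlonglongrightarrow> hom_density k E f U"
        using u_conv[OF G, of "\<lambda>e. Suc (\<iota> e)"] by (simp only:)
      have "convergent (\<lambda>n. hom_density k E f (W n))"
        by (rule conv) (use G f in \<open>simp add: decorated_graph_def\<close>)
      then obtain l where l: "(\<lambda>n. hom_density k E f (W n)) \<longlonglongrightarrow> l" by (auto simp: convergent_def)
      \<comment> \<open>The full sequence converges by hypothesis, so its limit \<open>l\<close> is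
        the one already found along the subsequence.\<close>
      have "(\<lambda>n. hom_density k E f (W (r n))) \<longlonglongrightarrow> l"
        using LIMSEQ_subseq_LIMSEQ[OF l r] by (simp only: o_def)
      from LIMSEQ_unique[OF this sub] show "(\<lambda>n. hom_density k E f (W n)) \<longlonglongrightarrow> hom_density k E f U"
        using l by (simp only:)
    qed
  qed
qed

end
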